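(* For any $3$-tensor $T$ over any perfect field $\mathbb{F}$, $\mathrm{SR}(T)\le 3\,\mathrm{GR}(T)$.
   Context: A $3$-tensor $T=(a_{i,j,k})\in\mathbb{F}^{n_1\times n_2\times n_3}$ is identified with the trilinear form $T(\mathbf{x},\mathbf{y},\mathbf{z})=\sum a_{i,j,k}x_iy_jz_k$ and the bilinear map $f\colon\mathbb{F}^{n_1}\times\mathbb{F}^{n_2}\to\mathbb{F}^{n_3}$, $f_k(\mathbf{x},\mathbf{y})=\sum_{i,j}a_{i,j,k}x_iy_j$. $\mathrm{SR}(T)$ (slice rank) is the least $r$ with $T=\sum_{i=1}^r\ell_ih_i$, each $\ell_i$ a linear form over $\mathbb{F}$ in one of $\mathbf{x},\mathbf{y},\mathbf{z}$ and $h_i$ a bilinear form over $\mathbb{F}$ in the other two. $\mathrm{GR}(T)$ (geometric rank) is the codimension of the variety $\{(\mathbf{x},\mathbf{y})\in\overline{\mathbb{F}}^{n_1}\times\overline{\mathbb{F}}^{n_2}: f(\mathbf{x},\mathbf{y})=\mathbf{0}\}$ in $\overline{\mathbb{F}}^{n_1+n_2}$. *)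

theory Defs
  imports
    "HOL-Analysis.Cartesian_Space"
    "HOL-Algebra.Algebraic_Closure_Type"
    "HOL-Library.Poly_Mapping"
    "HOL-Library.Extended_Nat"
begin

section \<open>Perfect fields\<close>

text \<open>A field is perfect if every irreducible polynomial over it is separable,
  i.e. has only simple roots in the algebraic closure.\<close>

definition perfect_field :: "'a::field itself \<Rightarrow> bool" where
  "perfect_field _ \<longleftrightarrow>
     (\<forall>p :: 'a poly. Factorial_Ring.irreducible p \<longrightarrow> rsquarefree (map_poly to_ac p))"


section \<open>Dimension and codimension in affine space\<close>

text \<open>Polynomials in variables indexed by \<open>'n\<close> are finitely supported maps from exponent vectors
  to coefficients.\<close>

definition mpoly_eval :: "(('n::finite \<Rightarrow>\<^sub>0 nat) \<Rightarrow>\<^sub>0 'k::comm_ring_1) \<Rightarrow> 'k ^ 'n \<Rightarrow> 'k" where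
  "mpoly_eval p v =
     (\<Sum>m\<in>Poly_Mapping.keys p.
        Poly_Mapping.lookup p m * (\<Prod>i\<in>UNIV. (v $ i) ^ Poly_Mapping.lookup m i))"

definition zariski_closed :: "('k::comm_ring_1 ^ 'n::finite) set \<Rightarrow> bool" where
  "zariski_closed Z \<longleftrightarrow>
     (\<exists>P :: (('n \<Rightarrow>\<^sub>0 nat) \<Rightarrow>\<^sub>0 'k) set. Z = {v. \<forall>p\<in>P. mpoly_eval p v = 0})"

definition irreducible_closed :: "('k::comm_ring_1 ^ 'n::finite) set \<Rightarrow> bool" where
  "irreducible_closed Z \<longleftrightarrow> zariski_closed Z \<and> Z \<noteq> {} \<and>
     (\<forall>A B. zariski_closed A \<and> zariski_closed B \<and> Z = A \<union> B \<longrightarrow> Z = A \<or> Z = B)"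

text \<open>The dimension of an algebraic set is the supremum of the lengths of strictly increasing
  chains of irreducible closed subsets. The definition is meant for nonempty sets only
  (the empty set would get dimension 0).\<close>

definition variety_dim :: "('k::comm_ring_1 ^ 'n::finite) set \<Rightarrow> enat" where
  "variety_dim V =
     Sup {enat d | d. \<exists>Z :: nat \<Rightarrow> ('k ^ 'n) set.
        (\<forall>i\<le>d. irreducible_closed (Z i) \<and> Z i \<subseteq> V) \<and> (\<forall>i<d. Z i \<subset> Z (Suc i))}"

definition variety_codim :: "('k::comm_ring_1 ^ 'n::finite) set \<Rightarrow> enat" where
  "variety_codim V = enat CARD('n) - variety_dim V"


section \<open>Tensors\<close>

text \<open>The coefficient \<open>a\<^sub>i\<^sub>j\<^sub>k\<close> of a tensor \<open>T\<close> is \<open>T $ i $ j $ k\<close>.\<close>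

type_synonym ('a, 'n1, 'n2, 'n3) tensor3 = "'a ^ 'n3 ^ 'n2 ^ 'n1"

definition trilinear_form ::
  "('a::comm_ring_1, 'n1::finite, 'n2::finite, 'n3::finite) tensor3 \<Rightarrow>
     'a ^ 'n1 \<Rightarrow> 'a ^ 'n2 \<Rightarrow> 'a ^ 'n3 \<Rightarrow> 'a" where
  "trilinear_form T x y z =
     (\<Sum>i\<in>UNIV. \<Sum>j\<in>UNIV. \<Sum>k\<in>UNIV. T $ i $ j $ k * x $ i * y $ j * z $ k)"

definition bilinear_map ::
  "('a::comm_ring_1, 'n1::finite, 'n2::finite, 'n3::finite) tensor3 \<Rightarrow>
     'a ^ 'n1 \<Rightarrow> 'a ^ 'n2 \<Rightarrow> 'a ^ 'n3" where
  "bilinear_map T x y = (\<chi> k. \<Sum>i\<in>UNIV. \<Sum>j\<in>UNIV. T $ i $ j $ k * x $ i * y $ j)"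


section \<open>Slice rank\<close>

definition linear_form :: "('a::field ^ 'n::finite \<Rightarrow> 'a) \<Rightarrow> bool" where
  "linear_form l \<longleftrightarrow> Vector_Spaces.linear (*s) (*) l"

definition bilinear_form :: "('a::field ^ 'm::finite \<Rightarrow> 'a ^ 'n::finite \<Rightarrow> 'a) \<Rightarrow> bool" where
  "bilinear_form h \<longleftrightarrow> (\<forall>y. linear_form (h y)) \<and> (\<forall>z. linear_form (\<lambda>y. h y z))"

definition is_slice ::
  "('a::field ^ 'n1::finite \<Rightarrow> 'a ^ 'n2::finite \<Rightarrow> 'a ^ 'n3::finite \<Rightarrow> 'a) \<Rightarrow> bool" where
  "is_slice S \<longleftrightarrow>
     (\<exists>l h. linear_form l \<and> bilinear_form h \<and> S = (\<lambda>x y z. l x * h y z)) \<or>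
     (\<exists>l h. linear_form l \<and> bilinear_form h \<and> S = (\<lambda>x y z. l y * h x z)) \<or>
     (\<exists>l h. linear_form l \<and> bilinear_form h \<and> S = (\<lambda>x y z. l z * h x y))"

definition slice_rank ::
  "('a::field, 'n1::finite, 'n2::finite, 'n3::finite) tensor3 \<Rightarrow> nat" where
  "slice_rank T = (LEAST r. \<exists>S :: nat \<Rightarrow> 'a ^ 'n1 \<Rightarrow> 'a ^ 'n2 \<Rightarrow> 'a ^ 'n3 \<Rightarrow> 'a.
     (\<forall>s<r. is_slice (S s)) \<and> trilinear_form T = (\<lambda>x y z. \<Sum>s<r. S s x y z))"


section \<open>Geometric rank\<close>

definition tensor_to_ac ::
  "('a::field, 'n1::finite, 'n2::finite, 'n3::finite) tensor3 \<Rightarrow>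
     ('a alg_closure, 'n1, 'n2, 'n3) tensor3" where
  "tensor_to_ac T = (\<chi> i j k. to_ac (T $ i $ j $ k))"

text \<open>A pair \<open>(x, y)\<close> is encoded as a single vector indexed by the disjoint sum of the two
  index types.\<close>

definition kernel_variety ::
  "('a::field, 'n1::finite, 'n2::finite, 'n3::finite) tensor3 \<Rightarrow>
     ('a alg_closure ^ ('n1 + 'n2)) set" where
  "kernel_variety T =
     {v. bilinear_map (tensor_to_ac T) (\<chi> i. v $ Inl i) (\<chi> j. v $ Inr j) = 0}"

definition geometric_rank ::
  "('a::field, 'n1::finite, 'n2::finite, 'n3::finite) tensor3 \<Rightarrow> enat" where
  "geometric_rank T = variety_codim (kernel_variety T)"

end

theory Submission
  imports
    Defs
    "HOL-Library.Function_Algebras"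
    "HOL-Analysis.Cartesian_Euclidean_Space"
begin

text \<open>
  Let \<open>K\<close> be the algebraic closure of \<open>F\<close>, let \<open>A(x)\<close> be the matrix of the linear map \<open>f(x, -)\<close>, let
  \<open>Z\<close> be an irreducible closed subset of the kernel variety of dimension \<open>d\<close>, let \<open>r\<close> be the rank of
  \<open>A(x)\<close> at a generic point \<open>(x, y)\<close> of \<open>Z\<close>, and let \<open>L\<close> be the tangent space at \<open>x\<close> of the closure of
  the projection of \<open>Z\<close> to the \<open>x\<close>-space. As \<open>y\<close> satisfies \<open>r\<close> independent linear equations over
  \<open>K(x)\<close>, the codimension \<open>c\<close> of \<open>L\<close> satisfies \<open>c + r \<le> n\<^sub>1 + n\<^sub>2 - d\<close>. Differentiating the identities
  \<open>A(x) u(x) = 0\<close>, where \<open>u\<close> runs through polynomial vectors that span the kernel of \<open>A(x)\<close> generically,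
  shows that \<open>A(v)\<close> maps the kernel of \<open>A(x)\<close> into the image of \<open>A(x)\<close> for all \<open>v \<in> L\<close>. Hence \<open>T\<close> vanishes
  on a product of subspaces over \<open>K\<close> of codimensions \<open>c, r, r\<close>.

  The passage from \<open>K\<close> to \<open>F\<close> costs a factor \<open>3/2\<close>. Relax subspaces to weighted bases
  \<open>(e\<^sub>i, a\<^sub>i), (e'\<^sub>j, a'\<^sub>j), (e''\<^sub>k, a''\<^sub>k)\<close> such that \<open>T(e\<^sub>i, e'\<^sub>j, e''\<^sub>k) \<noteq> 0\<close> implies
  \<open>a\<^sub>i + a'\<^sub>j + a''\<^sub>k \<ge> 1\<close>, and minimise a strictly convex perturbation of the total weight. Any two flags have
  a common adapted basis, on which weights can be averaged; hence the flags of a minimiser are unique,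
  thus invariant under all endomorphisms of \<open>K\<close> over \<open>F\<close>, and therefore defined over \<open>F\<close> because \<open>F\<close> is perfect.
  Cutting them at random thresholds yields subspaces over \<open>F\<close> of total codimension at most \<open>3/2\<close> of
  the total weight. So the slice rank is at most \<open>3/2 (c + 2r) \<le> 3 (c + r)\<close>.
\<close>

text \<open>The subspaces found over K depend on the choice of a generic point, so endomorphisms of
  K move them, and intersecting or adding conjugates destroys the codimension. Weights can be
  averaged where subspaces cannot; this is why the problem is relaxed before the descent and rounded
  after it. The total weight is linear, so its minimiser need not be unique; a quadratic term with
  coefficient \<epsilon> repairs this at the price of a factor 1 + \<epsilon>. The constant 3 is 3/2
  times the 2 in c + 2r \<le> 2 (c + r): the number r is paid in the second and in the third
  argument, but counts once in the codimension. No function field is constructed; dimensions are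
  obtained by counting. Up to a common denominator, the polynomials of degree at most D span on Z a
  space of dimension O(D^t), whereas a chain of length d supplies independent functions in number of
  order D^d. Generic points are those where a suitable polynomial, not identically zero on Z, is
  nonzero. When coordinates are added one at a time, each raises by one either t or the number c of
  tangent equations.\<close>

no_notation fps_nth (infixl "$" 75)

section \<open>Endomorphisms of the algebraic closure of a perfect field\<close>

definition ac_endo :: "('a::field alg_closure \<Rightarrow> 'a alg_closure) \<Rightarrow> bool" where
  "ac_endo \<sigma> \<longleftrightarrow> (\<forall>x y. \<sigma> (x + y) = \<sigma> x + \<sigma> y) \<and> (\<forall>x y. \<sigma> (x * y) = \<sigma> x * \<sigma> y) \<and>
     (\<forall>c. \<sigma> (to_ac c) = to_ac c)"

text \<open>A partial endomorphism is represented by its graph, a subring of the product ring.\<close>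

definition partial_endo :: "('a::field alg_closure \<times> 'a alg_closure) set \<Rightarrow> bool" where
  "partial_endo G \<longleftrightarrow> (\<forall>c. (to_ac c, to_ac c) \<in> G) \<and>
     (\<forall>x y x' y'. (x, y) \<in> G \<longrightarrow> (x', y') \<in> G \<longrightarrow> (x + x', y + y') \<in> G \<and> (x * x', y * y') \<in> G) \<and>
     (\<forall>y. (0, y) \<in> G \<longrightarrow> y = 0)"

text \<open>With \<open>G\<close> the graph of a map, \<open>q\<close> arises from \<open>p\<close>
  by applying the map to the coefficients.\<close>

definition coeffs_related :: "('k::zero \<times> 'k) set \<Rightarrow> 'k poly \<Rightarrow> 'k poly \<Rightarrow> bool" where
  "coeffs_related G p q \<longleftrightarrow> (\<forall>i. (Polynomial.coeff p i, Polynomial.coeff q i) \<in> G)"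

lemma partial_endo_to_ac: "partial_endo G \<Longrightarrow> (to_ac c, to_ac c) \<in> G"
  and partial_endo_add: "partial_endo G \<Longrightarrow> (x, y) \<in> G \<Longrightarrow> (x', y') \<in> G \<Longrightarrow> (x + x', y + y') \<in> G"
  and partial_endo_mult: "partial_endo G \<Longrightarrow> (x, y) \<in> G \<Longrightarrow> (x', y') \<in> G \<Longrightarrow> (x * x', y * y') \<in> G"
  and partial_endo_0: "partial_endo G \<Longrightarrow> (0, y) \<in> G \<Longrightarrow> y = 0"
  by (auto simp: partial_endo_def)

lemma partial_endo_zero: "partial_endo G \<Longrightarrow> (0, 0) \<in> G"
  using partial_endo_to_ac[of G 0] by simp

lemma partial_endo_uminus: "partial_endo G \<Longrightarrow> (x, y) \<in> G \<Longrightarrow> (- x, - y) \<in> G"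
  using partial_endo_mult[of G "to_ac (-1)" "to_ac (-1)" x y] partial_endo_to_ac[of G "-1"] by simp

lemma partial_endo_diff:
  "partial_endo G \<Longrightarrow> (x, y) \<in> G \<Longrightarrow> (x', y') \<in> G \<Longrightarrow> (x - x', y - y') \<in> G"
  using partial_endo_add[OF _ _ partial_endo_uminus, of G x y x' y'] by simp

lemma partial_endo_unique:
  "partial_endo G \<Longrightarrow> (x, y) \<in> G \<Longrightarrow> (x, y') \<in> G \<Longrightarrow> y = y'"
  using partial_endo_diff[of G x y x y'] partial_endo_0 by fastforce

lemma partial_endo_sum:
  assumes "partial_endo G" "\<And>i. i \<in> I \<Longrightarrow> (f i, g i) \<in> G"
  shows "(sum f I, sum g I) \<in> G"
  using assms(2)
  by (induction I rule: infinite_finite_induct)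
     (auto intro: partial_endo_zero partial_endo_add assms(1))

lemma coeffs_related_poly:
  assumes G: "partial_endo G" and "coeffs_related G p q" "(x, y) \<in> G"
  shows "(poly p x, poly q y) \<in> G"
proof -
  have "(poly p x, poly q y) \<in> G" if "\<And>i. (Polynomial.coeff p i, Polynomial.coeff q i) \<in> G" for p q
    using that
  proof (induction p arbitrary: q)
    case 0
    hence "q = 0"
      using partial_endo_0[OF G] by (auto simp: poly_eq_iff)
    thus ?case by (simp add: partial_endo_zero[OF G])
  next
    case (pCons a p)
    obtain b q' where q: "q = pCons b q'" by (cases q)
    have "(a, b) \<in> G" using pCons.prems[of 0] q by simp
    moreover have "(poly p x, poly q' y) \<in> G"
      using pCons.IH pCons.prems[of "Suc _"] q by simp
    ultimately show ?case
      using partial_endo_add[OF G] partial_endo_mult[OF G assms(3)] q by simp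
  qed
  thus ?thesis using assms(2) by (auto simp: coeffs_related_def)
qed

lemma coeffs_related_diff:
  "partial_endo G \<Longrightarrow> coeffs_related G p q \<Longrightarrow> coeffs_related G p' q' \<Longrightarrow>
    coeffs_related G (p - p') (q - q')"
  by (auto simp: coeffs_related_def partial_endo_diff)

lemma coeffs_related_add:
  "partial_endo G \<Longrightarrow> coeffs_related G p q \<Longrightarrow> coeffs_related G p' q' \<Longrightarrow>
    coeffs_related G (p + p') (q + q')"
  by (auto simp: coeffs_related_def partial_endo_add)

lemma coeffs_related_mult:
  "partial_endo G \<Longrightarrow> coeffs_related G p q \<Longrightarrow> coeffs_related G p' q' \<Longrightarrow>
    coeffs_related G (p * p') (q * q')"
  by (auto simp: coeffs_related_def Polynomial.coeff_mult intro!: partial_endo_sum partial_endo_mult)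

lemma coeffs_related_monom:
  "partial_endo G \<Longrightarrow> (a, b) \<in> G \<Longrightarrow> coeffs_related G (Polynomial.monom a k) (Polynomial.monom b k)"
  by (auto simp: coeffs_related_def partial_endo_zero)

lemma coeffs_related_map_poly:
  "partial_endo G \<Longrightarrow> coeffs_related G (map_poly to_ac p) (map_poly to_ac p)"
  by (auto simp: coeffs_related_def coeff_map_poly partial_endo_to_ac)

lemma alg_closure_minimal_poly:
  fixes x :: "'a::field alg_closure"
  obtains p :: "'a poly" where "p \<noteq> 0" "poly (map_poly to_ac p) x = 0"
    "\<And>q. q \<noteq> 0 \<Longrightarrow> poly (map_poly to_ac q) x = 0 \<Longrightarrow> Polynomial.degree p \<le> Polynomial.degree q"
proof -
  define P where "P = (\<lambda>p :: 'a poly. p \<noteq> 0 \<and> poly (map_poly to_ac p) x = 0)"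
  have "\<exists>p. P p" using alg_closure_algebraic[of x] by (auto simp: P_def)
  then obtain p where "P p" "\<And>q. P q \<Longrightarrow> Polynomial.degree p \<le> Polynomial.degree q"
    using ex_has_least_nat[of P _ Polynomial.degree] by blast
  thus ?thesis using that by (auto simp: P_def)
qed

text \<open>The domain is a ring, not yet a field, so injectivity needs algebraicity: if a nonzero x
  maps to 0, the equation p(x) = 0 for its minimal polynomial p maps to p(0) = 0, and p can be
  divided by its variable.\<close>

lemma partial_endo_inj:
  assumes G: "partial_endo G" and "(x, 0) \<in> G"
  shows "x = 0"
proof (rule ccontr)
  assume x: "x \<noteq> 0"
  obtain p where p: "p \<noteq> 0" "poly (map_poly to_ac p) x = 0"
    and min: "\<And>q. q \<noteq> 0 \<Longrightarrow> poly (map_poly to_ac q) x = 0 \<Longrightarrow> Polynomial.degree p \<le> Polynomial.degree q"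
    using alg_closure_minimal_poly[of x] by metis
  have "(0, to_ac (Polynomial.coeff p 0)) \<in> G"
    using coeffs_related_poly[OF G coeffs_related_map_poly[OF G, of p] assms(2)] p
    by (simp add: poly_0_coeff_0 coeff_map_poly)
  hence c0: "Polynomial.coeff p 0 = 0" using partial_endo_0[OF G] to_ac_eq_0_iff by blast
  obtain a q where q: "p = pCons a q" by (cases p)
  with c0 p have "a = 0" "q \<noteq> 0" by auto
  moreover have "poly (map_poly to_ac q) x = 0"
    using p q x \<open>a = 0\<close> by (simp add: map_poly_pCons)
  ultimately show False using min[of q] q by simp
qed

text \<open>A simple extension over a ring. The least-degree relation \<open>m\<close> need not be
  monic, so pseudo-division shows that p(c) determines q(d); it can be undone because the image of
  the leading coefficient of \<open>m\<close> is nonzero by injectivity.\<close>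

lemma partial_endo_extend:
  assumes G: "partial_endo G" and m: "coeffs_related G m m'" "m \<noteq> 0" "poly m c = 0" "poly m' d = 0"
    and min: "\<And>p q. coeffs_related G p q \<Longrightarrow> p \<noteq> 0 \<Longrightarrow> poly p c = 0 \<Longrightarrow>
                Polynomial.degree m \<le> Polynomial.degree p"
  shows "\<exists>G'. partial_endo G' \<and> G \<subseteq> G' \<and> (c, d) \<in> G'"
proof -
  define n where "n = Polynomial.degree m"
  have n: "n > 0"
    using m by (auto simp: n_def elim!: degree_eq_zeroE intro!: Nat.gr0I)
  have lead: "Polynomial.coeff m' n \<noteq> 0"
    using m(1,2) partial_endo_inj[OF G, of "Polynomial.coeff m n"]
    by (auto simp: coeffs_related_def n_def) (metis leading_coeff_0_iff)
  have wd: "poly q d = 0" if "coeffs_related G p q" "poly p c = 0" for p q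
    using that
  proof (induction "Polynomial.degree p" arbitrary: p q rule: less_induct)
    case less
    show ?case
    proof (cases "p = 0")
      case True
      hence "q = 0"
        using less.prems(1) partial_endo_0[OF G] by (auto simp: poly_eq_iff coeffs_related_def)
      thus ?thesis by simp
    next
      case False
      define N where "N = Polynomial.degree p"
      have nN: "n \<le> N" using min[OF less.prems(1) False less.prems(2)] by (simp add: n_def N_def)
      \<comment> \<open>The leading terms cancel in \<open>p2\<close>, and \<open>q2\<close> is its
        image. As \<open>m'\<close> vanishes at \<open>d\<close>, the value of \<open>q2\<close>
        there is that of \<open>q\<close> times the nonzero coefficient of \<open>m'\<close> in
        degree \<open>n\<close>.\<close>
      define p2 where "p2 = Polynomial.monom (Polynomial.coeff m n) 0 * p -
        Polynomial.monom (Polynomial.coeff p N) (N - n) * m"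
      define q2 where "q2 = Polynomial.monom (Polynomial.coeff m' n) 0 * q -
        Polynomial.monom (Polynomial.coeff q N) (N - n) * m'"
      have rel: "coeffs_related G p2 q2"
        unfolding p2_def q2_def
        using m(1) less.prems(1)
        by (intro coeffs_related_diff coeffs_related_mult coeffs_related_monom G)
           (auto simp: coeffs_related_def)
      have "Polynomial.degree p2 \<le> N"
        unfolding p2_def
      proof (rule degree_diff_le)
        show "Polynomial.degree (Polynomial.monom (Polynomial.coeff m n) 0 * p) \<le> N"
          by (simp add: monom_0 N_def degree_smult_le)
        have "Polynomial.degree (Polynomial.monom (Polynomial.coeff p N) (N - n) * m) \<le> (N - n) + n"
          unfolding n_def by (rule order.trans[OF degree_mult_le add_mono[OF degree_monom_le order.refl]])
        thus "Polynomial.degree (Polynomial.monom (Polynomial.coeff p N) (N - n) * m) \<le> N"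
          using nN by simp
      qed
      moreover have "Polynomial.coeff p2 N = 0"
        using nN by (simp add: p2_def coeff_monom_mult)
      ultimately have "Polynomial.degree p2 < Polynomial.degree p"
        using n nN unfolding N_def[symmetric]
        by (metis degree_0 leading_coeff_0_iff order_le_less order_less_le_trans)
      moreover have "poly p2 c = 0" using m less.prems by (simp add: p2_def)
      ultimately have "poly q2 d = 0" using less.hyps rel by blast
      thus ?thesis using m lead by (simp add: q2_def poly_monom)
    qed
  qed
  define G' where "G' = {(poly p c, poly q d) | p q. coeffs_related G p q}"
  have "(x, y) \<in> G'" if "(x, y) \<in> G" for x y
    using coeffs_related_monom[OF G that, of 0] unfolding G'_def
    by (auto simp: poly_monom intro!: exI[of _ "Polynomial.monom _ 0"])
  moreover have "(c, d) \<in> G'"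
    using coeffs_related_monom[OF G partial_endo_to_ac[OF G, of 1], of 1] unfolding G'_def
    by (auto simp: poly_monom intro!: exI[of _ "Polynomial.monom _ 1"])
  moreover have "partial_endo G'"
    unfolding partial_endo_def
  proof (intro conjI allI impI)
    show "(to_ac a, to_ac a) \<in> G'" for a
      using calculation(1) partial_endo_to_ac[OF G] by blast
  next
    fix x y x' y' assume "(x, y) \<in> G'" "(x', y') \<in> G'"
    then obtain p q p' q' where *: "coeffs_related G p q" "coeffs_related G p' q'"
      "x = poly p c" "y = poly q d" "x' = poly p' c" "y' = poly q' d"
      by (auto simp: G'_def)
    show "(x + x', y + y') \<in> G'"
      using coeffs_related_add[OF G *(1,2)] unfolding G'_def *(3-6) poly_add[symmetric] by blast
    show "(x * x', y * y') \<in> G'"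
      using coeffs_related_mult[OF G *(1,2)] unfolding G'_def *(3-6) poly_mult[symmetric] by blast
  next
    fix y assume "(0, y) \<in> G'"
    thus "y = 0" using wd by (auto simp: G'_def)
  qed
  ultimately show ?thesis by (intro exI[of _ G']) auto
qed

lemma partial_endo_Union:
  assumes "subset.chain {G. partial_endo G} \<C>" "\<C> \<noteq> {}"
  shows "partial_endo (\<Union>\<C>)"
  unfolding partial_endo_def
proof (intro conjI allI impI)
  have C: "partial_endo G" if "G \<in> \<C>" for G
    using assms(1) that by (auto simp: subset.chain_def)
  show "(to_ac c, to_ac c) \<in> \<Union>\<C>" for c
    using assms(2) C partial_endo_to_ac by blast
  show "y = 0" if "(0, y) \<in> \<Union>\<C>" for y
    using that C partial_endo_0 by blast
  fix x y x' y' assume "(x, y) \<in> \<Union>\<C>" "(x', y') \<in> \<Union>\<C>"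
  then obtain A B where AB: "A \<in> \<C>" "B \<in> \<C>" "(x, y) \<in> A" "(x', y') \<in> B" by blast
  hence "A \<subseteq> B \<or> B \<subseteq> A" using assms(1) unfolding subset.chain_def by blast
  with AB obtain G where G: "G \<in> \<C>" "(x, y) \<in> G" "(x', y') \<in> G" by blast
  show "(x + x', y + y') \<in> \<Union>\<C>" "(x * x', y * y') \<in> \<Union>\<C>"
    using C[OF G(1)] G partial_endo_add partial_endo_mult by blast+
qed

text \<open>Zorn's lemma. A maximal partial endomorphism is total: the image of a least-degree
  relation of \<open>c\<close> is nonconstant, so it has a root in the algebraically closed field,
  and \<open>c\<close> can be sent to this root.\<close>

lemma partial_endo_total:
  assumes G0: "partial_endo G0"
  obtains \<sigma> where "ac_endo \<sigma>" "\<And>x y. (x, y) \<in> G0 \<Longrightarrow> \<sigma> x = y"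
proof -
  have "\<exists>M\<in>{G. partial_endo G \<and> G0 \<subseteq> G}. \<forall>Y\<in>{G. partial_endo G \<and> G0 \<subseteq> G}. M \<subseteq> Y \<longrightarrow> Y = M"
  proof (rule subset_Zorn_nonempty)
    show "{G. partial_endo G \<and> G0 \<subseteq> G} \<noteq> {}" using G0 by auto
    fix \<C> assume *: "\<C> \<noteq> {}" "subset.chain {G. partial_endo G \<and> G0 \<subseteq> G} \<C>"
    hence "subset.chain {G. partial_endo G} \<C>" by (auto simp: subset.chain_def)
    hence "partial_endo (\<Union>\<C>)" using partial_endo_Union *(1) by blast
    moreover have "\<forall>G\<in>\<C>. G0 \<subseteq> G" using *(2) by (auto simp: subset.chain_def)
    ultimately show "\<Union>\<C> \<in> {G. partial_endo G \<and> G0 \<subseteq> G}" using *(1) by blast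
  qed
  then obtain M where M: "partial_endo M" "G0 \<subseteq> M"
    and max: "\<And>Y. partial_endo Y \<Longrightarrow> M \<subseteq> Y \<Longrightarrow> Y = M"
    by auto
  have total: "\<exists>d. (c, d) \<in> M" for c
  proof -
    define P where "P = (\<lambda>(p, q). coeffs_related M p q \<and> p \<noteq> 0 \<and> poly p c = 0)"
    obtain f :: "'a poly" where "f \<noteq> 0" "poly (map_poly to_ac f) c = 0"
      by (rule alg_closure_algebraic)
    hence "P (map_poly to_ac f, map_poly to_ac f)"
      using coeffs_related_map_poly[OF M(1), of f] by (auto simp: P_def map_poly_eq_0_iff)
    then obtain pq where "P pq" and "\<And>pq'. P pq' \<Longrightarrow> Polynomial.degree (fst pq) \<le> Polynomial.degree (fst pq')"
      using ex_has_least_nat[of P _ "\<lambda>pq. Polynomial.degree (fst pq)"] by blast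
    then obtain m m' where m: "coeffs_related M m m'" "m \<noteq> 0" "poly m c = 0"
      and min: "\<And>p q. coeffs_related M p q \<Longrightarrow> p \<noteq> 0 \<Longrightarrow> poly p c = 0 \<Longrightarrow>
                Polynomial.degree m \<le> Polynomial.degree p"
      by (cases pq) (fastforce simp: P_def)
    have "Polynomial.degree m > 0"
      using m by (auto elim!: degree_eq_zeroE intro!: Nat.gr0I)
    moreover have "Polynomial.coeff m' (Polynomial.degree m) \<noteq> 0"
      using m(1,2) partial_endo_inj[OF M(1), of "Polynomial.coeff m (Polynomial.degree m)"]
      by (auto simp: coeffs_related_def) (metis leading_coeff_0_iff)
    ultimately have "Polynomial.degree m' > 0"
      by (metis le_degree order_less_le_trans)
    then obtain d where "poly m' d = 0"
      using alg_closed_imp_poly_has_root by blast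
    hence "\<exists>G'. partial_endo G' \<and> M \<subseteq> G' \<and> (c, d) \<in> G'"
      using partial_endo_extend[OF M(1) m] min by blast
    thus ?thesis using max by blast
  qed
  define \<sigma> where "\<sigma> = (\<lambda>x. THE y. (x, y) \<in> M)"
  have \<sigma>: "\<sigma> x = y" if "(x, y) \<in> M" for x y
    unfolding \<sigma>_def using that partial_endo_unique[OF M(1)] by blast
  have \<sigma>M: "(x, \<sigma> x) \<in> M" for x using total[of x] \<sigma> by auto
  have "ac_endo \<sigma>"
    unfolding ac_endo_def
    using \<sigma>M partial_endo_add[OF M(1)] partial_endo_mult[OF M(1)] partial_endo_to_ac[OF M(1)]
    by (intro conjI allI) (auto intro!: \<sigma>)
  thus ?thesis using that M(2) \<sigma> by blast
qed

text \<open>Here perfection enters: the minimal polynomial of \<open>a\<close> has degree at least 2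
  and only simple roots, so it has a root \<open>b\<close> other than \<open>a\<close>, and sending
  \<open>a\<close> to \<open>b\<close> extends to an endomorphism.\<close>

lemma ac_endo_moves:
  fixes a :: "'a::field alg_closure"
  assumes perfect: "perfect_field TYPE('a)" and a: "a \<notin> range to_ac"
  obtains \<sigma> where "ac_endo \<sigma>" "\<sigma> a \<noteq> a"
proof -
  define D where "D = range (\<lambda>c :: 'a. (to_ac c, to_ac c))"
  have D: "partial_endo D"
    by (auto simp: partial_endo_def D_def image_iff intro: exI[of _ "_ + _"] exI[of _ "_ * _"])
  obtain p where p: "p \<noteq> 0" "poly (map_poly to_ac p) a = 0"
    and min: "\<And>q. q \<noteq> 0 \<Longrightarrow> poly (map_poly to_ac q) a = 0 \<Longrightarrow> Polynomial.degree p \<le> Polynomial.degree q"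
    using alg_closure_minimal_poly[of a] by metis
  have hom_mult: "map_poly to_ac (q * r) = map_poly to_ac q * map_poly to_ac r" for q r :: "'a poly"
    by (rule poly_eqI) (simp add: coeff_map_poly Polynomial.coeff_mult to_ac_sum)
  have deg_hom: "Polynomial.degree (map_poly to_ac q) = Polynomial.degree q" for q :: "'a poly"
    by (rule degree_map_poly) auto
  have "Polynomial.degree p > 0"
    using p by (auto elim!: degree_eq_zeroE intro!: Nat.gr0I simp: map_poly_pCons)
  have "Polynomial.degree p \<noteq> 1"
  proof
    assume "Polynomial.degree p = 1"
    then obtain u v where uv: "p = [:u, v:]" "v \<noteq> 0" by (rule degree1_coeffs)
    hence "to_ac u + a * to_ac v = 0" using p by (simp add: map_poly_pCons)
    hence "a = to_ac (- u / v)" using uv(2) by (simp add: field_simps add_eq_0_iff)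
    thus False using a by blast
  qed
  have "Factorial_Ring.irreducible p"
  proof (rule Factorial_Ring.irreducibleI)
    show "p \<noteq> 0" by fact
    show "\<not> p dvd 1" using \<open>Polynomial.degree p > 0\<close> by (auto simp: is_unit_iff_degree[OF p(1)])
    fix q r assume qr: "p = q * r"
    hence nz: "q \<noteq> 0" "r \<noteq> 0" using p by auto
    have "poly (map_poly to_ac q) a = 0 \<or> poly (map_poly to_ac r) a = 0"
      using p(2) unfolding qr hom_mult by simp
    thus "q dvd 1 \<or> r dvd 1"
      using min[OF nz(1)] min[OF nz(2)] nz degree_mult_eq[OF nz]
      by (auto simp: qr is_unit_iff_degree)
  qed
  hence sqf: "rsquarefree (map_poly to_ac p)"
    using perfect by (auto simp: perfect_field_def)
  obtain q where q: "map_poly to_ac p = [:- a, 1:] * q"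
    using p(2) by (metis poly_eq_0_iff_dvd dvdE)
  have q0: "q \<noteq> 0" using q p by (auto simp: map_poly_eq_0_iff)
  have "Polynomial.degree q > 0"
    using deg_hom[of p] \<open>Polynomial.degree p \<noteq> 1\<close> \<open>Polynomial.degree p > 0\<close>
      degree_mult_eq[OF _ q0, of "[:- a, 1:]"] unfolding q by simp
  then obtain b where b: "poly q b = 0" using alg_closed_imp_poly_has_root by blast
  have "b \<noteq> a"
  proof
    assume "b = a"
    then obtain r where "q = [:- a, 1:] * r" using b by (metis poly_eq_0_iff_dvd dvdE)
    hence "[:- a, 1:] ^ 2 dvd map_poly to_ac p" unfolding q power2_eq_square mult.assoc[symmetric] by (metis dvd_triv_left mult.assoc)
    hence "2 \<le> Polynomial.order a (map_poly to_ac p)"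
      using p by (subst (asm) order_divides) (auto simp: map_poly_eq_0_iff)
    moreover have "Polynomial.order a (map_poly to_ac p) \<in> {0, 1}"
      using sqf unfolding rsquarefree_def by blast
    ultimately show False by auto
  qed
  have "\<exists>G'. partial_endo G' \<and> D \<subseteq> G' \<and> (a, b) \<in> G'"
  proof (rule partial_endo_extend[OF D coeffs_related_map_poly[OF D, of p]])
    show "map_poly to_ac p \<noteq> 0" using p by (auto simp: map_poly_eq_0_iff)
    show "poly (map_poly to_ac p) a = 0" by fact
    show "poly (map_poly to_ac p) b = 0" using b q by simp
    \<comment> \<open>A relation over the diagonal \<open>D\<close> has coefficients in F, so the
      minimality of \<open>p\<close> applies to it.\<close>
    fix f g assume f: "coeffs_related D f g" "f \<noteq> 0" "poly f a = 0"
    have "Polynomial.coeff f i \<in> range to_ac" for i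
      using f(1) by (auto simp: coeffs_related_def D_def)
    hence "f = map_poly to_ac (map_poly of_ac f)"
      by (intro poly_eqI) (simp add: coeff_map_poly to_ac_of_ac)
    thus "Polynomial.degree (map_poly to_ac p) \<le> Polynomial.degree f"
      using min[of "map_poly of_ac f"] f deg_hom by (metis map_poly_0)
  qed
  then obtain G' where "partial_endo G'" "(a, b) \<in> G'" by blast
  thus ?thesis using partial_endo_total[of G'] that \<open>b \<noteq> a\<close> by metis
qed

section \<open>Subspaces defined over the base field\<close>

text \<open>The reduced row echelon form with pivot columns \<open>J\<close>. It is determined by
  \<open>U\<close> and \<open>J\<close>, which makes it suitable for descent.\<close>

definition echelon_basis :: "('k::field ^ 'n::finite) set \<Rightarrow> 'n set \<Rightarrow> ('n \<Rightarrow> 'k ^ 'n) \<Rightarrow> bool" where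
  "echelon_basis U J u \<longleftrightarrow>
     (\<forall>j\<in>J. u j \<in> U \<and> (\<forall>i\<in>J. u j $ i = (if i = j then 1 else 0))) \<and>
     (\<forall>v\<in>U. v = (\<Sum>j\<in>J. v $ j *s u j))"

text \<open>A maximal \<open>J\<close> works: a nonzero vector of \<open>U\<close> that vanishes on
  \<open>J\<close> would supply a further pivot.\<close>

lemma subspace_echelon_basis:
  fixes U :: "('k::field ^ 'n::finite) set"
  assumes U: "vec.subspace U"
  obtains J u where "card J = vec.dim U" "echelon_basis U J u"
proof -
  define P where "P = (\<lambda>J :: 'n set. \<exists>u. \<forall>j\<in>J. u j \<in> U \<and> (\<forall>i\<in>J. u j $ i = (if i = j then 1 else 0)))"
  have "P {}" by (simp add: P_def)
  moreover have "\<forall>J. P J \<longrightarrow> card J < Suc CARD('n)"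
    by (simp add: card_mono less_Suc_eq_le)
  ultimately obtain J where J: "P J" and max: "\<And>J'. P J' \<Longrightarrow> card J' \<le> card J"
    using ex_has_greatest_nat[of P "{}" card] by blast
  then obtain u where u: "\<And>j. j \<in> J \<Longrightarrow> u j \<in> U"
    "\<And>j i. j \<in> J \<Longrightarrow> i \<in> J \<Longrightarrow> u j $ i = (if i = j then 1 else 0)"
    by (auto simp: P_def)
  have zero: "v = 0" if v: "v \<in> U" "\<And>j. j \<in> J \<Longrightarrow> v $ j = 0" for v
  proof (rule ccontr)
    assume "v \<noteq> 0"
    then obtain i where i: "v $ i \<noteq> 0" by (auto simp: vec_eq_iff)
    with v have iJ: "i \<notin> J" by auto
    define w where "w = inverse (v $ i) *s v"
    have w: "w \<in> U" "w $ i = 1" "\<And>j. j \<in> J \<Longrightarrow> w $ j = 0"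
      using v i U by (auto simp: w_def vec.subspace_scale)
    define u' where "u' = (\<lambda>j. if j = i then w else u j - u j $ i *s w)"
    have "P (insert i J)"
      unfolding P_def
    proof (intro exI[of _ u'] ballI conjI)
      fix j assume j: "j \<in> insert i J"
      show "u' j \<in> U"
        using j w u U by (auto simp: u'_def intro!: vec.subspace_diff vec.subspace_scale)
      fix l assume l: "l \<in> insert i J"
      show "u' j $ l = (if l = j then 1 else 0)"
        using j l w u iJ by (auto simp: u'_def)
    qed
    from max[OF this] show False using iJ by simp
  qed
  have rep: "v = (\<Sum>j\<in>J. v $ j *s u j)" if v: "v \<in> U" for v
  proof -
    have "v - (\<Sum>j\<in>J. v $ j *s u j) = 0"
    proof (rule zero)
      show "v - (\<Sum>j\<in>J. v $ j *s u j) \<in> U"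
        using v u U by (intro vec.subspace_diff vec.subspace_sum vec.subspace_scale) auto
      fix i assume i: "i \<in> J"
      hence "(\<Sum>j\<in>J. v $ j *s u j) $ i = (\<Sum>j\<in>J. if j = i then v $ j else 0)"
        using u(2) by (simp only: sum_component) (intro sum.cong, auto)
      thus "(v - (\<Sum>j\<in>J. v $ j *s u j)) $ i = 0" using i by simp
    qed
    thus ?thesis by simp
  qed
  have inj: "inj_on u J"
    using u(2) by (intro inj_onI) (metis zero_neq_one)
  have "vec.independent (u ` J)"
  proof (rule vec.independent_if_scalars_zero)
    fix f x assume f: "(\<Sum>x\<in>u ` J. f x *s x) = 0" and "x \<in> u ` J"
    then obtain j where j: "j \<in> J" "x = u j" by auto
    have "0 = (\<Sum>i\<in>J. f (u i) *s u i) $ j"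
      using f by (simp add: sum.reindex[OF inj])
    also have "\<dots> = (\<Sum>i\<in>J. if i = j then f (u i) else 0)"
      using j u(2) by (simp only: sum_component) (intro sum.cong, auto)
    finally show "f x = 0" using j by simp
  qed simp
  moreover have "vec.span (u ` J) = vec.span U"
  proof
    show "vec.span (u ` J) \<subseteq> vec.span U" using u by (intro vec.span_mono) auto
    have "v \<in> vec.span (u ` J)" if "v \<in> U" for v
      by (subst rep[OF that]) (intro vec.span_sum vec.span_scale vec.span_base, auto)
    thus "vec.span U \<subseteq> vec.span (u ` J)" by (intro vec.span_minimal) auto
  qed
  ultimately have "vec.dim U = card (u ` J)" by (metis vec.dim_eq_card)
  hence "card J = vec.dim U" by (simp add: card_image[OF inj])
  moreover have "echelon_basis U J u"
    unfolding echelon_basis_def using u rep by blast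
  ultimately show ?thesis using that by blast
qed

text \<open>The graph of a linear map from the coordinates in \<open>J\<close> to the others. In
  this form a subspace is defined over F if the matrix \<open>m\<close> is, and its codimension is
  the number of coordinates outside \<open>J\<close>.\<close>

definition graph_space :: "'n set \<Rightarrow> ('n \<Rightarrow> 'n \<Rightarrow> 'k::field) \<Rightarrow> ('k ^ 'n::finite) set" where
  "graph_space J m = {v. \<forall>i. i \<notin> J \<longrightarrow> v $ i = (\<Sum>j\<in>J. m i j * v $ j)}"

lemma ac_endo_0: "ac_endo \<sigma> \<Longrightarrow> \<sigma> 0 = 0" and ac_endo_1: "ac_endo \<sigma> \<Longrightarrow> \<sigma> 1 = 1"
  using to_ac_0 to_ac_1 unfolding ac_endo_def by metis+

lemma ac_endo_sum: "ac_endo \<sigma> \<Longrightarrow> \<sigma> (sum f I) = (\<Sum>i\<in>I. \<sigma> (f i))"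
  by (induction I rule: infinite_finite_induct) (simp_all add: ac_endo_0, simp add: ac_endo_def)

lemma ac_endo_mult: "ac_endo \<sigma> \<Longrightarrow> \<sigma> (x * y) = \<sigma> x * \<sigma> y"
  and ac_endo_add: "ac_endo \<sigma> \<Longrightarrow> \<sigma> (x + y) = \<sigma> x + \<sigma> y"
  and ac_endo_to_ac: "ac_endo \<sigma> \<Longrightarrow> \<sigma> (to_ac c) = to_ac c"
  by (auto simp: ac_endo_def)

text \<open>Applied to a vector of the echelon basis, \<sigma> preserves the pivot entries 0 and 1
  and stays in \<open>U\<close>, so it returns the same vector. Hence all entries are fixed by every
  \<sigma> and lie in F.\<close>

lemma ac_endo_invariant_subspace:
  fixes U :: "('a::field alg_closure ^ 'n::finite) set"
  assumes perfect: "perfect_field TYPE('a)" and U: "vec.subspace U"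
    and inv: "\<And>\<sigma> v. ac_endo \<sigma> \<Longrightarrow> v \<in> U \<Longrightarrow> (\<chi> i. \<sigma> (v $ i)) \<in> U"
  obtains J and m :: "'n \<Rightarrow> 'n \<Rightarrow> 'a" where
    "card J = vec.dim U" "U = graph_space J (\<lambda>i j. to_ac (m i j))"
proof -
  obtain J u where J: "card J = vec.dim U" and "echelon_basis U J u"
    using subspace_echelon_basis[OF U] .
  hence u: "\<And>j. j \<in> J \<Longrightarrow> u j \<in> U"
    "\<And>j i. j \<in> J \<Longrightarrow> i \<in> J \<Longrightarrow> u j $ i = (if i = j then 1 else 0)"
    and rep: "\<And>v. v \<in> U \<Longrightarrow> v = (\<Sum>j\<in>J. v $ j *s u j)"
    by (auto simp: echelon_basis_def)
  have rat: "u j $ i \<in> range to_ac" if j: "j \<in> J" for i j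
  proof (rule ccontr)
    assume "u j $ i \<notin> range to_ac"
    then obtain \<sigma> where \<sigma>: "ac_endo \<sigma>" "\<sigma> (u j $ i) \<noteq> u j $ i"
      using ac_endo_moves[OF perfect] by blast
    define w where "w = (\<chi> i. \<sigma> (u j $ i))"
    have "w \<in> U" using inv[OF \<sigma>(1) u(1)[OF j]] by (simp add: w_def)
    hence "w = (\<Sum>k\<in>J. w $ k *s u k)" by (rule rep)
    also have "\<dots> = (\<Sum>k\<in>J. u j $ k *s u k)"
      using u(2) j by (intro sum.cong) (auto simp: w_def ac_endo_0[OF \<sigma>(1)] ac_endo_1[OF \<sigma>(1)])
    also have "\<dots> = u j" using rep[OF u(1)[OF j]] by simp
    finally show False using \<sigma>(2) by (simp add: w_def vec_eq_iff)
  qed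
  define m where "m = (\<lambda>i j. of_ac (u j $ i))"
  have m: "to_ac (m i j) = u j $ i" if "j \<in> J" for i j
    using rat[OF that] by (simp add: m_def to_ac_of_ac)
  have msum: "(\<Sum>j\<in>J. to_ac (m i j) * v $ j) = (\<Sum>j\<in>J. v $ j *s u j) $ i" for i v
    by (simp only: sum_component) (intro sum.cong, auto simp: m)
  have "U = graph_space J (\<lambda>i j. to_ac (m i j))"
  proof (intro equalityI subsetI)
    fix v assume "v \<in> U"
    hence "v = (\<Sum>j\<in>J. v $ j *s u j)" by (rule rep)
    hence "v $ i = (\<Sum>j\<in>J. v $ j *s u j) $ i" for i by (rule arg_cong)
    thus "v \<in> graph_space J (\<lambda>i j. to_ac (m i j))"
      unfolding graph_space_def msum by blast
  next
    fix v assume v: "v \<in> graph_space J (\<lambda>i j. to_ac (m i j))"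
    have "v = (\<Sum>j\<in>J. v $ j *s u j)"
    proof (rule iffD2[OF vec_eq_iff], rule allI)
      fix i
      show "v $ i = (\<Sum>j\<in>J. v $ j *s u j) $ i"
      proof (cases "i \<in> J")
        case True
        hence "(\<Sum>j\<in>J. v $ j *s u j) $ i = (\<Sum>j\<in>J. if j = i then v $ j else 0)"
          using u(2) by (simp only: sum_component) (intro sum.cong, auto)
        thus ?thesis using True by simp
      next
        case False
        thus ?thesis using v unfolding graph_space_def msum by blast
      qed
    qed
    moreover have "(\<Sum>j\<in>J. v $ j *s u j) \<in> U"
      using u U by (intro vec.subspace_sum vec.subspace_scale)
    ultimately show "v \<in> U" by simp
  qed
  thus ?thesis using that J by blast
qed

section \<open>Slice decompositions from vanishing subspaces\<close>

lemma linear_formI: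
  "(\<And>x y. l (x + y) = l x + l y) \<Longrightarrow> (\<And>c x. l (c *s x) = c * l x) \<Longrightarrow> linear_form l"
  unfolding linear_form_def
  by unfold_locales (auto simp: algebra_simps)

lemma slice_rank_le_card:
  assumes "finite A" "\<And>a. a \<in> A \<Longrightarrow> is_slice (S a)"
    "trilinear_form T = (\<lambda>x y z. \<Sum>a\<in>A. S a x y z)"
  shows "slice_rank T \<le> card A"
proof -
  obtain f where f: "bij_betw f {0..<card A} A"
    using ex_bij_betw_nat_finite[OF assms(1)] by blast
  show ?thesis
    unfolding slice_rank_def
  proof (rule Least_le, intro exI[of _ "\<lambda>s. S (f s)"] conjI allI impI)
    show "is_slice (S (f s))" if "s < card A" for s
      using bij_betwE[OF f] that assms(2) by simp
    show "trilinear_form T = (\<lambda>x y z. \<Sum>s<card A. S (f s) x y z)"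
      unfolding assms(3) by (intro ext sum.reindex_bij_betw[symmetric]) (simp add: f flip: atLeast0LessThan)
  qed
qed

lemma trilinear_form_add:
  "trilinear_form T (x + x') y z = trilinear_form T x y z + trilinear_form T x' y z"
  "trilinear_form T x (y + y') z = trilinear_form T x y z + trilinear_form T x y' z"
  "trilinear_form T x y (z + z') = trilinear_form T x y z + trilinear_form T x y z'"
  by (simp_all add: trilinear_form_def algebra_simps sum.distrib)

lemma trilinear_form_scale:
  "trilinear_form T (c *s x) y z = c * trilinear_form T x y z"
  "trilinear_form T x (c *s y) z = c * trilinear_form T x y z"
  "trilinear_form T x y (c *s z) = c * trilinear_form T x y z"
  by (simp_all add: trilinear_form_def sum_distrib_left algebra_simps)

lemma trilinear_form_zero:
  "trilinear_form T 0 y z = 0" "trilinear_form T x 0 z = 0" "trilinear_form T x y 0 = 0"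
  by (simp_all add: trilinear_form_def)

lemma trilinear_form_sum:
  "trilinear_form T (sum f I) y z = (\<Sum>i\<in>I. trilinear_form T (f i) y z)"
  "trilinear_form T x (sum g I) z = (\<Sum>i\<in>I. trilinear_form T x (g i) z)"
  "trilinear_form T x y (sum h I) = (\<Sum>i\<in>I. trilinear_form T x y (h i))"
  by (induction I rule: infinite_finite_induct)
     (simp_all add: trilinear_form_zero trilinear_form_add)

definition graph_proj :: "'n set \<Rightarrow> ('n \<Rightarrow> 'n \<Rightarrow> 'k::field) \<Rightarrow> 'k ^ 'n::finite \<Rightarrow> 'k ^ 'n" where
  "graph_proj J m v = (\<chi> i. if i \<in> J then v $ i else \<Sum>j\<in>J. m i j * v $ j)"

definition graph_defect :: "'n set \<Rightarrow> ('n \<Rightarrow> 'n \<Rightarrow> 'k::field) \<Rightarrow> 'n \<Rightarrow> 'k ^ 'n::finite \<Rightarrow> 'k" where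
  "graph_defect J m i v = v $ i - (\<Sum>j\<in>J. m i j * v $ j)"

lemma graph_proj_in: "graph_proj J m v \<in> graph_space J m"
  by (simp add: graph_proj_def graph_space_def)

lemma graph_proj_linear:
  "graph_proj J m (v + w) = graph_proj J m v + graph_proj J m w"
  "graph_proj J m (c *s v) = c *s graph_proj J m v"
  by (auto simp: graph_proj_def vec_eq_iff algebra_simps sum.distrib sum_distrib_left)

lemma linear_form_graph_defect: "linear_form (graph_defect J m i)"
  by (rule linear_formI)
     (auto simp: graph_defect_def algebra_simps sum.distrib sum_distrib_left)

lemma graph_proj_decompose:
  "v = graph_proj J m v + (\<Sum>i\<in>-J. graph_defect J m i v *s axis i 1)"
proof (rule iffD2[OF vec_eq_iff], rule allI)
  fix l
  have "(\<Sum>i\<in>-J. graph_defect J m i v *s axis i 1) $ l =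
      (\<Sum>i\<in>-J. if i = l then graph_defect J m i v else 0)"
    by (simp only: sum_component) (intro sum.cong, auto simp: axis_def)
  thus "v $ l = (graph_proj J m v + (\<Sum>i\<in>-J. graph_defect J m i v *s axis i 1)) $ l"
    by (simp add: graph_proj_def graph_defect_def)
qed

text \<open>Replace x, y, z one after the other by their projections. Each replacement costs one
  slice per equation of the subspace concerned, and the final term vanishes.\<close>

lemma slice_rank_le_codims:
  fixes T :: "('a::field, 'n1::finite, 'n2::finite, 'n3::finite) tensor3"
  assumes van: "\<And>x y z. x \<in> graph_space J1 m1 \<Longrightarrow> y \<in> graph_space J2 m2 \<Longrightarrow> z \<in> graph_space J3 m3 \<Longrightarrow>
      trilinear_form T x y z = 0"
  shows "slice_rank T \<le> card (- J1) + card (- J2) + card (- J3)"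
proof -
  define S where "S = case_sum
      (\<lambda>i x y z. graph_defect J1 m1 i x * trilinear_form T (axis i 1) y z)
      (case_sum
        (\<lambda>i x y z. graph_defect J2 m2 i y * trilinear_form T (graph_proj J1 m1 x) (axis i 1) z)
        (\<lambda>i x y z. graph_defect J3 m3 i z *
           trilinear_form T (graph_proj J1 m1 x) (graph_proj J2 m2 y) (axis i 1)))"
  define A where "A = (- J1) <+> ((- J2) <+> (- J3))"
  note lin = trilinear_form_add trilinear_form_scale graph_proj_linear
  have "slice_rank T \<le> card A"
  proof (rule slice_rank_le_card)
    show "finite A" by (simp add: A_def)
    fix a assume "a \<in> A"
    then consider i where "a = Inl i" | i where "a = Inr (Inl i)" | i where "a = Inr (Inr i)"
      by (auto simp: A_def)
    thus "is_slice (S a)"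
    proof cases
      case 1
      have "bilinear_form (trilinear_form T (axis i 1))"
        unfolding bilinear_form_def by (intro conjI allI linear_formI) (simp_all add: lin)
      thus ?thesis
        using linear_form_graph_defect unfolding is_slice_def S_def 1
        by (intro disjI1 exI conjI) auto
    next
      case 2
      have "bilinear_form (\<lambda>x. trilinear_form T (graph_proj J1 m1 x) (axis i 1))"
        unfolding bilinear_form_def by (intro conjI allI linear_formI) (simp_all add: lin)
      thus ?thesis
        using linear_form_graph_defect unfolding is_slice_def S_def 2
        by (intro disjI2[OF disjI1] exI conjI) auto
    next
      case 3
      have "bilinear_form (\<lambda>x y. trilinear_form T (graph_proj J1 m1 x) (graph_proj J2 m2 y) (axis i 1))"
        unfolding bilinear_form_def by (intro conjI allI linear_formI) (simp_all add: lin)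
      thus ?thesis
        using linear_form_graph_defect unfolding is_slice_def S_def 3
        by (intro disjI2[OF disjI2] exI conjI) auto
    qed
  next
    show "trilinear_form T = (\<lambda>x y z. \<Sum>a\<in>A. S a x y z)"
    proof (intro ext)
      fix x y z
      let ?x = "graph_proj J1 m1 x" and ?y = "graph_proj J2 m2 y" and ?z = "graph_proj J3 m3 z"
      have "trilinear_form T x y z = trilinear_form T ?x y z +
          (\<Sum>i\<in>-J1. graph_defect J1 m1 i x * trilinear_form T (axis i 1) y z)"
        by (subst graph_proj_decompose[of x J1 m1])
           (simp only: trilinear_form_add trilinear_form_sum trilinear_form_scale)
      also have "trilinear_form T ?x y z = trilinear_form T ?x ?y z +
          (\<Sum>i\<in>-J2. graph_defect J2 m2 i y * trilinear_form T ?x (axis i 1) z)"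
        by (subst graph_proj_decompose[of y J2 m2])
           (simp only: trilinear_form_add trilinear_form_sum trilinear_form_scale)
      also have "trilinear_form T ?x ?y z = trilinear_form T ?x ?y ?z +
          (\<Sum>i\<in>-J3. graph_defect J3 m3 i z * trilinear_form T ?x ?y (axis i 1))"
        by (subst graph_proj_decompose[of z J3 m3])
           (simp only: trilinear_form_add trilinear_form_sum trilinear_form_scale)
      also have "trilinear_form T ?x ?y ?z = 0"
        by (intro van graph_proj_in)
      finally show "trilinear_form T x y z = (\<Sum>a\<in>A. S a x y z)"
        by (simp add: A_def S_def sum.Plus)
    qed
  qed
  thus ?thesis by (simp add: A_def card_Plus)
qed

section \<open>Bases adapted to two chains of subspaces\<close>

definition adapted_basis :: "('k::field ^ 'n::finite) set set \<Rightarrow> ('k ^ 'n) set \<Rightarrow> bool" where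
  "adapted_basis \<A> E \<longleftrightarrow> vec.independent E \<and> vec.span E = UNIV \<and> (\<forall>A\<in>\<A>. A \<subseteq> vec.span (E \<inter> A))"

lemma span_exchange:
  fixes G :: "('k::field ^ 'n::finite) set"
  assumes "finite I" "I \<subseteq> G" "m \<in> I" "c m \<noteq> 0" "v = (\<Sum>e\<in>I. c e *s e)"
  shows "vec.span G \<subseteq> vec.span (insert v (G - {m}))"
proof (rule vec.span_minimal)
  let ?S = "vec.span (insert v (G - {m}))"
  have "c m *s m = v - (\<Sum>e\<in>I - {m}. c e *s e)"
    using assms by (simp add: sum.remove[of I m])
  moreover have "(\<Sum>e\<in>I - {m}. c e *s e) \<in> ?S"
    using assms by (intro vec.span_sum vec.span_scale vec.span_base) auto
  ultimately have "c m *s m \<in> ?S"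
    by (simp add: vec.span_diff vec.span_base)
  hence "inverse (c m) *s (c m *s m) \<in> ?S" by (rule vec.span_scale)
  hence "m \<in> ?S" using assms(4) by simp
  thus "G \<subseteq> ?S" by (auto intro: vec.span_base)
qed simp

text \<open>Among the bases adapted to \<A>, take one with the most incidences with the members of
  \<B>. If some \<open>B\<close> is not spanned by its share, exchanging a basis vector outside
  \<open>B\<close> for a vector of \<open>B\<close> increases the count.\<close>

lemma common_adapted_basis:
  fixes \<A> \<B> :: "('k::field ^ 'n::finite) set set"
  assumes fin: "finite \<A>" "finite \<B>"
    and sub: "\<And>A. A \<in> \<A> \<union> \<B> \<Longrightarrow> vec.subspace A"
    and chainA: "\<And>A A'. A \<in> \<A> \<Longrightarrow> A' \<in> \<A> \<Longrightarrow> A \<subseteq> A' \<or> A' \<subseteq> A"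
    and chainB: "\<And>B B'. B \<in> \<B> \<Longrightarrow> B' \<in> \<B> \<Longrightarrow> B \<subseteq> B' \<or> B' \<subseteq> B"
    and ex: "\<exists>E. adapted_basis \<A> E"
  shows "\<exists>E. adapted_basis \<A> E \<and> adapted_basis \<B> E"
proof -
  define f where "f = (\<lambda>E :: ('k ^ 'n) set. \<Sum>B\<in>\<B>. card (E \<inter> B))"
  have finE: "finite E" if "adapted_basis \<A> E" for E
    using that by (auto simp: adapted_basis_def vec.finiteI_independent)
  have bound: "f E < Suc (card \<B> * CARD('n))" if "adapted_basis \<A> E" for E
  proof -
    have "card E \<le> CARD('n)"
      using that vec.dim_eq_card_independent[of E] dim_subset_UNIV_cart_gen[of E]
      by (simp add: adapted_basis_def)
    hence "card (E \<inter> B) \<le> CARD('n)" for B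
      using card_mono[OF finE[OF that], of "E \<inter> B"] by simp
    hence "f E \<le> card \<B> * CARD('n)"
      unfolding f_def using sum_bounded_above[of \<B> "\<lambda>B. card (E \<inter> B)" "CARD('n)"] by simp
    thus ?thesis by simp
  qed
  obtain E where E: "adapted_basis \<A> E" and max: "\<And>E'. adapted_basis \<A> E' \<Longrightarrow> f E' \<le> f E"
    using ex ex_has_greatest_nat[of "adapted_basis \<A>" _ f] bound by metis
  have indep: "vec.independent E" and spanE: "vec.span E = UNIV"
    and adE: "\<And>A. A \<in> \<A> \<Longrightarrow> A \<subseteq> vec.span (E \<inter> A)"
    using E by (auto simp: adapted_basis_def)
  note finE = finE[OF E]
  have "B \<subseteq> vec.span (E \<inter> B)" if B: "B \<in> \<B>" for B
  proof (rule ccontr)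
    assume "\<not> B \<subseteq> vec.span (E \<inter> B)"
    then obtain v where v: "v \<in> B" "v \<notin> vec.span (E \<inter> B)" by blast
    have subB: "vec.subspace B" using sub B by blast
    have "v \<in> vec.span E" using spanE by simp
    then obtain c where c: "v = (\<Sum>e\<in>E. c e *s e)"
      unfolding vec.span_finite[OF finE] by blast
    \<comment> \<open>Subtracting the components in \<open>B\<close> leaves a vector of
      \<open>B\<close> whose expansion uses only basis vectors outside \<open>B\<close>.\<close>
    define w where "w = v - (\<Sum>e\<in>E \<inter> B. c e *s e)"
    have sp: "(\<Sum>e\<in>E \<inter> B. c e *s e) \<in> vec.span (E \<inter> B)"
      by (intro vec.span_sum vec.span_scale vec.span_base)
    have wB: "w \<in> B"
      unfolding w_def using v subB
      by (intro vec.subspace_diff vec.subspace_sum vec.subspace_scale) auto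
    have wn: "w \<notin> vec.span (E \<inter> B)"
      using vec.span_add[OF _ sp, of w] v(2) by (auto simp: w_def)
    define I where "I = {e \<in> E - B. c e \<noteq> 0}"
    have finI: "finite I" and IE: "I \<subseteq> E" using finE by (auto simp: I_def)
    have w: "w = (\<Sum>e\<in>I. c e *s e)"
    proof -
      have "v = (\<Sum>e\<in>E - B. c e *s e) + (\<Sum>e\<in>E \<inter> B. c e *s e)"
        unfolding c using sum.Int_Diff[OF finE, of "\<lambda>e. c e *s e" B] by (simp add: add.commute)
      hence "w = (\<Sum>e\<in>E - B. c e *s e)" by (simp add: w_def)
      also have "\<dots> = (\<Sum>e\<in>I. c e *s e)"
        using finE by (intro sum.mono_neutral_right) (auto simp: I_def)
      finally show ?thesis .
    qed
    have "I \<noteq> {}" using wn by (auto simp: w vec.span_zero)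
    \<comment> \<open>The vector \<open>m\<close> enters the chain \<A> last: every member
      containing it contains all of \<open>I\<close>, hence \<open>w\<close>, so that the exchange
      keeps the basis adapted.\<close>
    then obtain m where m: "m \<in> I" "\<And>e. e \<in> I \<Longrightarrow> card {A \<in> \<A>. m \<in> A} \<le> card {A \<in> \<A>. e \<in> A}"
      using ex_has_least_nat[of "\<lambda>e. e \<in> I" _ "\<lambda>e. card {A \<in> \<A>. e \<in> A}"] by blast
    have top: "I \<subseteq> A" if A: "A \<in> \<A>" "m \<in> A" for A
    proof (rule ccontr)
      assume "\<not> I \<subseteq> A"
      then obtain e where e: "e \<in> I" "e \<notin> A" by blast
      have "{A' \<in> \<A>. e \<in> A'} \<subset> {A' \<in> \<A>. m \<in> A'}"
        using e A chainA by blast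
      hence "card {A' \<in> \<A>. e \<in> A'} < card {A' \<in> \<A>. m \<in> A'}"
        using fin by (intro psubset_card_mono) auto
      thus False using m(2)[OF e(1)] by simp
    qed
    have cm: "c m \<noteq> 0" "m \<in> E" "m \<notin> B" using m(1) by (auto simp: I_def)
    note exch = span_exchange[OF finI _ m(1) cm(1) w]
    define E' where "E' = insert w (E - {m})"
    have wE: "w \<notin> vec.span (E - {m})"
    proof
      assume "w \<in> vec.span (E - {m})"
      hence "vec.span (insert w (E - {m})) = vec.span (E - {m})"
        by (rule vec.span_redundant)
      hence "m \<in> vec.span (E - {m})" using exch[OF IE] spanE by auto
      thus False using indep cm unfolding vec.dependent_def by blast
    qed
    have "adapted_basis \<A> E'"
      unfolding adapted_basis_def
    proof (intro conjI ballI)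
      show "vec.independent E'"
        using wE vec.independent_mono[OF indep, of "E - {m}"] unfolding E'_def
        by (auto simp: vec.independent_insert)
      show "vec.span E' = UNIV" using exch[OF IE] spanE by (auto simp: E'_def)
      fix A assume A: "A \<in> \<A>"
      show "A \<subseteq> vec.span (E' \<inter> A)"
      proof (cases "m \<in> A")
        case True
        hence IA: "I \<subseteq> E \<inter> A" using top A IE by blast
        have "w \<in> A"
          unfolding w using IA sub A by (intro vec.subspace_sum vec.subspace_scale) auto
        hence "insert w (E \<inter> A - {m}) \<subseteq> E' \<inter> A" by (auto simp: E'_def)
        hence "vec.span (insert w (E \<inter> A - {m})) \<subseteq> vec.span (E' \<inter> A)" by (rule vec.span_mono)
        thus ?thesis using adE[OF A] exch[OF IA] by blast
      next
        case False
        hence "E \<inter> A \<subseteq> E' \<inter> A" by (auto simp: E'_def)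
        thus ?thesis using adE[OF A] vec.span_mono by blast
      qed
    qed
    moreover have "f E < f E'"
      unfolding f_def
    proof (rule sum_strict_mono_ex1)
      have finE': "finite E'" using finE by (simp add: E'_def)
      show "\<forall>B'\<in>\<B>. card (E \<inter> B') \<le> card (E' \<inter> B')"
      proof
        fix B' assume B': "B' \<in> \<B>"
        show "card (E \<inter> B') \<le> card (E' \<inter> B')"
        proof (cases "m \<in> B'")
          case True
          \<comment> \<open>As \<open>m\<close> lies in \<open>B'\<close> but not in
            \<open>B\<close>, the chain property yields \<open>B \<subseteq> B'\<close>.\<close>
          hence "w \<in> B'" using chainB[OF B B'] cm wB by blast
          hence "E' \<inter> B' = insert w (E \<inter> B' - {m})" by (auto simp: E'_def)
          moreover have "w \<notin> E \<inter> B' - {m}"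
            using wE vec.span_base[of w "E - {m}"] by blast
          ultimately show ?thesis
            using finE True cm by (simp add: card_Diff_singleton)
        next
          case False
          thus ?thesis using finE' by (intro card_mono) (auto simp: E'_def)
        qed
      qed
      have "E' \<inter> B = insert w (E \<inter> B)" using wB cm by (auto simp: E'_def)
      moreover have "w \<notin> E \<inter> B" using wn vec.span_base[of w "E \<inter> B"] by blast
      ultimately have "card (E \<inter> B) < card (E' \<inter> B)" using finE by simp
      thus "\<exists>B\<in>\<B>. card (E \<inter> B) < card (E' \<inter> B)" using B by blast
    qed (rule fin)
    ultimately show False using max by fastforce
  qed
  hence "adapted_basis \<B> E" using indep spanE by (simp add: adapted_basis_def)
  thus ?thesis using E by blast
qed

section \<open>Weighted bases\<close>

definition frame :: "('n::finite \<Rightarrow> 'k::field ^ 'n) \<Rightarrow> bool" where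
  "frame b \<longleftrightarrow> inj b \<and> vec.independent (range b)"

text \<open>The increasing filtration by weight. For a minimiser these subspaces are canonical,
  whereas the frame is not.\<close>

definition flag :: "('n::finite \<Rightarrow> 'k::field ^ 'n) \<Rightarrow> real ^ 'n \<Rightarrow> real \<Rightarrow> ('k ^ 'n) set" where
  "flag b a t = vec.span (b ` {i. a $ i \<le> t})"

text \<open>Invertibility is a system of equations, and field endomorphisms preserve equations; in
  this form frames are transported along \<sigma>.\<close>

lemma frame_iff_matrix: "frame b \<longleftrightarrow> (\<exists>B. (\<chi> i. b i) ** B = mat 1)"
proof -
  have row: "row i (\<chi> i. b i) = b i" for i by (simp add: row_def vec_eq_iff)
  have "frame b \<longleftrightarrow> (\<forall>c. (\<Sum>i\<in>UNIV. c i *s b i) = 0 \<longrightarrow> (\<forall>i. c i = 0))"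
  proof
    assume b: "frame b"
    show "\<forall>c. (\<Sum>i\<in>UNIV. c i *s b i) = 0 \<longrightarrow> (\<forall>i. c i = 0)"
    proof (intro allI impI)
      fix c i assume "(\<Sum>i\<in>UNIV. c i *s b i) = 0"
      hence "(\<Sum>x\<in>range b. c (the_inv b x) *s x) = 0"
        using b by (simp add: frame_def sum.reindex the_inv_f_f)
      hence "c (the_inv b (b i)) = 0"
        using b vec.independentD[of "range b" "range b" "\<lambda>x. c (the_inv b x)" "b i"]
        by (simp add: frame_def)
      thus "c i = 0" using b by (simp add: frame_def the_inv_f_f)
    qed
  next
    assume *: "\<forall>c. (\<Sum>i\<in>UNIV. c i *s b i) = 0 \<longrightarrow> (\<forall>i. c i = 0)"
    have inj: "inj b"
    proof (rule injI, rule ccontr)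
      fix i j assume ij: "b i = b j" "i \<noteq> j"
      define c where "c = (\<lambda>l. if l = i then 1 else if l = j then - 1 else (0::'b))"
      have "(\<Sum>l\<in>UNIV. c l *s b l) = (\<Sum>l\<in>{i, j}. c l *s b l)"
        by (intro sum.mono_neutral_right) (auto simp: c_def)
      also have "\<dots> = 0" using ij by (simp add: c_def)
      finally show False using * by (metis c_def zero_neq_one)
    qed
    have "vec.independent (range b)"
    proof (rule vec.independent_if_scalars_zero)
      fix f x assume "(\<Sum>x\<in>range b. f x *s x) = 0" "x \<in> range b"
      thus "f x = 0" using *[rule_format, of "\<lambda>i. f (b i)"] by (auto simp: sum.reindex[OF inj])
    qed simp
    with inj show "frame b" by (simp add: frame_def)
  qed
  thus ?thesis unfolding matrix_right_invertible_independent_rows row .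
qed

lemma flag_subspace: "vec.subspace (flag b a t)"
  by (simp add: flag_def)

lemma flag_mono: "s \<le> t \<Longrightarrow> flag b a s \<subseteq> flag b a t"
  unfolding flag_def by (intro vec.span_mono image_mono) auto

lemma dim_flag: "frame b \<Longrightarrow> vec.dim (flag b a t) = card {i. a $ i \<le> t}"
  unfolding flag_def frame_def
  by (metis card_image inj_on_subset subset_UNIV vec.dim_span_eq_card_independent vec.independent_mono image_mono)

lemma span_frame: "frame b \<Longrightarrow> vec.span (range b) = UNIV"
  using vec.card_ge_dim_independent[of "range b" UNIV]
  by (simp add: frame_def card_image vec_dim_card top.extremum_unique del: vec.dim_UNIV)

text \<open>Differences of consecutive cumulative counts are the multiplicities of the values, so
  both families have the same multiset of values.\<close>

lemma sum_eq_of_cumulative_counts: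
  fixes f :: "'x \<Rightarrow> real" and g :: "'y \<Rightarrow> real" and \<phi> :: "real \<Rightarrow> real"
  assumes fin: "finite A" "finite B" "finite R" and fg: "f ` A \<subseteq> R" "g ` B \<subseteq> R"
    and cnt: "\<And>t. t \<in> R \<Longrightarrow> card {x\<in>A. f x \<le> t} = card {y\<in>B. g y \<le> t}"
  shows "(\<Sum>x\<in>A. \<phi> (f x)) = (\<Sum>y\<in>B. \<phi> (g y))"
proof -
  have less: "card {x\<in>A. f x < t} = card {y\<in>B. g y < t}" if t: "t \<in> R" for t
  proof (cases "{s\<in>R. s < t} = {}")
    case True
    hence "{x\<in>A. f x < t} = {}" "{y\<in>B. g y < t} = {}" using fg by auto
    thus ?thesis by (simp only: card.empty)
  next
    case False
    define s where "s = Max {s\<in>R. s < t}"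
    have s: "s \<in> R" "s < t" using Max_in[of "{s\<in>R. s < t}"] False fin by (auto simp: s_def)
    have max: "r \<le> s" if "r \<in> R" "r < t" for r
      unfolding s_def using that fin by (intro Max_ge) auto
    have "f x < t \<longleftrightarrow> f x \<le> s" if "x \<in> A" for x
      using that fg s max[of "f x"] by auto
    moreover have "g x < t \<longleftrightarrow> g x \<le> s" if "x \<in> B" for x
      using that fg s max[of "g x"] by auto
    ultimately have "{x\<in>A. f x < t} = {x\<in>A. f x \<le> s}" "{y\<in>B. g y < t} = {y\<in>B. g y \<le> s}"
      by blast+
    thus ?thesis using cnt[OF s(1)] by simp
  qed
  have eq: "card {x\<in>A. f x = t} = card {y\<in>B. g y = t}" if t: "t \<in> R" for t
  proof -
    have "{x\<in>A. f x \<le> t} = {x\<in>A. f x = t} \<union> {x\<in>A. f x < t}"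
      "{y\<in>B. g y \<le> t} = {y\<in>B. g y = t} \<union> {y\<in>B. g y < t}" by auto
    hence "card {x\<in>A. f x \<le> t} = card {x\<in>A. f x = t} + card {x\<in>A. f x < t}"
      "card {y\<in>B. g y \<le> t} = card {y\<in>B. g y = t} + card {y\<in>B. g y < t}"
      using fin by (auto intro!: card_Un_disjoint)
    thus ?thesis using cnt[OF t] less[OF t] by simp
  qed
  have "(\<Sum>x\<in>A. \<phi> (f x)) = (\<Sum>t\<in>R. \<Sum>x | x \<in> A \<and> f x = t. \<phi> (f x))"
    by (rule sum.group[symmetric]) (use fin fg in auto)
  also have "\<dots> = (\<Sum>t\<in>R. real (card {x\<in>A. f x = t}) * \<phi> t)" by simp
  also have "\<dots> = (\<Sum>t\<in>R. \<Sum>y | y \<in> B \<and> g y = t. \<phi> (g y))" by (simp add: eq)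
  also have "\<dots> = (\<Sum>y\<in>B. \<phi> (g y))"
    by (rule sum.group) (use fin fg in auto)
  finally show ?thesis .
qed

text \<open>Give \<open>x\<close> the weight of the first member of the flag that contains it. The
  vectors of weight at most \<open>t\<close> are a basis of the member at \<open>t\<close>, so there
  are as many of them as there are weights \<open>a $ i\<close> up to \<open>t\<close>.\<close>

lemma adapted_basis_weights:
  fixes b :: "'n::finite \<Rightarrow> 'k::field ^ 'n" and a :: "real ^ 'n"
  assumes b: "frame b" and E: "adapted_basis (flag b a ` range (($) a)) E"
  obtains \<alpha> where "\<And>x. x \<in> E \<Longrightarrow> x \<in> flag b a (\<alpha> x)" "\<And>x. x \<in> E \<Longrightarrow> \<alpha> x \<in> range (($) a)"
    "\<And>\<phi> :: real \<Rightarrow> real. (\<Sum>x\<in>E. \<phi> (\<alpha> x)) = (\<Sum>i\<in>UNIV. \<phi> (a $ i))"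
proof -
  define R where "R = range (($) a)"
  have R: "finite R" "R \<noteq> {}" by (auto simp: R_def)
  have finE: "finite E" using E by (auto simp: adapted_basis_def vec.finiteI_independent)
  define \<alpha> where "\<alpha> = (\<lambda>x. Min {t\<in>R. x \<in> flag b a t})"
  have top: "flag b a (Max R) = UNIV"
  proof -
    have "{i. a $ i \<le> Max R} = UNIV" using R by (auto simp: R_def)
    thus ?thesis using span_frame[OF b] by (simp add: flag_def)
  qed
  have ne: "{t\<in>R. x \<in> flag b a t} \<noteq> {}" for x
    using top Max_in[OF R] by auto
  have \<alpha>: "\<alpha> x \<in> R" "x \<in> flag b a (\<alpha> x)" for x
    using Min_in[OF _ ne[of x]] R unfolding \<alpha>_def by simp_all
  have \<alpha>_le: "\<alpha> x \<le> t \<longleftrightarrow> x \<in> flag b a t" if "t \<in> R" for x t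
  proof
    assume "\<alpha> x \<le> t"
    thus "x \<in> flag b a t" using \<alpha>(2)[of x] flag_mono[of "\<alpha> x" t b a] by blast
  next
    assume "x \<in> flag b a t"
    thus "\<alpha> x \<le> t" unfolding \<alpha>_def using that R by (intro Min_le) auto
  qed
  have "(\<Sum>x\<in>E. \<phi> (\<alpha> x)) = (\<Sum>i\<in>UNIV. \<phi> (a $ i))" for \<phi> :: "real \<Rightarrow> real"
  proof (rule sum_eq_of_cumulative_counts[where f = \<alpha> and g = "($) a" and R = R])
    fix t assume t: "t \<in> R"
    have "vec.independent (E \<inter> flag b a t)"
      using E vec.independent_mono[of E "E \<inter> flag b a t"] by (simp add: adapted_basis_def)
    moreover have "flag b a t \<subseteq> vec.span (E \<inter> flag b a t)"
      using E t by (auto simp: adapted_basis_def R_def)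
    ultimately have c: "card (E \<inter> flag b a t) = vec.dim (flag b a t)"
      by (intro vec.basis_card_eq_dim) auto
    have "{x \<in> E. \<alpha> x \<le> t} = E \<inter> flag b a t" using \<alpha>_le[OF t] by auto
    thus "card {x \<in> E. \<alpha> x \<le> t} = card {i \<in> UNIV. a $ i \<le> t}"
      using c dim_flag[OF b, of a t] by simp
  qed (use R finE \<alpha> in \<open>auto simp: R_def\<close>)
  thus ?thesis using that[of \<alpha>] \<alpha> unfolding R_def by blast
qed

text \<open>A second presentation of one filtration. The condition on all \<phi> expresses that the
  weights agree as multisets.\<close>

definition same_flag ::
  "('n::finite \<Rightarrow> 'k::field ^ 'n) \<Rightarrow> real ^ 'n \<Rightarrow> ('n \<Rightarrow> 'k ^ 'n) \<Rightarrow> real ^ 'n \<Rightarrow> bool" where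
  "same_flag b a e \<alpha> \<longleftrightarrow> (\<forall>i. e i \<in> flag b a (\<alpha> $ i)) \<and> range (($) \<alpha>) \<subseteq> range (($) a) \<and>
     (\<forall>\<phi> :: real \<Rightarrow> real. (\<Sum>i\<in>UNIV. \<phi> (\<alpha> $ i)) = (\<Sum>i\<in>UNIV. \<phi> (a $ i))) \<and>
     (\<forall>t. flag e \<alpha> t = flag b a t)"

lemma same_flagI:
  fixes b e :: "'n::finite \<Rightarrow> 'k::field ^ 'n" and a \<alpha> :: "real ^ 'n"
  assumes "frame b" "frame e" and e: "\<And>i. e i \<in> flag b a (\<alpha> $ i)" "range (($) \<alpha>) \<subseteq> range (($) a)"
    and sum: "\<And>\<phi> :: real \<Rightarrow> real. (\<Sum>i\<in>UNIV. \<phi> (\<alpha> $ i)) = (\<Sum>i\<in>UNIV. \<phi> (a $ i))"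
  shows "same_flag b a e \<alpha>"
proof -
  have "flag e \<alpha> t = flag b a t" for t
  proof (rule vec.subspace_dim_equal)
    show "flag e \<alpha> t \<subseteq> flag b a t"
      unfolding flag_def[of e]
    proof (rule vec.span_minimal)
      show "e ` {i. \<alpha> $ i \<le> t} \<subseteq> flag b a t" using e(1) flag_mono by blast
    qed (rule flag_subspace)
    have "real (card {i. \<alpha> $ i \<le> t}) = real (card {i. a $ i \<le> t})"
      using sum[of "\<lambda>x. if x \<le> t then 1 else 0"]
        sum.inter_filter[of UNIV "\<lambda>_. 1 :: real" "\<lambda>i. \<alpha> $ i \<le> t"]
        sum.inter_filter[of UNIV "\<lambda>_. 1 :: real" "\<lambda>i. a $ i \<le> t"] by simp
    thus "vec.dim (flag b a t) \<le> vec.dim (flag e \<alpha> t)"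
      using assms(1,2) by (simp add: dim_flag)
  qed (rule flag_subspace)+
  thus ?thesis unfolding same_flag_def using e sum by simp
qed

lemma flag_family:
  fixes b :: "'n::finite \<Rightarrow> 'k::field ^ 'n" and a :: "real ^ 'n"
  assumes b: "frame b"
  shows "finite (flag b a ` range (($) a))"
    "A \<in> flag b a ` range (($) a) \<Longrightarrow> vec.subspace A"
    "A \<in> flag b a ` range (($) a) \<Longrightarrow> A' \<in> flag b a ` range (($) a) \<Longrightarrow> A \<subseteq> A' \<or> A' \<subseteq> A"
    "\<exists>E. adapted_basis (flag b a ` range (($) a)) E"
proof -
  show "finite (flag b a ` range (($) a))" by simp
  show "vec.subspace A" if "A \<in> flag b a ` range (($) a)" using that flag_subspace by blast
  show "A \<subseteq> A' \<or> A' \<subseteq> A" if A: "A \<in> flag b a ` range (($) a)" "A' \<in> flag b a ` range (($) a)"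
  proof -
    obtain s t where "A = flag b a s" "A' = flag b a t" using A by blast
    thus ?thesis using flag_mono[of s t b a] flag_mono[of t s b a] linear[of s t] by blast
  qed
  have "adapted_basis (flag b a ` range (($) a)) (range b)"
    unfolding adapted_basis_def
  proof (intro conjI ballI)
    show "vec.independent (range b)" "vec.span (range b) = UNIV"
      using b span_frame[OF b] by (auto simp: frame_def)
    fix A assume "A \<in> flag b a ` range (($) a)"
    then obtain t where t: "A = flag b a t" by blast
    have "b ` {i. a $ i \<le> t} \<subseteq> range b \<inter> A"
      unfolding t flag_def by (auto intro: vec.span_base)
    thus "A \<subseteq> vec.span (range b \<inter> A)"
      using vec.span_mono[of "b ` {i. a $ i \<le> t}" "range b \<inter> A"] by (simp add: t flag_def)
  qed
  thus "\<exists>E. adapted_basis (flag b a ` range (($) a)) E" by blast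
qed

lemma common_frame:
  fixes b b' :: "'n::finite \<Rightarrow> 'k::field ^ 'n" and a a' :: "real ^ 'n"
  assumes b: "frame b" and b': "frame b'"
  obtains e \<alpha> \<alpha>' where "frame e" "same_flag b a e \<alpha>" "same_flag b' a' e \<alpha>'"
proof -
  define \<A> \<B> where "\<A> = flag b a ` range (($) a)" and "\<B> = flag b' a' ` range (($) a')"
  note A = flag_family[OF b, where a = a, folded \<A>_def]
    and B = flag_family[OF b', where a = a', folded \<B>_def]
  have "\<exists>E. adapted_basis \<A> E \<and> adapted_basis \<B> E"
  proof (rule common_adapted_basis[OF A(1) B(1) _ A(3) B(3) A(4)])
    show "vec.subspace C" if "C \<in> \<A> \<union> \<B>" for C using that A(2) B(2) by blast
  qed
  then obtain E where E: "adapted_basis \<A> E" "adapted_basis \<B> E" by blast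
  obtain \<alpha> where \<alpha>: "\<And>x. x \<in> E \<Longrightarrow> x \<in> flag b a (\<alpha> x)" "\<And>x. x \<in> E \<Longrightarrow> \<alpha> x \<in> range (($) a)"
    "\<And>\<phi> :: real \<Rightarrow> real. (\<Sum>x\<in>E. \<phi> (\<alpha> x)) = (\<Sum>i\<in>UNIV. \<phi> (a $ i))"
    using adapted_basis_weights[OF b E(1)[unfolded \<A>_def]] by blast
  obtain \<alpha>' where \<alpha>': "\<And>x. x \<in> E \<Longrightarrow> x \<in> flag b' a' (\<alpha>' x)" "\<And>x. x \<in> E \<Longrightarrow> \<alpha>' x \<in> range (($) a')"
    "\<And>\<phi> :: real \<Rightarrow> real. (\<Sum>x\<in>E. \<phi> (\<alpha>' x)) = (\<Sum>i\<in>UNIV. \<phi> (a' $ i))"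
    using adapted_basis_weights[OF b' E(2)[unfolded \<B>_def]] by blast
  have indep: "vec.independent E" using E by (simp add: adapted_basis_def)
  hence "card E = vec.dim (UNIV :: ('k ^ 'n) set)"
    using E by (intro vec.basis_card_eq_dim) (auto simp: adapted_basis_def)
  hence "card E = CARD('n)" by (simp only: vec_dim_card)
  then obtain e :: "'n \<Rightarrow> 'k ^ 'n" where e: "bij_betw e UNIV E"
    using finite_same_card_bij[of "UNIV :: 'n set" E] vec.finiteI_independent[OF indep] by auto
  have eE: "e i \<in> E" for i using bij_betwE[OF e] by simp
  have fr: "frame e" using e indep by (simp add: frame_def bij_betw_def)
  have same: "same_flag c d e (\<chi> i. \<gamma> (e i))"
    if c: "frame c" and \<gamma>: "\<And>x. x \<in> E \<Longrightarrow> x \<in> flag c d (\<gamma> x)" "\<And>x. x \<in> E \<Longrightarrow> \<gamma> x \<in> range (($) d)"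
      "\<And>\<phi> :: real \<Rightarrow> real. (\<Sum>x\<in>E. \<phi> (\<gamma> x)) = (\<Sum>i\<in>UNIV. \<phi> (d $ i))"
    for c :: "'n \<Rightarrow> 'k ^ 'n" and d :: "real ^ 'n" and \<gamma>
  proof (rule same_flagI[OF c fr])
    show "e i \<in> flag c d ((\<chi> i. \<gamma> (e i)) $ i)" for i using \<gamma>(1) eE by simp
    show "range (($) (\<chi> i. \<gamma> (e i))) \<subseteq> range (($) d)" using \<gamma>(2) eE by auto
    show "(\<Sum>i\<in>UNIV. \<phi> ((\<chi> i. \<gamma> (e i)) $ i)) = (\<Sum>i\<in>UNIV. \<phi> (d $ i))" for \<phi> :: "real \<Rightarrow> real"
      using \<gamma>(3)[of \<phi>] sum.reindex_bij_betw[OF e, of "\<lambda>x. \<phi> (\<gamma> x)"] by simp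
  qed
  show ?thesis using that[OF fr same[OF b \<alpha>] same[OF b' \<alpha>']] .
qed

section \<open>Weights supporting a tensor\<close>

text \<open>Weights 0 and 1 encode subspaces: the vectors of weight 0 span three subspaces on whose
  product the tensor vanishes. Over an algebraically closed field, the least total weight is the
  G-stable rank of the tensor.\<close>

definition weights_support ::
  "('k::field, 'n1::finite, 'n2::finite, 'n3::finite) tensor3 \<Rightarrow> ('n1 \<Rightarrow> 'k ^ 'n1) \<Rightarrow> ('n2 \<Rightarrow> 'k ^ 'n2) \<Rightarrow>
    ('n3 \<Rightarrow> 'k ^ 'n3) \<Rightarrow> real ^ 'n1 \<Rightarrow> real ^ 'n2 \<Rightarrow> real ^ 'n3 \<Rightarrow> bool" where
  "weights_support T b1 b2 b3 a1 a2 a3 \<longleftrightarrow> frame b1 \<and> frame b2 \<and> frame b3 \<and>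
     (\<forall>i j k. trilinear_form T (b1 i) (b2 j) (b3 k) \<noteq> 0 \<longrightarrow> 1 \<le> a1 $ i + a2 $ j + a3 $ k)"

definition weight_set ::
  "('k::field, 'n1::finite, 'n2::finite, 'n3::finite) tensor3 \<Rightarrow>
    ((real ^ 'n1) \<times> (real ^ 'n2) \<times> (real ^ 'n3)) set" where
  "weight_set T = {(a1, a2, a3). a1 \<in> cbox 0 1 \<and> a2 \<in> cbox 0 1 \<and> a3 \<in> cbox 0 1 \<and>
     (\<exists>b1 b2 b3. weights_support T b1 b2 b3 a1 a2 a3)}"

lemma trilinear_form_vanishes_span:
  assumes "\<And>x y z. x \<in> A \<Longrightarrow> y \<in> B \<Longrightarrow> z \<in> C \<Longrightarrow> trilinear_form T x y z = 0"
    and "x \<in> vec.span A" "y \<in> vec.span B" "z \<in> vec.span C"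
  shows "trilinear_form T x y z = 0"
proof -
  note sub = vec.subspace_def trilinear_form_zero trilinear_form_add trilinear_form_scale
  have "vec.span A \<subseteq> {x. \<forall>y\<in>B. \<forall>z\<in>C. trilinear_form T x y z = 0}"
    using assms(1) by (intro vec.span_minimal) (auto simp: sub)
  hence "vec.span B \<subseteq> {y. \<forall>x\<in>vec.span A. \<forall>z\<in>C. trilinear_form T x y z = 0}"
    by (intro vec.span_minimal) (auto simp: sub)
  hence "vec.span C \<subseteq> {z. \<forall>x\<in>vec.span A. \<forall>y\<in>vec.span B. trilinear_form T x y z = 0}"
    by (intro vec.span_minimal) (auto simp: sub)
  thus ?thesis using assms(2-4) by blast
qed

text \<open>The support condition depends on the flags alone, so it passes to every other frame
  adapted to them.\<close>

lemma weights_support_flag: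
  assumes "weights_support T b1 b2 b3 a1 a2 a3"
    and "x \<in> flag b1 a1 s" "y \<in> flag b2 a2 t" "z \<in> flag b3 a3 u" "trilinear_form T x y z \<noteq> 0"
  shows "1 \<le> s + t + u"
proof (rule ccontr)
  assume lt: "\<not> 1 \<le> s + t + u"
  have "trilinear_form T (b1 i) (b2 j) (b3 k) = 0" if "a1 $ i \<le> s" "a2 $ j \<le> t" "a3 $ k \<le> u" for i j k
  proof -
    have "\<not> 1 \<le> a1 $ i + a2 $ j + a3 $ k" using that lt by linarith
    thus ?thesis using assms(1) unfolding weights_support_def by blast
  qed
  hence "trilinear_form T x y z = 0"
    using assms(2-4)[unfolded flag_def]
    by (elim trilinear_form_vanishes_span[rotated]) auto
  thus False using assms by simp
qed

text \<open>There may be infinitely many frames, but a frame matters only through the set of index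
  triples where the tensor is nonzero. So the set is a finite union of polytopes in the unit
  cube.\<close>

lemma compact_weight_set:
  fixes T :: "('k::field, 'n1::finite, 'n2::finite, 'n3::finite) tensor3"
  shows "compact (weight_set T)"
proof -
  define \<P> where "\<P> = {P. \<exists>b1 b2 b3. frame b1 \<and> frame b2 \<and> frame b3 \<and>
     (\<forall>i j k. trilinear_form T (b1 i) (b2 j) (b3 k) \<noteq> 0 \<longrightarrow> (i, j, k) \<in> P)}"
  define W where "W = (\<lambda>P. (cbox 0 1 \<times> cbox 0 1 \<times> cbox 0 1) \<inter>
     (\<Inter>(i, j, k)\<in>P. {a :: (real ^ 'n1) \<times> (real ^ 'n2) \<times> (real ^ 'n3).
        1 \<le> fst a $ i + fst (snd a) $ j + snd (snd a) $ k}))"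
  have "weight_set T = (\<Union>P\<in>\<P>. W P)"
  proof (intro equalityI subsetI)
    fix a assume "a \<in> weight_set T"
    then obtain a1 a2 a3 b1 b2 b3 where a: "a = (a1, a2, a3)" "a1 \<in> cbox 0 1" "a2 \<in> cbox 0 1" "a3 \<in> cbox 0 1"
      "weights_support T b1 b2 b3 a1 a2 a3" by (auto simp: weight_set_def)
    define P where "P = {(i, j, k). trilinear_form T (b1 i) (b2 j) (b3 k) \<noteq> 0}"
    have "P \<in> \<P>" using a unfolding \<P>_def P_def weights_support_def by blast
    moreover have "a \<in> W P" using a by (auto simp: W_def P_def weights_support_def)
    ultimately show "a \<in> (\<Union>P\<in>\<P>. W P)" by blast
  next
    fix a assume "a \<in> (\<Union>P\<in>\<P>. W P)"
    then obtain P where P: "P \<in> \<P>" "a \<in> W P" by blast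
    then obtain b1 b2 b3 where b: "frame b1" "frame b2" "frame b3"
     "\<And>i j k. trilinear_form T (b1 i) (b2 j) (b3 k) \<noteq> 0 \<Longrightarrow> (i, j, k) \<in> P"
      by (auto simp: \<P>_def)
    have "weights_support T b1 b2 b3 (fst a) (fst (snd a)) (snd (snd a))"
      using b P(2) unfolding weights_support_def W_def by blast
    thus "a \<in> weight_set T" using P(2) by (force simp: weight_set_def W_def)
  qed
  moreover have "compact (W P)" for P
    unfolding W_def
    by (intro compact_Int_closed compact_Times compact_cbox closed_INT)
       (auto intro!: closed_Collect_le continuous_intros)
  ultimately show ?thesis by (simp add: compact_UN)
qed

definition energy :: "real \<Rightarrow> real ^ 'n::finite \<Rightarrow> real" where
  "energy \<epsilon> a = (\<Sum>i\<in>UNIV. a $ i + \<epsilon> * (a $ i)\<^sup>2)"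

lemma energy_midpoint:
  fixes a a' :: "real ^ 'n::finite"
  shows
  "energy \<epsilon> ((1 / 2) *\<^sub>R (a + a')) =
     (energy \<epsilon> a + energy \<epsilon> a') / 2 - \<epsilon> / 4 * (\<Sum>i\<in>UNIV. (a $ i - a' $ i)\<^sup>2)"
  unfolding energy_def sum.distrib[symmetric] sum_divide_distrib sum_distrib_left sum_subtractf[symmetric]
  by (intro sum.cong) (auto simp: power2_eq_square field_simps)

lemma energy_same_flag: "same_flag b a e \<alpha> \<Longrightarrow> energy \<epsilon> \<alpha> = energy \<epsilon> a"
  unfolding energy_def same_flag_def by (elim conjE allE[of _ "\<lambda>x. x + \<epsilon> * x\<^sup>2"]) simp

lemma same_flag_cbox: "same_flag b a e \<alpha> \<Longrightarrow> a \<in> cbox 0 1 \<Longrightarrow> \<alpha> \<in> cbox 0 1"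
  unfolding same_flag_def mem_box_cart by (auto simp: image_subset_iff) (metis rangeE)+

text \<open>The energy is strictly convex along the segment joining two weights on a common frame.\<close>

lemma minimal_weights_flag_unique:
  fixes T :: "('k::field, 'n1::finite, 'n2::finite, 'n3::finite) tensor3"
  assumes \<epsilon>: "\<epsilon> > 0" and a: "(a1, a2, a3) \<in> weight_set T"
    and min: "\<And>c1 c2 c3. (c1, c2, c3) \<in> weight_set T \<Longrightarrow>
       energy \<epsilon> a1 + energy \<epsilon> a2 + energy \<epsilon> a3 \<le> energy \<epsilon> c1 + energy \<epsilon> c2 + energy \<epsilon> c3"
    and b: "weights_support T b1 b2 b3 a1 a2 a3" and b': "weights_support T b1' b2' b3' a1 a2 a3"
  shows "flag b1 a1 t = flag b1' a1 t" "flag b2 a2 t = flag b2' a2 t" "flag b3 a3 t = flag b3' a3 t"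
proof -
  have fr: "frame b1" "frame b2" "frame b3" "frame b1'" "frame b2'" "frame b3'"
    using b b' by (auto simp: weights_support_def)
  obtain e1 \<alpha>1 \<beta>1 where e1: "frame e1" "same_flag b1 a1 e1 \<alpha>1" "same_flag b1' a1 e1 \<beta>1"
    by (rule common_frame[OF fr(1,4)])
  obtain e2 \<alpha>2 \<beta>2 where e2: "frame e2" "same_flag b2 a2 e2 \<alpha>2" "same_flag b2' a2 e2 \<beta>2"
    by (rule common_frame[OF fr(2,5)])
  obtain e3 \<alpha>3 \<beta>3 where e3: "frame e3" "same_flag b3 a3 e3 \<alpha>3" "same_flag b3' a3 e3 \<beta>3"
    by (rule common_frame[OF fr(3,6)])
  \<comment> \<open>Both weights live on one frame and support the tensor there, so their average
    does too.\<close>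
  define c1 c2 c3 where "c1 = (1 / 2) *\<^sub>R (\<alpha>1 + \<beta>1)" and "c2 = (1 / 2) *\<^sub>R (\<alpha>2 + \<beta>2)"
    and "c3 = (1 / 2) *\<^sub>R (\<alpha>3 + \<beta>3)"
  have "weights_support T e1 e2 e3 c1 c2 c3"
    unfolding weights_support_def
  proof (intro conjI allI impI e1 e2 e3)
    fix i j k assume nz: "trilinear_form T (e1 i) (e2 j) (e3 k) \<noteq> 0"
    have "1 \<le> \<alpha>1 $ i + \<alpha>2 $ j + \<alpha>3 $ k"
      using weights_support_flag[OF b _ _ _ nz] e1 e2 e3 by (simp add: same_flag_def)
    moreover have "1 \<le> \<beta>1 $ i + \<beta>2 $ j + \<beta>3 $ k"
      using weights_support_flag[OF b' _ _ _ nz] e1 e2 e3 by (simp add: same_flag_def)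
    ultimately show "1 \<le> c1 $ i + c2 $ j + c3 $ k"
      by (simp add: c1_def c2_def c3_def field_simps)
  qed
  moreover have mid: "(1 / 2) *\<^sub>R (x + y) \<in> cbox 0 1" if "x \<in> cbox 0 1" "y \<in> cbox 0 1"
    for x y :: "real ^ 'm::finite"
  proof -
    have "0 \<le> (x $ i + y $ i) / 2" "(x $ i + y $ i) / 2 \<le> 1" for i
      using that[unfolded mem_box_cart, THEN spec, of i] by simp_all
    thus ?thesis by (simp add: mem_box_cart)
  qed
  have ca: "a1 \<in> cbox 0 1" "a2 \<in> cbox 0 1" "a3 \<in> cbox 0 1"
    using a by (auto simp: weight_set_def)
  have "c1 \<in> cbox 0 1"
    unfolding c1_def by (intro mid same_flag_cbox[OF e1(2)] same_flag_cbox[OF e1(3)] ca)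
  moreover have "c2 \<in> cbox 0 1"
    unfolding c2_def by (intro mid same_flag_cbox[OF e2(2)] same_flag_cbox[OF e2(3)] ca)
  moreover have "c3 \<in> cbox 0 1"
    unfolding c3_def by (intro mid same_flag_cbox[OF e3(2)] same_flag_cbox[OF e3(3)] ca)
  ultimately have "(c1, c2, c3) \<in> weight_set T"
    unfolding weight_set_def by blast
  hence "energy \<epsilon> a1 + energy \<epsilon> a2 + energy \<epsilon> a3 \<le> energy \<epsilon> c1 + energy \<epsilon> c2 + energy \<epsilon> c3" by (rule min)
  also have "\<dots> = energy \<epsilon> a1 + energy \<epsilon> a2 + energy \<epsilon> a3 - \<epsilon> / 4 * ((\<Sum>i\<in>UNIV. (\<alpha>1 $ i - \<beta>1 $ i)\<^sup>2) +
      (\<Sum>i\<in>UNIV. (\<alpha>2 $ i - \<beta>2 $ i)\<^sup>2) + (\<Sum>i\<in>UNIV. (\<alpha>3 $ i - \<beta>3 $ i)\<^sup>2))"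
    unfolding c1_def c2_def c3_def energy_midpoint
      energy_same_flag[OF e1(2)] energy_same_flag[OF e1(3)] energy_same_flag[OF e2(2)]
      energy_same_flag[OF e2(3)] energy_same_flag[OF e3(2)] energy_same_flag[OF e3(3)]
    by (simp add: algebra_simps)
  finally have le: "(\<Sum>i\<in>UNIV. (\<alpha>1 $ i - \<beta>1 $ i)\<^sup>2) + (\<Sum>i\<in>UNIV. (\<alpha>2 $ i - \<beta>2 $ i)\<^sup>2) +
      (\<Sum>i\<in>UNIV. (\<alpha>3 $ i - \<beta>3 $ i)\<^sup>2) \<le> 0"
    using \<epsilon> by (simp add: mult_le_0_iff)
  have nn: "0 \<le> (\<Sum>i\<in>UNIV. (x $ i - y $ i)\<^sup>2)" for x y :: "real ^ 'm::finite"
    by (intro sum_nonneg) simp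
  have z: "x = y" if "(\<Sum>i\<in>UNIV. (x $ i - y $ i)\<^sup>2) = 0" for x y :: "real ^ 'm::finite"
    using that by (simp add: sum_nonneg_eq_0_iff vec_eq_iff)
  \<comment> \<open>The midpoint would have smaller energy otherwise. Equal weights on one frame
    define one flag, which is both of the given flags.\<close>
  have "\<alpha>1 = \<beta>1" "\<alpha>2 = \<beta>2" "\<alpha>3 = \<beta>3"
    using le nn[of \<alpha>1 \<beta>1] nn[of \<alpha>2 \<beta>2] nn[of \<alpha>3 \<beta>3] by (auto intro!: z)
  thus "flag b1 a1 t = flag b1' a1 t" "flag b2 a2 t = flag b2' a2 t" "flag b3 a3 t = flag b3' a3 t"
    using e1 e2 e3 by (auto simp: same_flag_def)
qed

section \<open>Rounding weights to subspaces\<close>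

lemma count_multiples_le:
  fixes h a :: real
  assumes "h > 0" "a \<ge> 0"
  shows "(\<Sum>p = 1..Q. of_bool (real p * h \<le> a)) \<le> a / h"
proof -
  \<comment> \<open>The second bound carries the induction: if the last multiple is at most
    \<open>a\<close>, the count is at most its index, which is at most a / h.\<close>
  have "(\<Sum>p = 1..Q. of_bool (real p * h \<le> a)) \<le> a / h \<and> (\<Sum>p = 1..Q. of_bool (real p * h \<le> a)) \<le> real Q"
  proof (induction Q)
    case 0
    thus ?case using assms by simp
  next
    case (Suc Q)
    show ?case
    proof (cases "real (Suc Q) * h \<le> a")
      case True
      hence "real (Suc Q) \<le> a / h" using assms by (simp add: field_simps)
      thus ?thesis using Suc True by simp
    next
      case False
      thus ?thesis using Suc by simp
    qed
  qed
  thus ?thesis by blast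
qed

text \<open>As M h = 1/3, the first two families together are the multiples p h with p up to 2M, of
  which at most a / h = 3 M a count. The third family has step 2h and contributes at most half as
  much, plus 1 for its threshold 0 at p = M.\<close>

lemma count_thresholds_le:
  fixes a :: real
  assumes a: "a \<ge> 0" and M: "M > 0"
  defines "h \<equiv> 1 / (3 * real M)"
  shows "(\<Sum>p = 1..M. of_bool (real p * h \<le> a) + of_bool (1 / 3 + real p * h \<le> a) +
      of_bool (2 / 3 - 2 * (real p * h) \<le> a)) \<le> 9 / 2 * real M * a + 1"
proof -
  have h: "h > 0" "real M * h = 1 / 3" using M by (simp_all add: h_def)
  have "(\<Sum>p = 1..M. of_bool (real p * h \<le> a)) + (\<Sum>p = 1..M. of_bool (1 / 3 + real p * h \<le> a)) =
      (\<Sum>p = 1..M. of_bool (real p * h \<le> a)) + (\<Sum>p = 1..M. of_bool (real (p + M) * h \<le> a))"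
    by (simp only: of_nat_add distrib_right h(2) add.commute)
  also have "(\<Sum>p = 1..M. of_bool (real (p + M) * h \<le> a)) = (\<Sum>p = M + 1..M + M. of_bool (real p * h \<le> a))"
    by (subst add.commute[of M 1]) (rule sum.shift_bounds_cl_nat_ivl[symmetric])
  also have "(\<Sum>p = 1..M. of_bool (real p * h \<le> a)) + (\<Sum>p = M + 1..M + M. of_bool (real p * h \<le> a)) =
      (\<Sum>p = 1..M + M. of_bool (real p * h \<le> a))"
    by (rule sum.ub_add_nat[symmetric]) simp
  also have "\<dots> \<le> a / h" by (rule count_multiples_le[OF h(1) a])
  finally have 1: "(\<Sum>p = 1..M. of_bool (real p * h \<le> a)) +
      (\<Sum>p = 1..M. of_bool (1 / 3 + real p * h \<le> a)) \<le> 3 * real M * a"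
    by (simp add: h_def mult_ac)
  have "(\<Sum>p = 1..M. of_bool (2 / 3 - 2 * (real p * h) \<le> a) :: real) =
      (\<Sum>p = 0..<M. of_bool (real p * (2 * h) \<le> a))"
  proof (rule sum.reindex_bij_witness[of _ "\<lambda>p. M - p" "\<lambda>p. M - p"])
    fix p assume "p \<in> {1..M}"
    hence "real (M - p) * (2 * h) = 2 * (real M * h) - 2 * (real p * h)"
      by (simp add: of_nat_diff algebra_simps)
    thus "of_bool (real (M - p) * (2 * h) \<le> a) = (of_bool (2 / 3 - 2 * (real p * h) \<le> a) :: real)"
      using h by simp
  qed (use M in auto)
  also have "\<dots> = of_bool (real 0 * (2 * h) \<le> a) + (\<Sum>p = 1..<M. of_bool (real p * (2 * h) \<le> a))"
    using M by (subst sum.atLeast_Suc_lessThan) simp_all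
  also have "\<dots> \<le> 1 + (\<Sum>p = 1..M. of_bool (real p * (2 * h) \<le> a))"
    by (intro add_mono sum_mono2) auto
  also have "\<dots> \<le> 1 + a / (2 * h)"
    using count_multiples_le[of "2 * h" a M] h a by simp
  finally have 2: "(\<Sum>p = 1..M. of_bool (2 / 3 - 2 * (real p * h) \<le> a)) \<le> 1 + 3 / 2 * real M * a"
    by (simp add: h_def mult_ac)
  show ?thesis using 1 2 by (simp add: sum.distrib)
qed

text \<open>For \<open>x\<close> uniform in \<open>[0, 1/3]\<close> and a random cyclic permutation, each entry of the triple
  \<open>(x, 1/3 + x, 2/3 - 2x)\<close> of thresholds with sum \<open>1\<close> is uniform in \<open>[0, 2/3]\<close>, so that
  a weight \<open>a\<close> reaches it with probability at most \<open>3a/2\<close>. The proof discretises \<open>x\<close>.\<close>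

lemma threshold_rounding:
  fixes a1 :: "real ^ 'n1::finite" and a2 :: "real ^ 'n2::finite" and a3 :: "real ^ 'n3::finite"
  assumes nonneg: "\<And>i. a1 $ i \<ge> 0" "\<And>i. a2 $ i \<ge> 0" "\<And>i. a3 $ i \<ge> 0"
    and S: "\<And>s t u. s + t + u \<le> 1 \<Longrightarrow>
      S \<le> real (card {i. s \<le> a1 $ i}) + real (card {i. t \<le> a2 $ i}) + real (card {i. u \<le> a3 $ i})"
  shows "S \<le> 3 / 2 * ((\<Sum>i\<in>UNIV. a1 $ i) + (\<Sum>i\<in>UNIV. a2 $ i) + (\<Sum>i\<in>UNIV. a3 $ i))"
proof -
  define A where "A = (\<Sum>i\<in>UNIV. a1 $ i) + (\<Sum>i\<in>UNIV. a2 $ i) + (\<Sum>i\<in>UNIV. a3 $ i)"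
  define n where "n = real CARD('n1) + real CARD('n2) + real CARD('n3)"
  \<comment> \<open>Each of M triples is used in its three cyclic shifts, so every weight meets all
    three kinds of threshold. The error \<open>n\<close> is one unit per coordinate; it disappears
    on division by 3M as M grows.\<close>
  have bound: "3 * real M * S \<le> 9 / 2 * real M * A + n" if M: "M > 0" for M
  proof -
    define h where "h = 1 / (3 * real M)"
    define C1 where "C1 = (\<lambda>s. real (card {i. s \<le> a1 $ i}))"
    define C2 where "C2 = (\<lambda>s. real (card {i. s \<le> a2 $ i}))"
    define C3 where "C3 = (\<lambda>s. real (card {i. s \<le> a3 $ i}))"
    have cnt: "(\<Sum>p = 1..M. real (card {i. real p * h \<le> a $ i}) + real (card {i. 1 / 3 + real p * h \<le> a $ i}) +
        real (card {i. 2 / 3 - 2 * (real p * h) \<le> a $ i})) \<le> 9 / 2 * real M * (\<Sum>i\<in>UNIV. a $ i) + real CARD('m)"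
      if "\<And>i. a $ i \<ge> 0" for a :: "real ^ 'm::finite"
    proof -
      have c: "real (card {i. s \<le> a $ i}) = (\<Sum>i\<in>UNIV. of_bool (s \<le> a $ i))" for s
        by simp
      have "(\<Sum>p = 1..M. real (card {i. real p * h \<le> a $ i}) + real (card {i. 1 / 3 + real p * h \<le> a $ i}) +
        real (card {i. 2 / 3 - 2 * (real p * h) \<le> a $ i})) =
        (\<Sum>i\<in>UNIV. \<Sum>p = 1..M. of_bool (real p * h \<le> a $ i) + of_bool (1 / 3 + real p * h \<le> a $ i) +
           of_bool (2 / 3 - 2 * (real p * h) \<le> a $ i))"
        unfolding c sum.distrib[symmetric] by (rule sum.swap)
      also have "\<dots> \<le> (\<Sum>i\<in>UNIV. 9 / 2 * real M * a $ i + 1)"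
        unfolding h_def by (intro sum_mono count_thresholds_le that M)
      also have "\<dots> = 9 / 2 * real M * (\<Sum>i\<in>UNIV. a $ i) + real CARD('m)"
        by (simp add: sum.distrib sum_distrib_left)
      finally show ?thesis .
    qed
    define D where "D = (\<lambda>C :: real \<Rightarrow> real. \<lambda>p :: nat.
      C (real p * h) + C (1 / 3 + real p * h) + C (2 / 3 - 2 * (real p * h)))"
    have "3 * real M * S = (\<Sum>p = 1..M. 3 * S)" by simp
    also have "\<dots> \<le> (\<Sum>p = 1..M. D C1 p + D C2 p + D C3 p)"
    proof (rule sum_mono)
      fix p
      have "S \<le> C1 (real p * h) + C2 (1 / 3 + real p * h) + C3 (2 / 3 - 2 * (real p * h))"
        "S \<le> C1 (1 / 3 + real p * h) + C2 (2 / 3 - 2 * (real p * h)) + C3 (real p * h)"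
        "S \<le> C1 (2 / 3 - 2 * (real p * h)) + C2 (real p * h) + C3 (1 / 3 + real p * h)"
        unfolding C1_def C2_def C3_def by (rule S, simp)+
      thus "3 * S \<le> D C1 p + D C2 p + D C3 p" unfolding D_def by linarith
    qed
    also have "\<dots> = (\<Sum>p = 1..M. D C1 p) + (\<Sum>p = 1..M. D C2 p) + (\<Sum>p = 1..M. D C3 p)"
      by (simp only: sum.distrib)
    also have "\<dots> \<le> (9 / 2 * real M * (\<Sum>i\<in>UNIV. a1 $ i) + real CARD('n1)) +
       (9 / 2 * real M * (\<Sum>i\<in>UNIV. a2 $ i) + real CARD('n2)) +
       (9 / 2 * real M * (\<Sum>i\<in>UNIV. a3 $ i) + real CARD('n3))"
      unfolding D_def C1_def C2_def C3_def by (intro add_mono cnt nonneg)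
    also have "\<dots> = 9 / 2 * real M * A + n" by (simp add: A_def n_def algebra_simps)
    finally show ?thesis .
  qed
  have "S \<le> 3 / 2 * A"
  proof (rule ccontr)
    assume "\<not> S \<le> 3 / 2 * A"
    hence d: "3 * (S - 3 / 2 * A) > 0" by simp
    then obtain M where M: "n < real M * (3 * (S - 3 / 2 * A))"
      using reals_Archimedean3 by blast
    moreover have "n \<ge> 0" by (simp add: n_def)
    ultimately have "M > 0" by (cases M) auto
    from bound[OF this] M show False by (simp add: algebra_simps)
  qed
  thus ?thesis by (simp add: A_def)
qed

section \<open>Descent of vanishing subspaces to the base field\<close>

lemma ac_endo_tensor:
  fixes T :: "('a::field, 'n1::finite, 'n2::finite, 'n3::finite) tensor3"
  assumes "ac_endo \<sigma>"
  shows "trilinear_form (tensor_to_ac T) (\<chi> i. \<sigma> (x $ i)) (\<chi> i. \<sigma> (y $ i)) (\<chi> i. \<sigma> (z $ i)) =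
    \<sigma> (trilinear_form (tensor_to_ac T) x y z)"
  by (simp add: trilinear_form_def tensor_to_ac_def ac_endo_sum[OF assms] ac_endo_mult[OF assms]
      ac_endo_to_ac[OF assms])

lemma trilinear_form_to_ac:
  "trilinear_form (tensor_to_ac T) (\<chi> i. to_ac (x $ i)) (\<chi> i. to_ac (y $ i)) (\<chi> i. to_ac (z $ i)) =
    to_ac (trilinear_form T x y z)"
  by (simp add: trilinear_form_def tensor_to_ac_def to_ac_sum)

lemma graph_space_to_ac:
  "x \<in> graph_space J m \<Longrightarrow> (\<chi> i. to_ac (x $ i)) \<in> graph_space J (\<lambda>i j. to_ac (m i j))"
  by (simp add: graph_space_def flip: to_ac_sum to_ac_mult)

lemma frame_ac_endo:
  assumes \<sigma>: "ac_endo \<sigma>" and b: "frame b"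
  shows "frame (\<lambda>i. \<chi> j. \<sigma> (b i $ j))"
proof -
  obtain B where "(\<chi> i. b i) ** B = mat 1" using b frame_iff_matrix by blast
  hence "(\<Sum>k\<in>UNIV. b i $ k * B $ k $ j) = (if i = j then 1 else 0)" for i j
    by (simp add: vec_eq_iff matrix_matrix_mult_def mat_def)
  hence "\<sigma> (\<Sum>k\<in>UNIV. b i $ k * B $ k $ j) = (if i = j then 1 else 0)" for i j
    by (simp add: ac_endo_0[OF \<sigma>] ac_endo_1[OF \<sigma>])
  hence "(\<chi> i. \<chi> j. \<sigma> (b i $ j)) ** (\<chi> k j. \<sigma> (B $ k $ j)) = mat 1"
    by (simp add: vec_eq_iff matrix_matrix_mult_def mat_def ac_endo_sum[OF \<sigma>] ac_endo_mult[OF \<sigma>])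
  thus ?thesis using frame_iff_matrix by blast
qed

lemma flag_ac_endo:
  fixes b :: "'b::finite \<Rightarrow> 'a::field alg_closure ^ 'b"
  assumes \<sigma>: "ac_endo \<sigma>" and v: "v \<in> flag b a t"
  shows "(\<chi> i. \<sigma> (v $ i)) \<in> flag (\<lambda>i. \<chi> j. \<sigma> (b i $ j)) a t"
proof -
  let ?W = "flag (\<lambda>i. \<chi> j. \<sigma> (b i $ j)) a t"
  have W: "vec.subspace ?W" by (rule flag_subspace)
  have "flag b a t \<subseteq> {v. (\<chi> i. \<sigma> (v $ i)) \<in> ?W}"
    unfolding flag_def[of b]
  proof (rule vec.span_minimal)
    show "b ` {i. a $ i \<le> t} \<subseteq> {v. (\<chi> i. \<sigma> (v $ i)) \<in> ?W}"
      unfolding flag_def by (auto intro!: vec.span_base)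
    show "vec.subspace {v. (\<chi> i. \<sigma> (v $ i)) \<in> ?W}"
    proof (rule vec.subspaceI, unfold mem_Collect_eq)
      have "(\<chi> i. \<sigma> (0 $ i)) = (0 :: 'a alg_closure ^ 'b)"
        by (simp add: vec_eq_iff ac_endo_0[OF \<sigma>])
      thus "(\<chi> i. \<sigma> (0 $ i)) \<in> ?W" using vec.subspace_0[OF W] by simp
      fix x y :: "'a alg_closure ^ 'b" and c
      assume x: "(\<chi> i. \<sigma> (x $ i)) \<in> ?W"
      have "(\<chi> i. \<sigma> ((c *s x) $ i)) = \<sigma> c *s (\<chi> i. \<sigma> (x $ i))"
        by (simp add: vec_eq_iff ac_endo_mult[OF \<sigma>])
      thus "(\<chi> i. \<sigma> ((c *s x) $ i)) \<in> ?W" using vec.subspace_scale[OF W x] by simp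
      assume y: "(\<chi> i. \<sigma> (y $ i)) \<in> ?W"
      have "(\<chi> i. \<sigma> ((x + y) $ i)) = (\<chi> i. \<sigma> (x $ i)) + (\<chi> i. \<sigma> (y $ i))"
        by (simp add: vec_eq_iff ac_endo_add[OF \<sigma>])
      thus "(\<chi> i. \<sigma> ((x + y) $ i)) \<in> ?W" using vec.subspace_add[OF W x y] by simp
    qed
  qed
  thus ?thesis using v by blast
qed

text \<open>A supported tensor is forced to vanish only for thresholds with sum less than 1, but the
  thresholds in use may have sum 1. Lowering a threshold to the next smaller weight selects the same
  indices and makes the inequality strict.\<close>

lemma strict_threshold:
  fixes a :: "real ^ 'n::finite"
  obtains s' where "s' < s" "{i. a $ i \<le> s'} = {i. a $ i < s}"
proof -
  \<comment> \<open>The element \<open>s - 1\<close> serves if no weight lies below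
    \<open>s\<close>.\<close>
  define R where "R = insert (s - 1) {a $ i | i. a $ i < s}"
  have R: "finite R" "R \<noteq> {}" by (auto simp: R_def)
  have "Max R < s" using R by (subst Max_less_iff) (auto simp: R_def)
  moreover have "a $ i \<le> Max R" if "a $ i < s" for i
    using R that by (intro Max_ge) (auto simp: R_def)
  ultimately show ?thesis by (intro that[of "Max R"]) force+
qed

lemma subspace_frame:
  fixes U :: "('k::field ^ 'n::finite) set"
  assumes U: "vec.subspace U"
  obtains b where "frame b" "card {i. b i \<notin> U} = CARD('n) - vec.dim U"
proof -
  obtain B where B: "B \<subseteq> U" "vec.independent B" "U \<subseteq> vec.span B" "card B = vec.dim U"
    using vec.basis_exists[of U] by blast
  obtain E where E: "B \<subseteq> E" "vec.independent E" "UNIV \<subseteq> vec.span E"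
    using vec.maximal_independent_subset_extend[OF subset_UNIV B(2)] by metis
  have finE: "finite E" using E(2) by (rule vec.finiteI_independent)
  have "card E = vec.dim (UNIV :: ('k ^ 'n) set)" using E by (intro vec.basis_card_eq_dim) auto
  hence cE: "card E = CARD('n)" by (simp only: vec_dim_card)
  then obtain b :: "'n \<Rightarrow> 'k ^ 'n" where b: "bij_betw b UNIV E"
    using finite_same_card_bij[of "UNIV :: 'n set" E] finE by auto
  have "vec.independent (E \<inter> U)" using E(2) by (rule vec.independent_mono) blast
  hence "card (E \<inter> U) \<le> card B"
    using vec.independent_card_le_dim[of "E \<inter> U" U] B(4) by simp
  moreover have "B \<subseteq> E \<inter> U" using B E by blast
  ultimately have "card (E \<inter> U) = card B"
    using card_mono[of "E \<inter> U" B] finE by simp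
  moreover have "card (E - U) = card E - card (E \<inter> U)"
    by (rule card_Diff_subset_Int) (use finE in simp)
  moreover have "bij_betw b {i. b i \<notin> U} (E - U)"
    using b unfolding bij_betw_def by (auto simp: inj_on_def)
  hence "card {i. b i \<notin> U} = card (E - U)" by (rule bij_betw_same_card)
  ultimately have "card {i. b i \<notin> U} = CARD('n) - vec.dim U" using cE B(4) by simp
  moreover have "frame b" using b E(2) by (simp add: frame_def bij_betw_def)
  ultimately show ?thesis using that by blast
qed

text \<open>An endomorphism \<sigma> fixes the tensor, so it maps a supporting frame to one that
  supports the same weights. By uniqueness it preserves the flags, whose members are therefore graph
  spaces with matrices over F.\<close>

lemma slice_rank_le_weights:
  fixes T :: "('a::field, 'n1::finite, 'n2::finite, 'n3::finite) tensor3"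
  assumes perfect: "perfect_field TYPE('a)"
    and b: "weights_support (tensor_to_ac T) b1 b2 b3 a1 a2 a3"
    and unique: "\<And>b1' b2' b3' t. weights_support (tensor_to_ac T) b1' b2' b3' a1 a2 a3 \<Longrightarrow>
      flag b1 a1 t = flag b1' a1 t \<and> flag b2 a2 t = flag b2' a2 t \<and> flag b3 a3 t = flag b3' a3 t"
    and stu: "s + t + u \<le> 1"
  shows "slice_rank T \<le> card {i. s \<le> a1 $ i} + card {i. t \<le> a2 $ i} + card {i. u \<le> a3 $ i}"
proof -
  have fr: "frame b1" "frame b2" "frame b3" using b by (auto simp: weights_support_def)
  have inv: "(\<chi> i. \<sigma> (x $ i)) \<in> flag b1 a1 r" "(\<chi> i. \<sigma> (y $ i)) \<in> flag b2 a2 r" "(\<chi> i. \<sigma> (z $ i)) \<in> flag b3 a3 r"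
    if \<sigma>: "ac_endo \<sigma>" and "x \<in> flag b1 a1 r" "y \<in> flag b2 a2 r" "z \<in> flag b3 a3 r" for \<sigma> x y z r
  proof -
    have "weights_support (tensor_to_ac T) (\<lambda>i. \<chi> j. \<sigma> (b1 i $ j)) (\<lambda>i. \<chi> j. \<sigma> (b2 i $ j))
        (\<lambda>i. \<chi> j. \<sigma> (b3 i $ j)) a1 a2 a3"
      using b unfolding weights_support_def ac_endo_tensor[OF \<sigma>]
      by (auto intro!: frame_ac_endo[OF \<sigma>] simp: ac_endo_0[OF \<sigma>])
        (metis ac_endo_0[OF \<sigma>])
    from unique[OF this, of r] show "(\<chi> i. \<sigma> (x $ i)) \<in> flag b1 a1 r"
       "(\<chi> i. \<sigma> (y $ i)) \<in> flag b2 a2 r" "(\<chi> i. \<sigma> (z $ i)) \<in> flag b3 a3 r"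
      using flag_ac_endo[OF \<sigma> that(2)] flag_ac_endo[OF \<sigma> that(3)] flag_ac_endo[OF \<sigma> that(4)] by simp_all
  qed
  have rational: "\<exists>J m. card (- J) = card {i. s \<le> a $ i} \<and>
      flag b a s' = graph_space J (\<lambda>i j. to_ac (m i j :: 'a))"
    if fb: "frame b" and s': "{i. a $ i \<le> s'} = {i. a $ i < s}"
      and i: "\<And>\<sigma> v. ac_endo \<sigma> \<Longrightarrow> v \<in> flag b a s' \<Longrightarrow> (\<chi> i. \<sigma> (v $ i)) \<in> flag b a s'"
    for b :: "'m::finite \<Rightarrow> 'a alg_closure ^ 'm" and a :: "real ^ 'm" and s s'
  proof -
    obtain J and m :: "'m \<Rightarrow> 'm \<Rightarrow> 'a" where J: "card J = vec.dim (flag b a s')"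
      "flag b a s' = graph_space J (\<lambda>i j. to_ac (m i j))"
      using ac_endo_invariant_subspace[OF perfect flag_subspace i] by blast
    have "card (- J) = CARD('m) - card {i. a $ i < s}"
      using J(1) s' by (simp add: Compl_eq_Diff_UNIV card_Diff_subset dim_flag[OF fb])
    also have "\<dots> = card (- {i. a $ i < s})" by (simp add: Compl_eq_Diff_UNIV card_Diff_subset)
    also have "- {i. a $ i < s} = {i. s \<le> a $ i}" by auto
    finally show ?thesis using J(2) by blast
  qed
  obtain s' where s': "s' < s" "{i. a1 $ i \<le> s'} = {i. a1 $ i < s}" by (rule strict_threshold)
  obtain t' where t': "t' < t" "{i. a2 $ i \<le> t'} = {i. a2 $ i < t}" by (rule strict_threshold)
  obtain u' where u': "u' < u" "{i. a3 $ i \<le> u'} = {i. a3 $ i < u}" by (rule strict_threshold)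
  have zero: "0 \<in> flag b a r" for b :: "'m::finite \<Rightarrow> 'a alg_closure ^ 'm" and a r
    using flag_subspace vec.subspace_0 by blast
  obtain J1 m1 where J1: "card (- J1) = card {i. s \<le> a1 $ i}"
    "flag b1 a1 s' = graph_space J1 (\<lambda>i j. to_ac (m1 i j :: 'a))"
    using rational[OF fr(1) s'(2)] inv(1)[OF _ _ zero zero] by blast
  obtain J2 m2 where J2: "card (- J2) = card {i. t \<le> a2 $ i}"
    "flag b2 a2 t' = graph_space J2 (\<lambda>i j. to_ac (m2 i j :: 'a))"
    using rational[OF fr(2) t'(2)] inv(2)[OF _ zero _ zero] by blast
  obtain J3 m3 where J3: "card (- J3) = card {i. u \<le> a3 $ i}"
    "flag b3 a3 u' = graph_space J3 (\<lambda>i j. to_ac (m3 i j :: 'a))"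
    using rational[OF fr(3) u'(2)] inv(3)[OF _ zero zero] by blast
  have "slice_rank T \<le> card (- J1) + card (- J2) + card (- J3)"
  proof (rule slice_rank_le_codims)
    fix x y z assume "x \<in> graph_space J1 m1" "y \<in> graph_space J2 m2" "z \<in> graph_space J3 m3"
    hence "(\<chi> i. to_ac (x $ i)) \<in> flag b1 a1 s'" "(\<chi> i. to_ac (y $ i)) \<in> flag b2 a2 t'"
      "(\<chi> i. to_ac (z $ i)) \<in> flag b3 a3 u'"
      unfolding J1(2) J2(2) J3(2) by (simp_all add: graph_space_to_ac)
    hence "trilinear_form (tensor_to_ac T) (\<chi> i. to_ac (x $ i)) (\<chi> i. to_ac (y $ i)) (\<chi> i. to_ac (z $ i)) = 0"
      using weights_support_flag[OF b, of _ s' _ t' _ u'] stu s'(1) t'(1) u'(1) by fastforce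
    thus "trilinear_form T x y z = 0" by (simp add: trilinear_form_to_ac)
  qed
  thus ?thesis using J1(1) J2(1) J3(1) by simp
qed

text \<open>The indicator weights of the frame vectors outside the given subspaces have energy (1 +
  \<epsilon>) c, because 0 and 1 equal their squares. A minimiser has at most this energy, rounding
  multiplies by 3/2, and \<epsilon> tends to 0.\<close>

lemma slice_rank_descent:
  fixes T :: "('a::field, 'n1::finite, 'n2::finite, 'n3::finite) tensor3"
  assumes perfect: "perfect_field TYPE('a)"
    and U: "vec.subspace U1" "vec.subspace U2" "vec.subspace U3"
    and van: "\<And>x y z. x \<in> U1 \<Longrightarrow> y \<in> U2 \<Longrightarrow> z \<in> U3 \<Longrightarrow> trilinear_form (tensor_to_ac T) x y z = 0"
  shows "2 * slice_rank T \<le> 3 * ((CARD('n1) - vec.dim U1) + (CARD('n2) - vec.dim U2) + (CARD('n3) - vec.dim U3))"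
proof -
  define c where "c = (CARD('n1) - vec.dim U1) + (CARD('n2) - vec.dim U2) + (CARD('n3) - vec.dim U3)"
  obtain f1 where f1: "frame f1" "card {i. f1 i \<notin> U1} = CARD('n1) - vec.dim U1" by (rule subspace_frame[OF U(1)])
  obtain f2 where f2: "frame f2" "card {i. f2 i \<notin> U2} = CARD('n2) - vec.dim U2" by (rule subspace_frame[OF U(2)])
  obtain f3 where f3: "frame f3" "card {i. f3 i \<notin> U3} = CARD('n3) - vec.dim U3" by (rule subspace_frame[OF U(3)])
  define w1 :: "real ^ 'n1" where "w1 = (\<chi> i. of_bool (f1 i \<notin> U1))"
  define w2 :: "real ^ 'n2" where "w2 = (\<chi> i. of_bool (f2 i \<notin> U2))"
  define w3 :: "real ^ 'n3" where "w3 = (\<chi> i. of_bool (f3 i \<notin> U3))"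
  have "weights_support (tensor_to_ac T) f1 f2 f3 w1 w2 w3"
    using f1 f2 f3 van by (auto simp: weights_support_def w1_def w2_def w3_def of_bool_def)
  hence w: "(w1, w2, w3) \<in> weight_set (tensor_to_ac T)"
    unfolding weight_set_def by (auto simp: mem_box_cart w1_def w2_def w3_def)
  have bound: "real (slice_rank T) \<le> 3 / 2 * ((1 + \<epsilon>) * real c)" if \<epsilon>: "\<epsilon> > 0" for \<epsilon> :: real
  proof -
    define F where "F = (\<lambda>(a1 :: real ^ 'n1, a2 :: real ^ 'n2, a3 :: real ^ 'n3).
      energy \<epsilon> a1 + energy \<epsilon> a2 + energy \<epsilon> a3)"
    have "continuous_on (weight_set (tensor_to_ac T)) F"
      unfolding F_def energy_def case_prod_unfold by (intro continuous_intros)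
    then obtain a where a: "a \<in> weight_set (tensor_to_ac T)" "\<And>c. c \<in> weight_set (tensor_to_ac T) \<Longrightarrow> F a \<le> F c"
      using continuous_attains_inf[OF compact_weight_set[of "tensor_to_ac T"], of F] w by blast
    obtain a1 a2 a3 where a_eq: "a = (a1, a2, a3)" by (cases a)
    obtain b1 b2 b3 where b: "weights_support (tensor_to_ac T) b1 b2 b3 a1 a2 a3"
      using a(1) by (auto simp: a_eq weight_set_def)
    have nonneg: "a1 $ i \<ge> 0" "a2 $ j \<ge> 0" "a3 $ k \<ge> 0" for i j k
      using a(1) by (auto simp: a_eq weight_set_def mem_box_cart)
    have min: "energy \<epsilon> a1 + energy \<epsilon> a2 + energy \<epsilon> a3 \<le> energy \<epsilon> c1 + energy \<epsilon> c2 + energy \<epsilon> c3"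
      if "(c1, c2, c3) \<in> weight_set (tensor_to_ac T)" for c1 c2 c3
      using a(2)[OF that] by (simp add: F_def a_eq)
    note unique = minimal_weights_flag_unique[OF \<epsilon> a(1)[unfolded a_eq] min b]
    have "real (slice_rank T) \<le> real (card {i. s \<le> a1 $ i}) + real (card {i. t \<le> a2 $ i}) + real (card {i. u \<le> a3 $ i})"
      if "s + t + u \<le> 1" for s t u
      using slice_rank_le_weights[OF perfect b _ that] unique
      by (metis (no_types, lifting) of_nat_add of_nat_le_iff)
    hence "real (slice_rank T) \<le> 3 / 2 * ((\<Sum>i\<in>UNIV. a1 $ i) + (\<Sum>i\<in>UNIV. a2 $ i) + (\<Sum>i\<in>UNIV. a3 $ i))"
      by (intro threshold_rounding nonneg)
    also have "\<dots> \<le> 3 / 2 * (energy \<epsilon> a1 + energy \<epsilon> a2 + energy \<epsilon> a3)"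
      unfolding energy_def using \<epsilon> by (intro mult_left_mono add_mono sum_mono) auto
    also have "\<dots> \<le> 3 / 2 * (energy \<epsilon> w1 + energy \<epsilon> w2 + energy \<epsilon> w3)"
      using min[OF w] by simp
    also have "energy \<epsilon> w1 + energy \<epsilon> w2 + energy \<epsilon> w3 = (1 + \<epsilon>) * real c"
    proof -
      have e: "energy \<epsilon> (\<chi> i. of_bool (f i \<notin> U)) = (1 + \<epsilon>) * real (card {i. f i \<notin> U})"
        for f :: "'m::finite \<Rightarrow> 'a alg_closure ^ 'm" and U
      proof -
        have "energy \<epsilon> (\<chi> i. of_bool (f i \<notin> U)) = (\<Sum>i\<in>UNIV. (1 + \<epsilon>) * of_bool (f i \<notin> U))"
          unfolding energy_def by (intro sum.cong) auto
        also have "\<dots> = (1 + \<epsilon>) * (\<Sum>i\<in>UNIV. of_bool (f i \<notin> U))" by (rule sum_distrib_left[symmetric])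
        finally show ?thesis by simp
      qed
      show ?thesis unfolding w1_def w2_def w3_def e f1(2) f2(2) f3(2) c_def by (simp add: algebra_simps)
    qed
    finally show ?thesis .
  qed
  have "real (slice_rank T) \<le> 3 / 2 * real c + e" if e: "e > 0" for e :: real
  proof -
    define \<epsilon> where "\<epsilon> = e / (3 / 2 * real c + 1)"
    have d: "3 / 2 * real c + 1 > 0" by (simp add: add_pos_nonneg add.commute)
    hence \<epsilon>: "\<epsilon> > 0" using e by (simp add: \<epsilon>_def)
    have "\<epsilon> * (3 / 2 * real c) \<le> \<epsilon> * (3 / 2 * real c + 1)" using \<epsilon> by (intro mult_left_mono) auto
    also have "\<dots> = e" using d by (simp add: \<epsilon>_def)
    finally show ?thesis using bound[OF \<epsilon>] by (simp add: algebra_simps)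
  qed
  hence "real (slice_rank T) \<le> 3 / 2 * real c" by (rule field_le_epsilon)
  hence "real (2 * slice_rank T) \<le> real (3 * c)" by simp
  hence "2 * slice_rank T \<le> 3 * c" by (simp only: of_nat_le_iff)
  thus ?thesis by (simp add: c_def)
qed

text \<open>Goals produced by induction rules are eta-expanded, so these rules would destroy
  the ring operations on functions.\<close>

lemmas fun_ring_apply = plus_fun_apply times_fun_apply zero_fun_apply one_fun_apply minus_apply uminus_apply

declare fun_ring_apply [simp del]

section \<open>Polynomial functions\<close>

text \<open>A polynomial over \<open>K\<close> in the variables \<open>S\<close> is represented by its action on points with
  coordinates in \<open>K[\<epsilon>]\<close>: this yields its values and, as coefficients of \<open>\<epsilon>\<close>, its derivatives.
  The natural number bounds the total degree.\<close>

type_synonym ('v, 'k) polyfun = "('v \<Rightarrow> 'k poly) \<Rightarrow> 'k poly"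

definition Const :: "'k::field \<Rightarrow> ('v, 'k) polyfun" where "Const c = (\<lambda>g. [:c:])"

definition Var :: "'v \<Rightarrow> ('v, 'k::field) polyfun" where "Var i = (\<lambda>g. g i)"

inductive polyf :: "'v set \<Rightarrow> nat \<Rightarrow> ('v, 'k::field) polyfun \<Rightarrow> bool" for S where
  Const: "polyf S d (Const c)"
| Var: "i \<in> S \<Longrightarrow> polyf S (Suc d) (Var i)"
| add: "polyf S d P \<Longrightarrow> polyf S d Q \<Longrightarrow> polyf S d (P + Q)"
| mult: "polyf S d P \<Longrightarrow> polyf S e Q \<Longrightarrow> polyf S (d + e) (P * Q)"

definition polys :: "'v set \<Rightarrow> ('v, 'k::field) polyfun set" where
  "polys S = {P. \<exists>d. polyf S d P}"

definition ev :: "('v::finite, 'k::field) polyfun \<Rightarrow> 'k ^ 'v \<Rightarrow> 'k" where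
  "ev P z = Polynomial.coeff (P (\<lambda>i. [:z $ i:])) 0"

definition dv :: "('v::finite, 'k::field) polyfun \<Rightarrow> 'k ^ 'v \<Rightarrow> 'k ^ 'v \<Rightarrow> 'k" where
  "dv P z v = Polynomial.coeff (P (\<lambda>i. [:z $ i, v $ i:])) 1"

lemma polyf_mono: "polyf S d P \<Longrightarrow> d \<le> e \<Longrightarrow> polyf S e P"
proof (induction arbitrary: e rule: polyf.induct)
  case (Var i d)
  thus ?case using polyf.Var[of i S "e - 1"] by (cases e) auto
next
  case (mult d P d' Q)
  have "polyf S (d + (e - d)) (P * Q)"
    by (rule polyf.mult) (use mult in auto)
  thus ?case using mult.prems by simp
qed (auto intro: polyf.intros)

lemma polyf_subset: "polyf S d P \<Longrightarrow> S \<subseteq> S' \<Longrightarrow> polyf S' d P"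
  by (induction rule: polyf.induct) (auto intro: polyf.intros)

lemma Const_0: "Const 0 = 0" and Const_1: "Const 1 = 1"
  by (simp_all add: Const_def fun_eq_iff one_pCons fun_ring_apply)

lemma polyf_0: "polyf S d 0" and polyf_1: "polyf S d 1"
  using polyf.Const[of S d 0] polyf.Const[of S d 1] by (simp_all add: Const_0 Const_1)

lemma polyf_uminus: "polyf S d P \<Longrightarrow> polyf S d (- P)"
proof -
  assume "polyf S d P"
  hence "polyf S (0 + d) (Const (- 1) * P)" by (intro polyf.intros)
  moreover have "Const (- 1) * P = - P" by (simp add: fun_eq_iff Const_def fun_ring_apply)
  ultimately show ?thesis by simp
qed

lemma polyf_diff: "polyf S d P \<Longrightarrow> polyf S d Q \<Longrightarrow> polyf S d (P - Q)"
  using polyf.add[of S d P "- Q"] polyf_uminus[of S d Q] by simp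

lemma polyf_sum: "(\<And>i. i \<in> I \<Longrightarrow> polyf S d (f i)) \<Longrightarrow> polyf S d (sum f I)"
  by (induction I rule: infinite_finite_induct) (auto intro: polyf_0 polyf.add)

lemma polyf_power: "polyf S d P \<Longrightarrow> polyf S (n * d) (P ^ n)"
  by (induction n) (auto intro: polyf_1 polyf.mult)

lemma polysE: "P \<in> polys S \<Longrightarrow> (\<And>d. polyf S d P \<Longrightarrow> thesis) \<Longrightarrow> thesis"
  by (auto simp: polys_def)

lemma polyf_polys: "polyf S d P \<Longrightarrow> P \<in> polys S"
  by (auto simp: polys_def)

lemma polys_subset: "P \<in> polys S \<Longrightarrow> S \<subseteq> S' \<Longrightarrow> P \<in> polys S'"
  by (auto simp: polys_def intro: polyf_subset)

lemma polys_UNIV: "P \<in> polys S \<Longrightarrow> P \<in> polys UNIV"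
  by (erule polys_subset) simp

lemma polys_common_degree:
  assumes "finite I" "\<And>i. i \<in> I \<Longrightarrow> f i \<in> polys S"
  obtains d where "\<And>i. i \<in> I \<Longrightarrow> polyf S d (f i)"
proof -
  have "\<exists>d. \<forall>i\<in>I. polyf S d (f i)" using assms
  proof (induction I rule: finite_induct)
    case (insert i I)
    then obtain d where "\<forall>j\<in>I. polyf S d (f j)" by blast
    moreover obtain e where "polyf S e (f i)" using insert.prems by (auto simp: polys_def)
    ultimately have "\<forall>j\<in>insert i I. polyf S (max d e) (f j)" by (auto intro: polyf_mono)
    thus ?case by blast
  qed simp
  thus ?thesis using that by blast
qed

lemma polys_add: "P \<in> polys S \<Longrightarrow> Q \<in> polys S \<Longrightarrow> P + Q \<in> polys S"
proof -
  assume "P \<in> polys S" "Q \<in> polys S"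
  then obtain d e where "polyf S d P" "polyf S e Q" by (auto simp: polys_def)
  hence "polyf S (max d e) P" "polyf S (max d e) Q" by (auto intro: polyf_mono)
  thus ?thesis using polyf.add polyf_polys by blast
qed

lemma polys_mult: "P \<in> polys S \<Longrightarrow> Q \<in> polys S \<Longrightarrow> P * Q \<in> polys S"
  unfolding polys_def using polyf.mult by blast

lemma polys_Const: "Const c \<in> polys S" and polys_0: "0 \<in> polys S" and polys_1: "1 \<in> polys S"
  and polys_Var: "i \<in> S \<Longrightarrow> Var i \<in> polys S"
  by (auto simp: polys_def intro: polyf.intros polyf_0 polyf_1)

lemma polys_uminus: "P \<in> polys S \<Longrightarrow> - P \<in> polys S"
  unfolding polys_def using polyf_uminus by blast

lemma polys_diff: "P \<in> polys S \<Longrightarrow> Q \<in> polys S \<Longrightarrow> P - Q \<in> polys S"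
  using polys_add[of P S "- Q"] polys_uminus[of Q S] by simp

lemma polys_sum: "(\<And>i. i \<in> I \<Longrightarrow> f i \<in> polys S) \<Longrightarrow> sum f I \<in> polys S"
  by (induction I rule: infinite_finite_induct) (auto intro: polys_0 polys_add)

lemma polys_power: "P \<in> polys S \<Longrightarrow> P ^ n \<in> polys S"
  by (induction n) (auto intro: polys_1 polys_mult)

lemmas polys_intros =
  polys_Const polys_0 polys_1 polys_Var polys_add polys_mult polys_uminus polys_diff polys_sum polys_power

lemma ev_simps [simp]:
  "ev (Const c) z = c" "ev (Var i) z = z $ i" "ev 0 z = 0" "ev 1 z = 1"
  "ev (P + Q) z = ev P z + ev Q z" "ev (P - Q) z = ev P z - ev Q z" "ev (- P) z = - ev P z"
  "ev (P * Q) z = ev P z * ev Q z"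
  by (simp_all add: ev_def Const_def Var_def coeff_mult_0 fun_ring_apply)

lemma ev_power [simp]: "ev (P ^ n) z = ev P z ^ n"
  by (induction n) simp_all

lemma ev_sum [simp]: "ev (sum f I) z = (\<Sum>i\<in>I. ev (f i) z)"
  by (induction I rule: infinite_finite_induct) simp_all

lemma polys_eval_dual:
  assumes "P \<in> polys S"
  shows "Polynomial.coeff (P (\<lambda>i. [:z $ i, v $ i:])) 0 = ev P z"
proof -
  obtain d where "polyf S d P" using assms by (auto simp: polys_def)
  thus ?thesis
    by induction (auto simp: Const_def Var_def ev_def coeff_mult_0 fun_ring_apply)
qed

lemma dv_simps [simp]:
  "dv (Const c) z v = 0" "dv (Var i) z v = v $ i" "dv 0 z v = 0" "dv 1 z v = 0"
  "dv (P + Q) z v = dv P z v + dv Q z v" "dv (P - Q) z v = dv P z v - dv Q z v" "dv (- P) z v = - dv P z v"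
  by (simp_all add: dv_def Const_def Var_def fun_ring_apply)

lemma dv_sum [simp]: "dv (sum f I) z v = (\<Sum>i\<in>I. dv (f i) z v)"
  by (induction I rule: infinite_finite_induct) simp_all

lemma dv_mult:
  assumes "P \<in> polys S" "Q \<in> polys S"
  shows "dv (P * Q) z v = ev P z * dv Q z v + dv P z v * ev Q z"
  unfolding dv_def times_fun_apply Polynomial.coeff_mult
  using polys_eval_dual[OF assms(1), of z v] polys_eval_dual[OF assms(2), of z v]
  by simp

lemma dv_linear:
  assumes "P \<in> polys S"
  shows "dv P z (v + w) = dv P z v + dv P z w" "dv P z (c *s v) = c * dv P z v"
proof -
  obtain d where "polyf S d P" using assms by (auto simp: polys_def)
  hence "dv P z (v + w) = dv P z v + dv P z w \<and> dv P z (c *s v) = c * dv P z v"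
  proof induction
    case (mult d P e Q)
    note * = dv_mult[OF polyf_polys[OF mult.hyps(1)] polyf_polys[OF mult.hyps(2)]]
    show ?case unfolding * using mult.IH by (simp add: algebra_simps)
  qed (simp_all add: algebra_simps)
  thus "dv P z (v + w) = dv P z v + dv P z w" "dv P z (c *s v) = c * dv P z v" by auto
qed

text \<open>Polynomials in one variable over the ring of polynomial functions: this view makes
  univariate division available.\<close>

lemma polyf_decompose:
  assumes "polyf (insert i S) d P"
  shows "\<exists>q. P = poly q (Var i) \<and> Polynomial.degree q \<le> d \<and> (\<forall>k. polyf S d (Polynomial.coeff q k))"
  using assms
proof induction
  case (Const d c)
  show ?case
    by (intro exI[of _ "[:Const c:]"]) (auto simp: coeff_pCons split: nat.split intro: polyf.intros polyf_0)
next
  case (Var j d)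
  show ?case
  proof (cases "j = i")
    case True
    thus ?thesis
      by (intro exI[of _ "[:0, 1:]"]) (auto simp: coeff_pCons split: nat.split intro: polyf_0 polyf_1)
  next
    case False
    thus ?thesis using Var
      by (intro exI[of _ "[:Var j:]"]) (auto simp: coeff_pCons split: nat.split intro: polyf.intros polyf_0)
  qed
next
  case (add d P Q)
  then obtain p q where "P = poly p (Var i)" "Polynomial.degree p \<le> d" "\<forall>k. polyf S d (Polynomial.coeff p k)"
    "Q = poly q (Var i)" "Polynomial.degree q \<le> d" "\<forall>k. polyf S d (Polynomial.coeff q k)" by blast
  thus ?case by (intro exI[of _ "p + q"]) (auto intro: polyf.add degree_add_le)
next
  case (mult d P e Q)
  then obtain p q where "P = poly p (Var i)" "Polynomial.degree p \<le> d" "\<forall>k. polyf S d (Polynomial.coeff p k)"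
    "Q = poly q (Var i)" "Polynomial.degree q \<le> e" "\<forall>k. polyf S e (Polynomial.coeff q k)" by blast
  thus ?case
    by (intro exI[of _ "p * q"])
       (auto simp: Polynomial.coeff_mult intro!: polyf_sum polyf.mult order.trans[OF degree_mult_le])
qed

lemma poly_Var_polys:
  assumes "\<And>k. Polynomial.coeff q k \<in> polys S"
  shows "poly q (Var i) \<in> polys (insert i S)"
  unfolding poly_altdef
  by (intro polys_intros) (use assms polys_subset in blast)+

section \<open>Zariski closed sets\<close>

lemma mpoly_eval_superset:
  assumes "finite K" "Poly_Mapping.keys p \<subseteq> K"
  shows "mpoly_eval p v = (\<Sum>m\<in>K. Poly_Mapping.lookup p m * (\<Prod>i\<in>UNIV. (v $ i) ^ Poly_Mapping.lookup m i))"
  unfolding mpoly_eval_def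
  by (rule sum.mono_neutral_left) (use assms in \<open>auto simp: in_keys_iff\<close>)

lemma mpoly_eval_add: "mpoly_eval (p + q) v = mpoly_eval p v + mpoly_eval q v"
proof -
  let ?K = "Poly_Mapping.keys p \<union> Poly_Mapping.keys q"
  have "Poly_Mapping.keys (p + q) \<subseteq> ?K" by (rule Poly_Mapping.keys_add)
  thus ?thesis
    by (simp add: mpoly_eval_superset[of ?K p] mpoly_eval_superset[of ?K q] mpoly_eval_superset[of ?K "p + q"]
        lookup_add algebra_simps sum.distrib)
qed

lemma mpoly_eval_single:
  "mpoly_eval (Poly_Mapping.single m c) v = c * (\<Prod>i\<in>UNIV. (v $ i) ^ Poly_Mapping.lookup m i)"
  by (subst mpoly_eval_superset[of "{m}"]) auto

lemma mpoly_eval_sum: "mpoly_eval (sum f I) v = (\<Sum>i\<in>I. mpoly_eval (f i) v)"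
  by (induction I rule: infinite_finite_induct) (simp_all add: mpoly_eval_add, simp_all add: mpoly_eval_def)

lemma poly_mapping_sum_monomials:
  "p = (\<Sum>m\<in>Poly_Mapping.keys p. Poly_Mapping.single m (Poly_Mapping.lookup p m))"
  by (rule poly_mapping_eqI)
     (auto simp: lookup_sum lookup_single when_def in_keys_iff)

lemma mpoly_eval_mult:
  fixes p q :: "('a::finite \<Rightarrow>\<^sub>0 nat) \<Rightarrow>\<^sub>0 'b::comm_ring_1"
  shows "mpoly_eval (p * q) v = mpoly_eval p v * mpoly_eval q v"
proof -
  have single: "mpoly_eval (Poly_Mapping.single m c * Poly_Mapping.single m' c') v =
      mpoly_eval (Poly_Mapping.single m c) v * mpoly_eval (Poly_Mapping.single m' c') v" for m m' c c'
    by (simp add: mult_single mpoly_eval_single lookup_add power_add prod.distrib)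
  have "p * q = (\<Sum>m\<in>Poly_Mapping.keys p. \<Sum>m'\<in>Poly_Mapping.keys q.
      Poly_Mapping.single m (Poly_Mapping.lookup p m) * Poly_Mapping.single m' (Poly_Mapping.lookup q m'))"
    using sum_product[of "\<lambda>m. Poly_Mapping.single m (Poly_Mapping.lookup p m)" "Poly_Mapping.keys p"
      "\<lambda>m. Poly_Mapping.single m (Poly_Mapping.lookup q m)" "Poly_Mapping.keys q"]
    unfolding poly_mapping_sum_monomials[symmetric] .
  hence "mpoly_eval (p * q) v = (\<Sum>m\<in>Poly_Mapping.keys p. \<Sum>m'\<in>Poly_Mapping.keys q.
      mpoly_eval (Poly_Mapping.single m (Poly_Mapping.lookup p m)) v *
      mpoly_eval (Poly_Mapping.single m' (Poly_Mapping.lookup q m')) v)"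
    by (simp add: mpoly_eval_sum single)
  also have "\<dots> = mpoly_eval p v * mpoly_eval q v"
  proof -
    have E: "mpoly_eval p v = (\<Sum>m\<in>Poly_Mapping.keys p. mpoly_eval (Poly_Mapping.single m (Poly_Mapping.lookup p m)) v)"
      for p :: "('a \<Rightarrow>\<^sub>0 nat) \<Rightarrow>\<^sub>0 'b"
      by (simp add: mpoly_eval_def[of p] mpoly_eval_single)
    show ?thesis unfolding sum_product[symmetric] E[of p, symmetric] E[of q, symmetric] ..
  qed
  finally show ?thesis .
qed

lemma polys_mpoly_eval:
  fixes P :: "('v::finite, 'k::field) polyfun"
  assumes "P \<in> polys UNIV"
  shows "\<exists>p. \<forall>z. mpoly_eval p z = ev P z"
proof -
  obtain d where "polyf UNIV d P" using assms by (auto simp: polys_def)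
  thus ?thesis
  proof induction
    case (Const d c)
    show ?case by (intro exI[of _ "Poly_Mapping.single 0 c"]) (simp add: mpoly_eval_single)
  next
    case (Var i d)
    have "(\<Prod>j\<in>UNIV. (z $ j) ^ Poly_Mapping.lookup (Poly_Mapping.single i 1) j) = z $ i" for z :: "'k ^ 'v"
      by (subst prod.remove[of _ i]) (auto simp: lookup_single when_def intro!: prod.neutral)
    thus ?case by (intro exI[of _ "Poly_Mapping.single (Poly_Mapping.single i 1) 1"]) (simp add: mpoly_eval_single)
  next
    case (add d P Q)
    thus ?case by (metis mpoly_eval_add ev_simps(5))
  next
    case (mult d P e Q)
    thus ?case by (metis mpoly_eval_mult ev_simps(8))
  qed
qed

lemma mpoly_eval_polys:
  fixes p :: "('v::finite \<Rightarrow>\<^sub>0 nat) \<Rightarrow>\<^sub>0 'k::field"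
  shows "\<exists>P\<in>polys UNIV. \<forall>z. ev P z = mpoly_eval p z"
proof -
  have prod: "prod f I \<in> polys UNIV" if "\<And>i. f i \<in> polys UNIV" for f :: "'v \<Rightarrow> ('v, 'k) polyfun" and I
    by (induction I rule: infinite_finite_induct) (auto intro: polys_intros that)
  have evp: "ev (prod f I) z = (\<Prod>i\<in>I. ev (f i) z)" for f :: "'v \<Rightarrow> ('v, 'k) polyfun" and I z
    by (induction I rule: infinite_finite_induct) simp_all
  show ?thesis
    by (rule bexI[of _ "\<Sum>m\<in>Poly_Mapping.keys p. Const (Poly_Mapping.lookup p m) *
        (\<Prod>i\<in>UNIV. Var i ^ Poly_Mapping.lookup m i)"])
       (auto simp: mpoly_eval_def evp intro!: polys_intros prod)
qed

section \<open>Vanishing ideals and irreducibility\<close>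

definition vanishes :: "('k::field ^ 'v::finite) set \<Rightarrow> ('v, 'k) polyfun \<Rightarrow> bool" where
  "vanishes Z P \<longleftrightarrow> (\<forall>z\<in>Z. ev P z = 0)"

text \<open>The vanishing ideal is prime; irreducibility enters the later arguments in this
  form.\<close>

definition prime_set :: "('k::field ^ 'v::finite) set \<Rightarrow> bool" where
  "prime_set Z \<longleftrightarrow> Z \<noteq> {} \<and> (\<forall>P\<in>polys UNIV. \<forall>Q\<in>polys UNIV. vanishes Z (P * Q) \<longrightarrow> vanishes Z P \<or> vanishes Z Q)"

lemma prime_setD:
  "prime_set Z \<Longrightarrow> P \<in> polys UNIV \<Longrightarrow> Q \<in> polys UNIV \<Longrightarrow> vanishes Z (P * Q) \<Longrightarrow> vanishes Z P \<or> vanishes Z Q"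
  by (auto simp: prime_set_def)

lemma prime_set_1: "prime_set Z \<Longrightarrow> \<not> vanishes Z 1"
  by (auto simp: prime_set_def vanishes_def)

lemma prime_set_power:
  "prime_set Z \<Longrightarrow> P \<in> polys UNIV \<Longrightarrow> \<not> vanishes Z P \<Longrightarrow> \<not> vanishes Z (P ^ n)"
proof (induction n)
  case 0
  thus ?case using prime_set_1 by simp
next
  case (Suc n)
  thus ?case using prime_setD[of Z P "P ^ n"] polys_power by auto
qed

lemma zariski_closed_Int_zeros:
  assumes "zariski_closed Z" "P \<in> polys UNIV"
  shows "zariski_closed {z \<in> Z. ev P z = 0}"
proof -
  obtain A where A: "Z = {v. \<forall>p\<in>A. mpoly_eval p v = 0}" using assms by (auto simp: zariski_closed_def)
  obtain p where p: "\<And>z. mpoly_eval p z = ev P z" using polys_mpoly_eval[OF assms(2)] by blast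
  have "{z \<in> Z. ev P z = 0} = {v. \<forall>q\<in>insert p A. mpoly_eval q v = 0}" using A p by auto
  thus ?thesis unfolding zariski_closed_def by blast
qed

lemma irreducible_closed_prime:
  assumes "irreducible_closed Z"
  shows "prime_set Z"
  unfolding prime_set_def
proof (intro conjI ballI impI)
  show "Z \<noteq> {}" using assms by (simp add: irreducible_closed_def)
  fix P Q assume PQ: "P \<in> polys UNIV" "Q \<in> polys UNIV" "vanishes Z (P * Q)"
  have "zariski_closed {z \<in> Z. ev P z = 0}" "zariski_closed {z \<in> Z. ev Q z = 0}"
    using assms PQ by (auto simp: irreducible_closed_def intro: zariski_closed_Int_zeros)
  moreover have "Z = {z \<in> Z. ev P z = 0} \<union> {z \<in> Z. ev Q z = 0}"
    using PQ(3) by (auto simp: vanishes_def)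
  ultimately have "Z = {z \<in> Z. ev P z = 0} \<or> Z = {z \<in> Z. ev Q z = 0}"
    using assms unfolding irreducible_closed_def by blast
  thus "vanishes Z P \<or> vanishes Z Q" unfolding vanishes_def by blast
qed

lemma zariski_closed_separate:
  assumes "zariski_closed Z" "Z \<subset> Z'"
  obtains P where "P \<in> polys UNIV" "vanishes Z P" "\<not> vanishes Z' P"
proof -
  obtain A where A: "Z = {v. \<forall>p\<in>A. mpoly_eval p v = 0}" using assms by (auto simp: zariski_closed_def)
  obtain z where "z \<in> Z'" "z \<notin> Z" using assms by blast
  then obtain p where p: "p \<in> A" "mpoly_eval p z \<noteq> 0" using A by blast
  obtain P where P: "P \<in> polys UNIV" "\<And>z. ev P z = mpoly_eval p z" using mpoly_eval_polys[of p] by blast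
  have "vanishes Z P" "\<not> vanishes Z' P"
    using A p P \<open>z \<in> Z'\<close> by (auto simp: vanishes_def)
  thus ?thesis using that P by blast
qed

declare zero_fun_apply [simp]

section \<open>Growth of coordinate rings\<close>

interpretation funspace: vector_space "\<lambda>(c :: 'k::field) (f :: 'x \<Rightarrow> 'k) x. c * f x"
  by unfold_locales (simp_all add: fun_eq_iff algebra_simps fun_ring_apply)

text \<open>Extension by zero places the coordinate ring of \<open>Z\<close> inside one fixed vector
  space of functions.\<close>

definition restr :: "('k::field ^ 'v::finite) set \<Rightarrow> ('v, 'k) polyfun \<Rightarrow> 'k ^ 'v \<Rightarrow> 'k" where
  "restr Z P = (\<lambda>z. if z \<in> Z then ev P z else 0)"

lemma restr_sum: "restr Z (sum f I) = (\<Sum>i\<in>I. restr Z (f i))"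
proof
  fix z
  have "(\<Sum>i\<in>I. restr Z (f i)) z = (\<Sum>i\<in>I. restr Z (f i) z)"
    by (induction I rule: infinite_finite_induct) (simp_all add: fun_ring_apply)
  thus "restr Z (sum f I) z = (\<Sum>i\<in>I. restr Z (f i)) z"
    by (simp add: restr_def)
qed

text \<open>This bounds the transcendence degree of the coordinate functions indexed by \<open>S\<close>. The common
  denominator \<open>s\<close> allows pseudo-division by relations whose leading coefficient is not a unit.\<close>

definition growth :: "('k::field ^ 'v::finite) set \<Rightarrow> 'v set \<Rightarrow> nat \<Rightarrow> bool" where
  "growth Z S t \<longleftrightarrow> (\<exists>C. \<forall>D. \<exists>s\<in>polys UNIV. \<not> vanishes Z s \<and>
     (\<exists>B. finite B \<and> card B \<le> C * (D + 1) ^ t \<and> (\<forall>P. polyf S D P \<longrightarrow> restr Z (s * P) \<in> funspace.span B)))"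

lemma span_mult_right:
  assumes "f \<in> funspace.span B"
  shows "(\<lambda>z. f z * g z) \<in> funspace.span ((\<lambda>b z. b z * g z) ` B)"
proof -
  let ?W = "{f. (\<lambda>z. f z * g z) \<in> funspace.span ((\<lambda>b z. b z * g z) ` B)}"
  have "funspace.span B \<subseteq> ?W"
  proof (rule funspace.span_minimal)
    show "B \<subseteq> ?W" by (auto intro: funspace.span_base)
    show "funspace.subspace ?W"
    proof (rule funspace.subspaceI, unfold mem_Collect_eq)
      have "(\<lambda>z. 0 z * g z) = 0" by (simp add: fun_eq_iff fun_ring_apply)
      thus "(\<lambda>z. 0 z * g z) \<in> funspace.span ((\<lambda>b z. b z * g z) ` B)"
        by (simp only: funspace.span_zero)
      fix x y c
      assume x: "(\<lambda>z. x z * g z) \<in> funspace.span ((\<lambda>b z. b z * g z) ` B)"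
      have "(\<lambda>z. c * x z * g z) = (\<lambda>z. c * (x z * g z))" by (simp add: mult.assoc)
      thus "(\<lambda>z. c * x z * g z) \<in> funspace.span ((\<lambda>b z. b z * g z) ` B)"
        using funspace.span_scale[OF x, of c] by simp
      assume y: "(\<lambda>z. y z * g z) \<in> funspace.span ((\<lambda>b z. b z * g z) ` B)"
      have "(\<lambda>z. (x + y) z * g z) = (\<lambda>z. x z * g z) + (\<lambda>z. y z * g z)"
        by (simp add: fun_eq_iff fun_ring_apply distrib_right)
      thus "(\<lambda>z. (x + y) z * g z) \<in> funspace.span ((\<lambda>b z. b z * g z) ` B)"
        using funspace.span_add[OF x y] by simp
    qed
  qed
  thus ?thesis using assms by blast
qed

lemma poly_eq_sum_bound:
  fixes q :: "'r::comm_ring_1 poly"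
  assumes "\<And>k. k > n \<Longrightarrow> Polynomial.coeff q k = 0"
  shows "poly q x = (\<Sum>k\<le>n. Polynomial.coeff q k * x ^ k)"
proof -
  have "Polynomial.degree q \<le> n" using assms by (intro Polynomial.degree_le) auto
  thus ?thesis
    unfolding poly_altdef by (intro sum.mono_neutral_left) (auto simp: coeff_eq_0)
qed

lemma span_powers:
  fixes Z :: "('k::field ^ 'v::finite) set"
  assumes span: "\<And>k. k \<le> n \<Longrightarrow> restr Z (s * Polynomial.coeff q k) \<in> funspace.span B"
    and q: "\<And>k. k > n \<Longrightarrow> Polynomial.coeff q k = 0"
  shows "restr Z (s * poly q (Var i)) \<in> funspace.span (\<Union>k\<le>n. (\<lambda>b z. b z * (z $ i) ^ k) ` B)"
proof -
  have "s * poly q (Var i) = (\<Sum>k\<le>n. s * Polynomial.coeff q k * Var i ^ k)"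
    by (subst poly_eq_sum_bound[OF q]) (simp_all add: sum_distrib_left mult.assoc)
  hence "restr Z (s * poly q (Var i)) = (\<Sum>k\<le>n. restr Z (s * Polynomial.coeff q k * Var i ^ k))"
    by (simp only: restr_sum)
  also have "\<dots> = (\<Sum>k\<le>n. (\<lambda>z. restr Z (s * Polynomial.coeff q k) z * (z $ i) ^ k))"
    by (intro sum.cong ext) (simp_all add: restr_def zero_fun_apply)
  also have "\<dots> \<in> funspace.span (\<Union>k\<le>n. (\<lambda>b z. b z * (z $ i) ^ k) ` B)"
  proof (rule funspace.span_sum)
    fix k assume k: "k \<in> {..n}"
    hence "(\<lambda>b z. b z * (z $ i) ^ k) ` B \<subseteq> (\<Union>k\<le>n. (\<lambda>b z. b z * (z $ i) ^ k) ` B)" by blast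
    thus "(\<lambda>z. restr Z (s * Polynomial.coeff q k) z * (z $ i) ^ k)
        \<in> funspace.span (\<Union>k\<le>n. (\<lambda>b z. b z * (z $ i) ^ k) ` B)"
      using span_mult_right[OF span, of k "\<lambda>z. (z $ i) ^ k"] k funspace.span_mono by blast
  qed
  finally show ?thesis .
qed

lemma card_powers_le:
  fixes B :: "('k::field ^ 'v::finite \<Rightarrow> 'k) set"
  assumes "finite B"
  shows "finite (\<Union>k\<le>n. (\<lambda>b z. b z * (z $ i) ^ k) ` B)"
    "card (\<Union>k\<le>n. (\<lambda>b z. b z * (z $ i) ^ k) ` B) \<le> (n + 1) * card B"
proof -
  show "finite (\<Union>k\<le>n. (\<lambda>b z. b z * (z $ i) ^ k) ` B)" using assms by simp
  have "card (\<Union>k\<le>n. (\<lambda>b z. b z * (z $ i) ^ k) ` B) \<le> (\<Sum>k\<le>n. card ((\<lambda>b z. b z * (z $ i) ^ k) ` B))"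
    by (rule card_UN_le) simp
  also have "\<dots> \<le> (\<Sum>k\<le>n. card B)" by (intro sum_mono card_image_le assms)
  finally show "card (\<Union>k\<le>n. (\<lambda>b z. b z * (z $ i) ^ k) ` B) \<le> (n + 1) * card B" by simp
qed

lemma growth_empty:
  fixes Z :: "('k::field ^ 'v::finite) set"
  assumes "prime_set Z"
  shows "growth Z {} 0"
proof -
  have const: "\<exists>c. P = Const c" if "polyf {} D P" for D and P :: "('v, 'k::field) polyfun"
    using that
  proof induction
    case (add d P Q)
    then obtain a b where "P = Const a" "Q = Const b" by blast
    hence "P + Q = Const (a + b)" by (simp add: Const_def fun_eq_iff fun_ring_apply)
    thus ?case by blast
  next
    case (mult d P e Q)
    then obtain a b where "P = Const a" "Q = Const b" by blast
    hence "P * Q = Const (a * b)" by (simp add: Const_def fun_eq_iff fun_ring_apply)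
    thus ?case by blast
  qed auto
  show ?thesis
    unfolding growth_def
  proof (rule exI[of _ 1], rule allI, rule bexI[of _ 1], intro conjI exI[of _ "{restr Z 1}"] allI impI)
    fix D and P :: "('v, 'k) polyfun" assume "polyf {} D P"
    then obtain c where c: "P = Const c" using const by blast
    have "restr Z (1 * P) = (\<lambda>x. c * restr Z 1 x)" by (auto simp: restr_def c)
    thus "restr Z (1 * P) \<in> funspace.span {restr Z 1}"
      using funspace.span_scale[OF funspace.span_base[of "restr Z 1" "{restr Z 1}"], of c] by simp
  qed (use prime_set_1[OF assms] polys_1 in auto)
qed

text \<open>A polynomial of degree at most D has at most D + 1 coefficients with respect to the new
  variable, so the dimension grows by a factor of at most D + 1.\<close>

lemma growth_insert:
  assumes "growth Z S t"
  shows "growth Z (insert i S) (Suc t)"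
proof -
  obtain C where C: "\<And>D. \<exists>s\<in>polys UNIV. \<not> vanishes Z s \<and>
     (\<exists>B. finite B \<and> card B \<le> C * (D + 1) ^ t \<and> (\<forall>P. polyf S D P \<longrightarrow> restr Z (s * P) \<in> funspace.span B))"
    using assms unfolding growth_def by blast
  show ?thesis
    unfolding growth_def
  proof (intro exI[of _ C] allI)
    fix D
    obtain s B where s: "s \<in> polys UNIV" "\<not> vanishes Z s" "finite B" "card B \<le> C * (D + 1) ^ t"
      "\<And>P. polyf S D P \<Longrightarrow> restr Z (s * P) \<in> funspace.span B" using C by blast
    define B' where "B' = (\<Union>k\<le>D. (\<lambda>b z. b z * (z $ i) ^ k) ` B)"
    have "card B' \<le> (D + 1) * card B" unfolding B'_def by (rule card_powers_le[OF s(3)])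
    also have "\<dots> \<le> (D + 1) * (C * (D + 1) ^ t)" by (intro mult_left_mono s) simp
    finally have "card B' \<le> C * (D + 1) ^ Suc t" by (simp add: algebra_simps)
    moreover have "finite B'" unfolding B'_def by (rule card_powers_le[OF s(3)])
    moreover have "restr Z (s * P) \<in> funspace.span B'" if P: "polyf (insert i S) D P" for P
    proof -
      obtain q where q: "P = poly q (Var i)" "Polynomial.degree q \<le> D" "\<And>k. polyf S D (Polynomial.coeff q k)"
        using polyf_decompose[OF P] by blast
      show ?thesis unfolding q(1) B'_def
        by (rule span_powers) (use s(5) q in \<open>auto intro: coeff_eq_0\<close>)
    qed
    ultimately show "\<exists>s\<in>polys UNIV. \<not> vanishes Z s \<and> (\<exists>B. finite B \<and> card B \<le> C * (D + 1) ^ Suc t \<and>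
        (\<forall>P. polyf (insert i S) D P \<longrightarrow> restr Z (s * P) \<in> funspace.span B))"
      using s by blast
  qed
qed

section \<open>Algebraic relations and pseudo-division\<close>

definition relation :: "('k::field ^ 'v::finite) set \<Rightarrow> 'v set \<Rightarrow> 'v \<Rightarrow> ('v, 'k) polyfun poly \<Rightarrow> bool" where
  "relation Z S i q \<longleftrightarrow> (\<forall>k. Polynomial.coeff q k \<in> polys S) \<and> vanishes Z (poly q (Var i))"

lemma pseudo_division_step:
  fixes q u :: "'r::comm_ring_1 poly"
  assumes "Polynomial.degree u \<le> Polynomial.degree q + m"
  defines "u' \<equiv> Polynomial.smult (Polynomial.lead_coeff q) u -
     Polynomial.monom (Polynomial.coeff u (Polynomial.degree q + m)) m * q"
  shows "\<And>k. k \<ge> Polynomial.degree q + m \<Longrightarrow> Polynomial.coeff u' k = 0"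
    "poly u' x = Polynomial.lead_coeff q * poly u x -
       Polynomial.coeff u (Polynomial.degree q + m) * x ^ m * poly q x"
proof -
  show "Polynomial.coeff u' k = 0" if "k \<ge> Polynomial.degree q + m" for k
  proof (cases "k = Polynomial.degree q + m")
    case True
    thus ?thesis by (simp add: u'_def coeff_monom_mult)
  next
    case False
    hence "k > Polynomial.degree q + m" using that by simp
    hence "Polynomial.coeff u k = 0" "Polynomial.coeff q (k - m) = 0"
      using assms(1) by (auto intro!: coeff_eq_0)
    thus ?thesis by (simp add: u'_def coeff_monom_mult)
  qed
  show "poly u' x = Polynomial.lead_coeff q * poly u x -
       Polynomial.coeff u (Polynomial.degree q + m) * x ^ m * poly q x"
    by (simp add: u'_def poly_monom)
qed

text \<open>Each step multiplies by coefficients of \<open>q\<close> and so adds \<open>e\<close> to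
  the degrees. This increase is linear in the number of steps, which keeps the growth exponent
  unchanged.\<close>

lemma pseudo_division:
  fixes q u :: "('v::finite, 'k::field) polyfun poly"
  assumes van: "vanishes Z (poly q (Var i))" and q: "\<And>k. polyf S e (Polynomial.coeff q k)"
    and u: "\<And>k. polyf S D (Polynomial.coeff u k)"
    and deg: "\<And>k. k \<ge> Polynomial.degree q + m \<Longrightarrow> Polynomial.coeff u k = 0"
  shows "\<exists>w. (\<forall>k. polyf S (D + m * e) (Polynomial.coeff w k)) \<and>
     (\<forall>k\<ge>Polynomial.degree q. Polynomial.coeff w k = 0) \<and>
     (\<forall>z\<in>Z. ev (Polynomial.lead_coeff q ^ m * poly u (Var i)) z = ev (poly w (Var i)) z)"
  using u deg
proof (induction m arbitrary: u D)
  case 0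
  thus ?case by (intro exI[of _ u]) simp
next
  case (Suc m)
  define a where "a = Polynomial.lead_coeff q"
  define u' where "u' = Polynomial.smult a u -
     Polynomial.monom (Polynomial.coeff u (Polynomial.degree q + m)) m * q"
  have du: "Polynomial.degree u \<le> Polynomial.degree q + m"
    using Suc.prems(2) by (intro Polynomial.degree_le) auto
  note step = pseudo_division_step[OF du, folded a_def, folded u'_def]
  have "polyf S (D + e) (Polynomial.coeff u' k)" for k
  proof -
    have "polyf S (D + e) (a * Polynomial.coeff u k)"
      using polyf.mult[OF q Suc.prems(1)] by (simp add: a_def add.commute)
    moreover have "polyf S (D + e) (Polynomial.coeff u l * Polynomial.coeff q j)" for l j
      using polyf.mult[OF Suc.prems(1) q] by simp
    ultimately show ?thesis
      by (auto simp: u'_def coeff_monom_mult intro!: polyf_diff)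
  qed
  from Suc.IH[OF this step(1)] obtain w where w: "\<And>k. polyf S (D + e + m * e) (Polynomial.coeff w k)"
     "\<And>k. k\<ge>Polynomial.degree q \<Longrightarrow> Polynomial.coeff w k = 0"
     "\<And>z. z\<in>Z \<Longrightarrow> ev (a ^ m * poly u' (Var i)) z = ev (poly w (Var i)) z"
    unfolding a_def by blast
  have "ev (a ^ Suc m * poly u (Var i)) z = ev (poly w (Var i)) z" if z: "z \<in> Z" for z
  proof -
    have "ev (poly q (Var i)) z = 0" using van z by (simp add: vanishes_def)
    hence "ev (poly u' (Var i)) z = ev a z * ev (poly u (Var i)) z" unfolding step(2) by simp
    thus ?thesis using w(3)[OF z] by (simp add: algebra_simps)
  qed
  thus ?case using w(1,2) unfolding a_def by (intro exI[of _ w]) (simp add: algebra_simps)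
qed

text \<open>Times a power of the leading coefficient, every polynomial of degree D reduces to powers
  of the new variable below the degree of \<open>q\<close>, with coefficients of degree D (1 + e).
  So the dimension grows by a constant factor only.\<close>

lemma growth_insert_algebraic:
  fixes Z :: "('k::field ^ 'v::finite) set"
  assumes Z: "prime_set Z" and g: "growth Z S t" and q: "relation Z S i q"
    and lead: "\<not> vanishes Z (Polynomial.lead_coeff q)"
  shows "growth Z (insert i S) t"
proof -
  obtain e where e: "\<And>k. k \<in> {..Polynomial.degree q} \<Longrightarrow> polyf S e (Polynomial.coeff q k)"
    using polys_common_degree[of "{..Polynomial.degree q}" "Polynomial.coeff q" S] q
    by (auto simp: relation_def)
  have e: "polyf S e (Polynomial.coeff q k)" for k
    using e[of k] polyf_0[of S e] by (cases "k \<le> Polynomial.degree q") (auto simp: coeff_eq_0)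
  have van: "vanishes Z (poly q (Var i))" using q by (simp add: relation_def)
  define \<delta> where "\<delta> = Polynomial.degree q"
  \<comment> \<open>A constant \<open>q\<close> would be its own leading coefficient and vanish on
    \<open>Z\<close>.\<close>
  have \<delta>: "\<delta> > 0"
  proof (rule Nat.gr0I)
    assume "\<delta> = 0"
    then obtain c where "q = [:c:]" unfolding \<delta>_def by (rule degree_eq_zeroE)
    thus False using van lead by simp
  qed
  define a where "a = Polynomial.lead_coeff q"
  have a: "a \<in> polys UNIV" using q polys_UNIV by (auto simp: a_def relation_def)
  obtain C where C: "\<And>D. \<exists>s\<in>polys UNIV. \<not> vanishes Z s \<and>
     (\<exists>B. finite B \<and> card B \<le> C * (D + 1) ^ t \<and> (\<forall>P. polyf S D P \<longrightarrow> restr Z (s * P) \<in> funspace.span B))"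
    using g unfolding growth_def by blast
  show ?thesis
    unfolding growth_def
  proof (intro exI[of _ "\<delta> * C * (1 + e) ^ t"] allI)
    fix D
    obtain s B where s: "s \<in> polys UNIV" "\<not> vanishes Z s" "finite B" "card B \<le> C * (D + D * e + 1) ^ t"
      "\<And>P. polyf S (D + D * e) P \<Longrightarrow> restr Z (s * P) \<in> funspace.span B" using C[of "D + D * e"] by blast
    define B' where "B' = (\<Union>k\<le>\<delta> - 1. (\<lambda>b z. b z * (z $ i) ^ k) ` B)"
    have "card B' \<le> (\<delta> - 1 + 1) * card B" unfolding B'_def by (rule card_powers_le[OF s(3)])
    also have "\<dots> \<le> \<delta> * (C * (D + D * e + 1) ^ t)" using \<delta> s(4) by simp
    also have "\<dots> \<le> \<delta> * (C * ((1 + e) * (D + 1)) ^ t)"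
      by (intro mult_left_mono power_mono) (auto simp: algebra_simps)
    also have "\<dots> = \<delta> * C * (1 + e) ^ t * (D + 1) ^ t"
      by (simp only: power_mult_distrib mult.assoc)
    finally have "card B' \<le> \<delta> * C * (1 + e) ^ t * (D + 1) ^ t" .
    moreover have "finite B'" unfolding B'_def by (rule card_powers_le[OF s(3)])
    moreover have "restr Z (s * a ^ D * P) \<in> funspace.span B'" if P: "polyf (insert i S) D P" for P
    proof -
      obtain u where u: "P = poly u (Var i)" "Polynomial.degree u \<le> D" "\<And>k. polyf S D (Polynomial.coeff u k)"
        using polyf_decompose[OF P] by blast
      have du: "Polynomial.coeff u k = 0" if "k \<ge> Polynomial.degree q + D" for k
        using that u(2) \<delta> by (intro coeff_eq_0) (auto simp: \<delta>_def)
      obtain w where w: "\<And>k. polyf S (D + D * e) (Polynomial.coeff w k)"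
         "\<And>k. k\<ge>\<delta> \<Longrightarrow> Polynomial.coeff w k = 0"
         "\<And>z. z\<in>Z \<Longrightarrow> ev (a ^ D * poly u (Var i)) z = ev (poly w (Var i)) z"
        using pseudo_division[where m = D, OF van e u(3) du] unfolding a_def \<delta>_def by blast
      have "restr Z (s * a ^ D * P) = restr Z (s * poly w (Var i))"
        using w(3) unfolding restr_def u(1) by (auto simp: mult.assoc)
      also have "\<dots> \<in> funspace.span B'"
        unfolding B'_def by (rule span_powers) (use s(5) w(1,2) in auto)
      finally show ?thesis .
    qed
    moreover have "s * a ^ D \<in> polys UNIV" by (intro polys_intros s a)
    moreover have "\<not> vanishes Z (s * a ^ D)"
      using prime_setD[OF Z s(1), of "a ^ D"] s(2) prime_set_power[OF Z a, of D] lead polys_power[OF a]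
      unfolding a_def by blast
    ultimately show "\<exists>s\<in>polys UNIV. \<not> vanishes Z s \<and> (\<exists>B. finite B \<and> card B \<le> \<delta> * C * (1 + e) ^ t * (D + 1) ^ t \<and>
        (\<forall>P. polyf (insert i S) D P \<longrightarrow> restr Z (s * P) \<in> funspace.span B))"
      by blast
  qed
qed

section \<open>Tangent spaces at generic points\<close>

text \<open>At a generic point, the tangent space of the closure of the projection of \<open>Z\<close> to the
  coordinates \<open>S\<close> has codimension at most \<open>c\<close>.\<close>

definition tangent_codim :: "('k::field ^ 'v::finite) set \<Rightarrow> 'v set \<Rightarrow> nat \<Rightarrow> bool" where
  "tangent_codim Z S c \<longleftrightarrow> (\<exists>s\<in>polys UNIV. \<not> vanishes Z s \<and> (\<exists>Q\<subseteq>polys UNIV. finite Q \<and> card Q \<le> c \<and>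
     (\<forall>z\<in>Z. ev s z \<noteq> 0 \<longrightarrow> (\<forall>v. (\<forall>p\<in>Q. dv p z v = 0) \<longrightarrow>
        (\<forall>P\<in>polys S. vanishes Z P \<longrightarrow> dv P z v = 0)))))"

lemma dv_poly_coeffs:
  fixes q :: "('v::finite, 'k::field) polyfun poly"
  assumes "\<And>k. Polynomial.coeff q k \<in> polys S" "\<And>k. ev (Polynomial.coeff q k) z = 0"
    "\<And>k. dv (Polynomial.coeff q k) z v = 0"
  shows "dv (poly q (Var i)) z v = 0"
proof -
  have "dv (Polynomial.coeff q k * Var i ^ k) z v = 0" for k
    using dv_mult[of "Polynomial.coeff q k" UNIV "Var i ^ k" z v] assms polys_UNIV[OF assms(1)]
    by (simp add: polys_intros zero_fun_apply)
  thus ?thesis unfolding poly_altdef by simp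
qed

text \<open>Without a nontrivial relation for the new coordinate, a polynomial that vanishes on
  \<open>Z\<close> has coefficients that do so too, and no tangent equation is added. Otherwise one
  relation of least degree suffices: all others reduce to it by pseudo-division. An inseparable
  relation may have derivative 0, which is harmless for an upper bound on the codimension.\<close>

lemma growth_tangent_insert:
  fixes Z :: "('k::field ^ 'v::finite) set"
  assumes Z: "prime_set Z" and g: "growth Z S t" and c: "tangent_codim Z S c"
  shows "growth Z (insert i S) (Suc t) \<and> tangent_codim Z (insert i S) c \<or>
    growth Z (insert i S) t \<and> tangent_codim Z (insert i S) (Suc c)"
proof -
  obtain s Q where s: "s \<in> polys UNIV" "\<not> vanishes Z s" and Q: "Q \<subseteq> polys UNIV" "finite Q" "card Q \<le> c"
    and tan: "\<And>z v P. z \<in> Z \<Longrightarrow> ev s z \<noteq> 0 \<Longrightarrow> (\<And>p. p \<in> Q \<Longrightarrow> dv p z v = 0) \<Longrightarrow> P \<in> polys S \<Longrightarrow>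
      vanishes Z P \<Longrightarrow> dv P z v = 0"
    using c unfolding tangent_codim_def by metis
  have coeffs: "dv (poly q (Var i)) z v = 0"
    if "z \<in> Z" "ev s z \<noteq> 0" "\<And>p. p \<in> Q \<Longrightarrow> dv p z v = 0" "\<And>k. Polynomial.coeff q k \<in> polys S"
      "\<And>k. vanishes Z (Polynomial.coeff q k)" for q z v
  proof (rule dv_poly_coeffs[OF that(4)])
    show "ev (Polynomial.coeff q k) z = 0" for k using that(1,5) by (simp add: vanishes_def)
    show "dv (Polynomial.coeff q k) z v = 0" for k by (rule tan[OF that])
  qed
  have decompose: "\<exists>q. P = poly q (Var i) \<and> (\<forall>k. Polynomial.coeff q k \<in> polys S)"
    if P: "P \<in> polys (insert i S)" for P :: "('v, 'k) polyfun"
  proof -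
    obtain d where "polyf (insert i S) d P" using P by (rule polysE)
    from polyf_decompose[OF this] show ?thesis using polyf_polys by blast
  qed
  define R where "R = (\<lambda>q. relation Z S i q \<and> (\<exists>k. \<not> vanishes Z (Polynomial.coeff q k)))"
  show ?thesis
  proof (cases "\<exists>q. R q")
    case False
    have "tangent_codim Z (insert i S) c"
      unfolding tangent_codim_def
    proof (intro bexI[OF _ s(1)] conjI exI[of _ Q] ballI allI impI)
      fix z v P assume z: "z \<in> Z" "ev s z \<noteq> 0" "\<forall>p\<in>Q. dv p z v = 0" and P: "P \<in> polys (insert i S)" "vanishes Z P"
      obtain q where q: "P = poly q (Var i)" "\<And>k. Polynomial.coeff q k \<in> polys S"
        using decompose[OF P(1)] by blast
      hence "relation Z S i q" using P(2) by (simp add: relation_def)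
      hence "vanishes Z (Polynomial.coeff q k)" for k using False by (auto simp: R_def)
      thus "dv P z v = 0" unfolding q(1) using z q(2) by (intro coeffs) auto
    qed (use s Q in auto)
    thus ?thesis using growth_insert[OF g] by blast
  next
    case True
    then obtain q where q: "R q" and min: "\<And>p. R p \<Longrightarrow> Polynomial.degree q \<le> Polynomial.degree p"
      using ex_has_least_nat[of R _ Polynomial.degree] by blast
    define \<delta> where "\<delta> = Polynomial.degree q"
    define a where "a = Polynomial.lead_coeff q"
    have rel: "relation Z S i q" and qS: "\<And>k. Polynomial.coeff q k \<in> polys S"
      and vanq: "vanishes Z (poly q (Var i))" using q by (auto simp: R_def relation_def)
    \<comment> \<open>By minimality, a relation of degree below \<delta> is trivial.\<close>
    have lower: "vanishes Z (Polynomial.coeff w k)"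
      if "\<And>k. Polynomial.coeff w k \<in> polys S" "vanishes Z (poly w (Var i))" "\<And>k. k \<ge> \<delta> \<Longrightarrow> Polynomial.coeff w k = 0"
      for w k
    proof (rule ccontr)
      assume k: "\<not> vanishes Z (Polynomial.coeff w k)"
      hence "R w" using that by (auto simp: R_def relation_def)
      hence "\<delta> \<le> Polynomial.degree w" using min by (simp add: \<delta>_def)
      hence "Polynomial.lead_coeff w = 0" using that(3) by blast
      hence "w = 0" by simp
      thus False using k by (simp add: vanishes_def)
    qed
    \<comment> \<open>If the leading coefficient vanished on \<open>Z\<close>, dropping the leading
      term would leave a relation of smaller degree, trivial by minimality, and \<open>q\<close>
      itself would be trivial.\<close>
    have a: "\<not> vanishes Z a"
    proof
      assume va: "vanishes Z a"
      define w where "w = q - Polynomial.monom a \<delta>"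
      have vw: "vanishes Z (Polynomial.coeff w k)" for k
      proof (rule lower)
        show "Polynomial.coeff w k \<in> polys S" for k
          using qS by (auto simp: w_def a_def intro: polys_intros)
        show "vanishes Z (poly w (Var i))"
          using va vanq by (simp add: w_def vanishes_def poly_monom)
        show "Polynomial.coeff w k = 0" if "k \<ge> \<delta>" for k
          using that by (cases "k = \<delta>") (auto simp: w_def a_def \<delta>_def coeff_eq_0)
      qed
      have "vanishes Z (Polynomial.coeff q k)" for k
      proof (cases "k = \<delta>")
        case True
        thus ?thesis using va by (simp only: a_def \<delta>_def)
      next
        case False
        hence "Polynomial.coeff w k = Polynomial.coeff q k" by (simp add: w_def)
        thus ?thesis using vw[of k] by simp
      qed
      thus False using q unfolding R_def by blast
    qed
    have aS: "a \<in> polys S" "a \<in> polys UNIV" using qS polys_UNIV by (auto simp: a_def)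
    have "tangent_codim Z (insert i S) (Suc c)"
      unfolding tangent_codim_def
    proof (intro bexI[of _ "s * a"] conjI exI[of _ "insert (poly q (Var i)) Q"] ballI allI impI)
      show "s * a \<in> polys UNIV" by (intro polys_intros s aS)
      show "\<not> vanishes Z (s * a)" using prime_setD[OF Z s(1) aS(2)] s(2) a by blast
      have pq: "poly q (Var i) \<in> polys UNIV"
        using poly_Var_polys[of q S i] qS polys_UNIV by blast
      thus "insert (poly q (Var i)) Q \<subseteq> polys UNIV" using Q by blast
      show "finite (insert (poly q (Var i)) Q)" "card (insert (poly q (Var i)) Q) \<le> Suc c"
        using Q by (auto simp: card_insert_if)
      fix z v P assume z: "z \<in> Z" "ev (s * a) z \<noteq> 0" "\<forall>p\<in>insert (poly q (Var i)) Q. dv p z v = 0"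
        and P: "P \<in> polys (insert i S)" "vanishes Z P"
      have za: "ev s z \<noteq> 0" "ev a z \<noteq> 0" "dv (poly q (Var i)) z v = 0" "\<And>p. p \<in> Q \<Longrightarrow> dv p z v = 0"
        "ev (poly q (Var i)) z = 0"
        using z vanq by (auto simp: vanishes_def)
      \<comment> \<open>Induction on the number of pseudo-division steps; it ends with a remainder
        of degree below \<delta>, whose coefficients vanish on \<open>Z\<close>.\<close>
      have "dv (poly u (Var i)) z v = 0"
        if "\<And>k. Polynomial.coeff u k \<in> polys S" "vanishes Z (poly u (Var i))" "\<And>k. k \<ge> \<delta> + m \<Longrightarrow> Polynomial.coeff u k = 0"
        for u m
        using that
      proof (induction m arbitrary: u)
        case 0
        have "vanishes Z (Polynomial.coeff u k)" for k
          by (rule lower) (use 0 in auto)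
        thus ?case by (intro coeffs[OF z(1) za(1,4)] 0)
      next
        case (Suc m)
        define u' where "u' = Polynomial.smult a u - Polynomial.monom (Polynomial.coeff u (\<delta> + m)) m * q"
        have du: "Polynomial.degree u \<le> Polynomial.degree q + m"
          using Suc.prems(3) by (intro Polynomial.degree_le) (auto simp: \<delta>_def)
        note step = pseudo_division_step[OF du, folded a_def \<delta>_def, folded u'_def]
        have "dv (poly u' (Var i)) z v = 0"
        proof (rule Suc.IH)
          show "Polynomial.coeff u' k \<in> polys S" for k
            using Suc.prems(1) qS aS by (auto simp: u'_def coeff_monom_mult intro!: polys_intros)
          show "vanishes Z (poly u' (Var i))"
            unfolding step(2) using Suc.prems(2) vanq by (simp add: vanishes_def)
        qed (rule step(1))
        moreover have pu: "poly u (Var i) \<in> polys UNIV"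
          using poly_Var_polys[of u S i] Suc.prems(1) polys_UNIV by blast
        moreover have "Polynomial.coeff u (\<delta> + m) * Var i ^ m \<in> polys UNIV"
          using Suc.prems(1) polys_UNIV by (intro polys_intros) auto
        moreover have "ev (poly u (Var i)) z = 0" using Suc.prems(2) z(1) by (simp add: vanishes_def)
        \<comment> \<open>Both \<open>u\<close> and \<open>q\<close> give values 0 at
          \<open>z\<close>, and the derivative of the latter is 0, so the product rule leaves a
          single term.\<close>
        ultimately have "ev a z * dv (poly u (Var i)) z v = 0"
          unfolding step(2) using dv_mult[OF aS(2) pu, of z v]
            dv_mult[of "Polynomial.coeff u (\<delta> + m) * Var i ^ m" UNIV "poly q (Var i)" z v] pq za
          by simp
        thus ?case using za by simp
      qed
      moreover obtain u where u: "P = poly u (Var i)" "\<And>k. Polynomial.coeff u k \<in> polys S"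
        using decompose[OF P(1)] by blast
      moreover have "Polynomial.coeff u k = 0" if "k \<ge> \<delta> + Suc (Polynomial.degree u)" for k
        using that by (intro coeff_eq_0) simp
      ultimately show "dv P z v = 0" using P(2) by blast
    qed
    thus ?thesis
      using growth_insert_algebraic[OF Z g rel] a by (simp add: a_def)
  qed
qed

lemma growth_tangent:
  fixes Z :: "('k::field ^ 'v::finite) set"
  assumes Z: "prime_set Z"
  obtains t c where "t + c = card S" "growth Z S t" "tangent_codim Z S c"
proof -
  have "\<exists>t c. t + c = card S \<and> growth Z S t \<and> tangent_codim Z S c"
    using finite[of S]
  proof (induction S rule: finite_induct)
    case empty
    have "dv P z v = 0" if "polyf {} d P" for d z v and P :: "('v, 'k) polyfun"
      using that
    proof induction
      case (mult d P e Q)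
      thus ?case using dv_mult[OF polyf_polys polyf_polys, of "{}" d P e Q z v] by (simp add: zero_fun_apply)
    qed auto
    hence "tangent_codim Z {} 0"
      unfolding tangent_codim_def using prime_set_1[OF Z] polys_1
      by (intro bexI[of _ 1] conjI exI[of _ "{}"]) (auto simp: polys_def)
    thus ?case using growth_empty[OF Z] by (intro exI[of _ 0]) simp
  next
    case (insert i S)
    then obtain t c where "t + c = card S" "growth Z S t" "tangent_codim Z S c" by blast
    with growth_tangent_insert[OF Z this(2,3), of i] insert.hyps show ?case
      by (metis add_Suc add_Suc_right card_insert_disjoint)
  qed
  thus ?thesis using that by blast
qed

section \<open>Chains of irreducible closed sets\<close>

text \<open>The head of the list is the exponent of the factor with the highest index, so peeling it
  off goes one step down the chain.\<close>

primrec chain_monomial :: "(nat \<Rightarrow> ('v, 'k::field) polyfun) \<Rightarrow> nat list \<Rightarrow> ('v, 'k) polyfun" where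
  "chain_monomial h [] = 1"
| "chain_monomial h (k # ks) = h (length ks) ^ k * chain_monomial h ks"

definition exponents :: "nat \<Rightarrow> nat \<Rightarrow> nat list set" where
  "exponents i N = {xs. set xs \<subseteq> {..N} \<and> length xs = i}"

lemma finite_exponents: "finite (exponents i N)"
  unfolding exponents_def by (rule finite_lists_length_eq) simp

lemma card_exponents: "card (exponents i N) = (N + 1) ^ i"
  unfolding exponents_def by (subst card_lists_length_eq) simp_all

lemma exponents_0: "exponents 0 N = {[]}"
  by (auto simp: exponents_def)

lemma exponents_Suc: "exponents (Suc i) N = (\<lambda>(k, ks). k # ks) ` ({..N} \<times> exponents i N)"
  by (auto simp: exponents_def length_Suc_conv image_iff)

lemma sum_exponents_Suc:
  "(\<Sum>xs\<in>exponents (Suc i) N. f xs) = (\<Sum>k\<le>N. \<Sum>ks\<in>exponents i N. f (k # ks))"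
proof -
  have "inj_on (\<lambda>(k, ks). k # ks) ({..N} \<times> exponents i N)" by (auto simp: inj_on_def)
  hence "(\<Sum>xs\<in>exponents (Suc i) N. f xs) = (\<Sum>x\<in>{..N} \<times> exponents i N. f (fst x # snd x))"
    unfolding exponents_Suc by (subst sum.reindex) (auto simp: case_prod_unfold)
  thus ?thesis by (simp add: sum.cartesian_product case_prod_unfold)
qed

lemma polyf_chain_monomial:
  assumes "\<And>i. i < d \<Longrightarrow> polyf S E (h i)"
  shows "ks \<in> exponents i N \<Longrightarrow> i \<le> d \<Longrightarrow> polyf S (i * (N * E)) (chain_monomial h ks)"
proof (induction i arbitrary: ks)
  case 0
  thus ?case by (simp add: exponents_0 polyf_1)
next
  case (Suc i)
  then obtain k ls where ks: "ks = k # ls" "k \<le> N" "ls \<in> exponents i N" by (auto simp: exponents_Suc)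
  have len: "length ls = i" using ks by (simp add: exponents_def)
  have "polyf S (k * E) (h i ^ k)" using assms[of i] Suc.prems by (intro polyf_power) simp
  hence "polyf S (N * E) (h i ^ k)" by (rule polyf_mono) (use ks in simp)
  thus ?case using polyf.mult[OF _ Suc.IH[OF ks(3)]] Suc.prems len by (simp add: ks(1))
qed

text \<open>A relation among the monomials in \<open>h 0, \<dots>, h i\<close> on \<open>Z (i + 1)\<close>, divided by the largest
  possible power of \<open>h i\<close> and restricted to \<open>Z i\<close>, is a relation in \<open>h 0, \<dots>, h (i - 1)\<close>.\<close>

lemma chain_monomials_independent:
  fixes h :: "nat \<Rightarrow> ('v::finite, 'k::field) polyfun" and Z :: "nat \<Rightarrow> ('k ^ 'v) set"
  assumes prime: "\<And>i. i \<le> d \<Longrightarrow> prime_set (Z i)" and sub: "\<And>i. i < d \<Longrightarrow> Z i \<subseteq> Z (Suc i)"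
    and h: "\<And>i. i < d \<Longrightarrow> h i \<in> polys UNIV" "\<And>i. i < d \<Longrightarrow> vanishes (Z i) (h i)"
      "\<And>i. i < d \<Longrightarrow> \<not> vanishes (Z (Suc i)) (h i)"
  shows "i \<le> d \<Longrightarrow> vanishes (Z i) (\<Sum>ks\<in>exponents i N. Const (c ks) * chain_monomial h ks) \<Longrightarrow>
    ks \<in> exponents i N \<Longrightarrow> c ks = 0"
proof (induction i arbitrary: c ks)
  case 0
  thus ?case using prime[of 0] by (auto simp: exponents_0 vanishes_def prime_set_def)
next
  case (Suc i)
  have id: "i < d" using Suc.prems by simp
  define g where "g = (\<lambda>k. \<Sum>ls\<in>exponents i N. Const (c (k # ls)) * chain_monomial h ls)"
  have monom: "chain_monomial h ls \<in> polys UNIV" if "length ls \<le> d" for ls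
    using that by (induction ls) (auto intro!: polys_1 polys_mult polys_power h)
  have g: "g k \<in> polys UNIV" for k
    unfolding g_def using id by (intro polys_sum polys_mult polys_Const monom) (auto simp: exponents_def)
  have ev_sum: "(\<Sum>k\<le>N. ev (h i) z ^ k * ev (g k) z) = 0" if z: "z \<in> Z (Suc i)" for z
  proof -
    have "ev (\<Sum>ks\<in>exponents (Suc i) N. Const (c ks) * chain_monomial h ks) z = 0"
      using Suc.prems(2) z by (simp only: vanishes_def)
    hence "(\<Sum>k\<le>N. \<Sum>ls\<in>exponents i N. ev (Const (c (k # ls)) * chain_monomial h (k # ls)) z) = 0"
      by (simp only: ev_sum sum_exponents_Suc)
    moreover have "(\<Sum>ls\<in>exponents i N. ev (Const (c (k # ls)) * chain_monomial h (k # ls)) z) =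
        ev (h i) z ^ k * ev (g k) z" for k
      unfolding g_def ev_sum sum_distrib_left
      by (intro sum.cong) (auto simp: exponents_def)
    ultimately show ?thesis by simp
  qed
  have zero: "\<forall>ls\<in>exponents i N. c (k # ls) = 0" if "k \<le> N" for k
    using that
  proof (induction k rule: less_induct)
    case (less k)
    have gz: "ev (g l) z = 0" if "l < k" for l z
      using less.IH[OF that] less.prems that by (auto simp: g_def)
    \<comment> \<open>The coefficients below \<open>k\<close> vanish by induction, so the relation
      is \<open>h i ^ k\<close> times \<open>r\<close>, and primality cancels the power.\<close>
    define r where "r = (\<Sum>l\<in>{k..N}. h i ^ (l - k) * g l)"
    have r: "r \<in> polys UNIV" unfolding r_def by (intro polys_intros h g id)
    have "ev (h i ^ k * r) z = 0" if z: "z \<in> Z (Suc i)" for z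
    proof -
      have "(\<Sum>l\<le>N. ev (h i) z ^ l * ev (g l) z) = (\<Sum>l\<in>{k..N}. ev (h i) z ^ l * ev (g l) z)"
        by (rule sum.mono_neutral_right) (auto simp: gz)
      also have "\<dots> = (\<Sum>l\<in>{k..N}. ev (h i) z ^ k * (ev (h i) z ^ (l - k) * ev (g l) z))"
        by (intro sum.cong) (auto simp: mult.assoc[symmetric] power_add[symmetric])
      finally show ?thesis using ev_sum[OF z] by (simp add: r_def sum_distrib_left)
    qed
    hence "vanishes (Z (Suc i)) (h i ^ k * r)" by (simp add: vanishes_def)
    hence "vanishes (Z (Suc i)) r"
      using prime_setD[OF prime[OF Suc.prems(1)] polys_power[OF h(1)[OF id]] r]
        prime_set_power[OF prime[OF Suc.prems(1)] h(1)[OF id] h(3)[OF id]] by blast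
    have "ev (g k) z = 0" if z: "z \<in> Z i" for z
    proof -
      have "ev r z = 0" using \<open>vanishes (Z (Suc i)) r\<close> z sub[OF id] by (auto simp: vanishes_def)
      moreover have "ev (h i) z = 0" using h(2)[OF id] z by (simp add: vanishes_def)
      \<comment> \<open>On \<open>Z i\<close> only the exponent 0 survives, as 0 ^ 0 = 1.\<close>
      moreover have "(\<Sum>l\<in>{k..N}. 0 ^ (l - k) * ev (g l) z) = (\<Sum>l\<in>{k}. 0 ^ (l - k) * ev (g l) z)"
        using less.prems by (intro sum.mono_neutral_right) auto
      ultimately show ?thesis by (simp add: r_def)
    qed
    hence "vanishes (Z i) (g k)" by (simp add: vanishes_def)
    hence "vanishes (Z i) (\<Sum>ls\<in>exponents i N. Const (c (k # ls)) * chain_monomial h ls)"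
      by (simp only: g_def)
    thus ?case using Suc.IH[of "\<lambda>ls. c (k # ls)"] id by simp
  qed
  show ?case using Suc.prems(3) zero by (auto simp: exponents_Suc)
qed

text \<open>With exponents up to N, the chain monomials are (N + 1)^d independent functions of
  degree at most d N E. The denominator \<open>s\<close> keeps them independent because
  \<open>Z d\<close> is prime, so they fit into a space of dimension at most C (d N E + 1)^t only if
  d \<le> t.\<close>

lemma chain_length_le_growth:
  fixes Z :: "nat \<Rightarrow> ('k::field ^ 'v::finite) set"
  assumes Z: "\<And>i. i \<le> d \<Longrightarrow> irreducible_closed (Z i)" "\<And>i. i < d \<Longrightarrow> Z i \<subset> Z (Suc i)"
    and g: "growth (Z d) UNIV t"
  shows "d \<le> t"
proof -
  have "\<exists>h. h \<in> polys UNIV \<and> vanishes (Z i) h \<and> \<not> vanishes (Z (Suc i)) h" if i: "i < d" for i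
    using zariski_closed_separate[of "Z i" "Z (Suc i)"] Z(1)[of i] Z(2)[OF i] i
    unfolding irreducible_closed_def by (metis less_imp_le)
  then obtain h where h: "\<And>i. i < d \<Longrightarrow> h i \<in> polys UNIV" "\<And>i. i < d \<Longrightarrow> vanishes (Z i) (h i)"
      "\<And>i. i < d \<Longrightarrow> \<not> vanishes (Z (Suc i)) (h i)" by metis
  obtain E where E: "\<And>i. i < d \<Longrightarrow> polyf UNIV E (h i)"
    using polys_common_degree[of "{..<d}" h UNIV] h(1) by auto
  have prime: "prime_set (Z i)" if "i \<le> d" for i using irreducible_closed_prime[OF Z(1)[OF that]] .
  have sub: "Z i \<subseteq> Z (Suc i)" if "i < d" for i using Z(2)[OF that] by blast
  obtain C where C: "\<And>D. \<exists>s\<in>polys UNIV. \<not> vanishes (Z d) s \<and>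
     (\<exists>B. finite B \<and> card B \<le> C * (D + 1) ^ t \<and> (\<forall>P. polyf UNIV D P \<longrightarrow> restr (Z d) (s * P) \<in> funspace.span B))"
    using g unfolding growth_def by blast
  have bound: "(N + 1) ^ d \<le> C * (d * (N * E) + 1) ^ t" for N
  proof -
    obtain s B where s: "s \<in> polys UNIV" "\<not> vanishes (Z d) s" "finite B" "card B \<le> C * (d * (N * E) + 1) ^ t"
      "\<And>P. polyf UNIV (d * (N * E)) P \<Longrightarrow> restr (Z d) (s * P) \<in> funspace.span B"
      using C by blast
    define F where "F = (\<lambda>ks. restr (Z d) (s * chain_monomial h ks))"
    have indep: "c ks = 0"
      if eq: "(\<Sum>ks\<in>exponents d N. (\<lambda>z. c ks * F ks z)) = 0" and ks: "ks \<in> exponents d N" for c ks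
    proof (rule chain_monomials_independent[where i = d and c = c and Z = Z, OF prime sub h order.refl _ ks])
      define r where "r = (\<Sum>ks\<in>exponents d N. Const (c ks) * chain_monomial h ks)"
      have "ev (s * r) z = 0" if z: "z \<in> Z d" for z
      proof -
        have *: "(\<Sum>ks\<in>A. (\<lambda>z. c ks * F ks z)) z = (\<Sum>ks\<in>A. c ks * F ks z)" for A
          by (induction A rule: infinite_finite_induct) (simp_all add: plus_fun_apply)
        have "(\<Sum>ks\<in>exponents d N. c ks * F ks z) = 0"
          unfolding *[symmetric] eq by simp
        moreover have "ev (s * r) z = (\<Sum>ks\<in>exponents d N. c ks * F ks z)"
          using z by (simp add: r_def F_def restr_def sum_distrib_left mult_ac)
        ultimately show ?thesis by simp
      qed
      hence "vanishes (Z d) (s * r)" by (simp add: vanishes_def)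
      moreover have "r \<in> polys UNIV"
        unfolding r_def
        by (intro polys_sum polys_mult polys_Const polyf_polys[OF polyf_chain_monomial[OF E _ order.refl]])
      ultimately show "vanishes (Z d) (\<Sum>ks\<in>exponents d N. Const (c ks) * chain_monomial h ks)"
        using prime_setD[OF prime[OF order.refl] s(1)] s(2) unfolding r_def by blast
    qed
    have inj: "inj_on F (exponents d N)"
    proof (rule inj_onI, rule ccontr)
      fix ks ls assume k: "ks \<in> exponents d N" "ls \<in> exponents d N" "F ks = F ls" "ks \<noteq> ls"
      define c where "c = (\<lambda>xs. if xs = ks then 1 else if xs = ls then - 1 else (0 :: 'k))"
      have "(\<Sum>xs\<in>exponents d N. (\<lambda>z. c xs * F xs z)) = (\<Sum>xs\<in>{ks, ls}. (\<lambda>z. c xs * F xs z))"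
        using k finite_exponents by (intro sum.mono_neutral_right) (auto simp: c_def fun_eq_iff)
      also have "\<dots> = 0" using k by (simp add: c_def fun_eq_iff fun_ring_apply)
      finally show False using indep[of c ks] k by (simp add: c_def)
    qed
    have "funspace.independent (F ` exponents d N)"
    proof (rule funspace.independent_if_scalars_zero)
      fix c f assume c: "(\<Sum>f\<in>F ` exponents d N. (\<lambda>z. c f * f z)) = 0" and "f \<in> F ` exponents d N"
      then obtain ks where ks: "ks \<in> exponents d N" "f = F ks" by blast
      have "(\<Sum>ks\<in>exponents d N. (\<lambda>z. c (F ks) * F ks z)) = 0"
        using c by (simp add: sum.reindex[OF inj])
      thus "c f = 0" using indep[of "\<lambda>ks. c (F ks)" ks] ks by simp
    qed (simp add: finite_exponents)
    moreover have "F ` exponents d N \<subseteq> funspace.span B"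
      using s(5) polyf_chain_monomial[OF E _ order.refl] by (auto simp: F_def)
    ultimately have "card (F ` exponents d N) \<le> card B"
      using funspace.independent_span_bound[OF s(3)] by blast
    hence "(N + 1) ^ d \<le> card B" by (simp add: card_image[OF inj] card_exponents)
    thus ?thesis using s(4) by simp
  qed
  show "d \<le> t"
  proof (rule ccontr)
    assume "\<not> d \<le> t"
    hence td: "Suc t \<le> d" by simp
    \<comment> \<open>For d > t the bound fails at N = M: its left side is at least (M + 1)^(t + 1),
      its right side at most M (M + 1)^t.\<close>
    define M where "M = C * (d * E + 1) ^ t"
    have "(M + 1) ^ Suc t \<le> (M + 1) ^ d" using td by (intro power_increasing) auto
    also have "\<dots> \<le> C * (d * (M * E) + 1) ^ t" by (rule bound)
    also have "\<dots> \<le> C * ((d * E + 1) * (M + 1)) ^ t"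
      by (intro mult_left_mono power_mono) (auto simp: algebra_simps)
    also have "\<dots> = M * (M + 1) ^ t" by (simp only: M_def power_mult_distrib mult.assoc)
    finally have "(M + 1) * (M + 1) ^ t \<le> M * (M + 1) ^ t" by simp
    thus False by simp
  qed
qed

declare fun_ring_apply [simp]

section \<open>From the kernel variety to vanishing subspaces\<close>

lemma growth_Un:
  assumes "growth Z S t"
  shows "finite A \<Longrightarrow> growth Z (S \<union> A) (t + card A)"
proof (induction A rule: finite_induct)
  case (insert x A)
  thus ?case using growth_insert[of Z "S \<union> A" "t + card A" x] by simp
qed (use assms in simp)

lemma common_kernel_dim:
  fixes f :: "'i \<Rightarrow> 'k::field ^ 'n::finite \<Rightarrow> 'k"
  assumes "finite I" and lin: "\<And>i v w. f i (v + w) = f i v + f i w" "\<And>i c v. f i (c *s v) = c * f i v"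
  shows "vec.subspace {v. \<forall>i\<in>I. f i v = 0}" "CARD('n) \<le> vec.dim {v. \<forall>i\<in>I. f i v = 0} + card I"
proof -
  have zero: "f i 0 = 0" for i using lin(2)[of i 0 0] by simp
  have diff: "f i (v - w) = f i v - f i w" for i v w
    using lin(1)[of i "v - w" w] by simp
  have sub: "vec.subspace {v. \<forall>i\<in>I. f i v = 0}" for I
    by (rule vec.subspaceI) (simp_all add: zero lin)
  show "vec.subspace {v. \<forall>i\<in>I. f i v = 0}" by (rule sub)
  show "CARD('n) \<le> vec.dim {v. \<forall>i\<in>I. f i v = 0} + card I"
    using assms(1)
  proof (induction I rule: finite_induct)
    case empty
    show ?case by (simp add: vec_dim_card del: vec.dim_UNIV)
  next
    case (insert i I)
    let ?W = "{v. \<forall>i\<in>I. f i v = 0}" and ?W' = "{v. \<forall>i\<in>insert i I. f i v = 0}"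
    have "vec.dim ?W \<le> vec.dim ?W' + 1"
    proof (cases "\<exists>u\<in>?W. f i u \<noteq> 0")
      case False
      hence "?W' = ?W" by auto
      thus ?thesis by simp
    next
      case True
      then obtain u where u: "u \<in> ?W" "f i u \<noteq> 0" by blast
      have "?W \<subseteq> vec.span (insert u ?W')"
      proof
        fix v assume v: "v \<in> ?W"
        define c where "c = f i v / f i u"
        have "v - c *s u \<in> ?W'" using u v by (simp add: lin diff c_def)
        hence "c *s u + (v - c *s u) \<in> vec.span (insert u ?W')"
          by (intro vec.span_add vec.span_scale vec.span_base) auto
        thus "v \<in> vec.span (insert u ?W')" by simp
      qed
      hence "vec.dim ?W \<le> vec.dim (insert u ?W')" by (rule vec.dim_mono)
      also have "\<dots> \<le> vec.dim ?W' + 1" by (simp add: vec.dim_insert)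
      finally show ?thesis .
    qed
    thus ?case using insert by simp
  qed
qed

section \<open>Linear equations in the second argument and fraction-free elimination\<close>

definition row_relation ::
  "('k::field ^ 'v::finite) set \<Rightarrow> 'v set \<Rightarrow> ('m::finite \<Rightarrow> 'v) \<Rightarrow> ('m \<Rightarrow> ('v, 'k) polyfun) \<Rightarrow> bool" where
  "row_relation Z S y \<rho> \<longleftrightarrow> (\<forall>m. \<rho> m \<in> polys S) \<and> (\<forall>z\<in>Z. (\<Sum>m\<in>UNIV. ev (\<rho> m) z * z $ y m) = 0)"

text \<open>Fraction-free elimination: \<open>\<rho> j\<close>, for \<open>j\<close> in a maximal set \<open>J\<close> of pivots, are the rows of the
  reduced echelon form with common pivot \<open>s\<close>.\<close>

definition pivots ::
  "('k::field ^ 'v::finite) set \<Rightarrow> 'v set \<Rightarrow> ('m::finite \<Rightarrow> 'v) \<Rightarrow> 'm set \<Rightarrow> ('v, 'k) polyfun \<Rightarrow>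
    ('m \<Rightarrow> 'm \<Rightarrow> ('v, 'k) polyfun) \<Rightarrow> bool" where
  "pivots Z S y J s \<rho> \<longleftrightarrow> s \<in> polys S \<and> \<not> vanishes Z s \<and> (\<forall>j\<in>J. row_relation Z S y (\<rho> j) \<and>
     (\<forall>l\<in>J. \<forall>z\<in>Z. ev (\<rho> j l) z = (if l = j then ev s z else 0)))"

lemma row_relation_combine:
  assumes "row_relation Z S y \<rho>" "row_relation Z S y \<rho>'" "a \<in> polys S" "b \<in> polys S"
  shows "row_relation Z S y (\<lambda>m. a * \<rho> m - b * \<rho>' m)"
  unfolding row_relation_def
proof (intro conjI allI ballI)
  show "a * \<rho> m - b * \<rho>' m \<in> polys S" for m
    using assms by (intro polys_diff polys_mult) (auto simp: row_relation_def)
  fix z assume z: "z \<in> Z"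
  have "(\<Sum>m\<in>UNIV. ev (a * \<rho> m - b * \<rho>' m) z * z $ y m) =
      ev a z * (\<Sum>m\<in>UNIV. ev (\<rho> m) z * z $ y m) - ev b z * (\<Sum>m\<in>UNIV. ev (\<rho>' m) z * z $ y m)"
    by (simp add: sum_distrib_left algebra_simps sum_subtractf)
  thus "(\<Sum>m\<in>UNIV. ev (a * \<rho> m - b * \<rho>' m) z * z $ y m) = 0"
    using assms(1,2) z by (simp add: row_relation_def)
qed

lemma row_relation_combine_sum:
  assumes "row_relation Z S y \<rho>" "\<And>j. j \<in> J \<Longrightarrow> row_relation Z S y (\<rho>' j)" "a \<in> polys S" "\<And>j. b j \<in> polys S"
  shows "row_relation Z S y (\<lambda>m. a * \<rho> m - (\<Sum>j\<in>J. b j * \<rho>' j m))"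
  unfolding row_relation_def
proof (intro conjI allI ballI)
  show "a * \<rho> m - (\<Sum>j\<in>J. b j * \<rho>' j m) \<in> polys S" for m
    using assms by (intro polys_diff polys_mult polys_sum) (auto simp: row_relation_def)
  fix z assume z: "z \<in> Z"
  have "(\<Sum>m\<in>UNIV. ev (a * \<rho> m - (\<Sum>j\<in>J. b j * \<rho>' j m)) z * z $ y m) =
      ev a z * (\<Sum>m\<in>UNIV. ev (\<rho> m) z * z $ y m) - (\<Sum>m\<in>UNIV. \<Sum>j\<in>J. ev (b j) z * (ev (\<rho>' j m) z * z $ y m))"
    by (simp add: sum_distrib_left sum_distrib_right algebra_simps sum_subtractf)
  also have "(\<Sum>m\<in>UNIV. \<Sum>j\<in>J. ev (b j) z * (ev (\<rho>' j m) z * z $ y m)) =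
      (\<Sum>j\<in>J. ev (b j) z * (\<Sum>m\<in>UNIV. ev (\<rho>' j m) z * z $ y m))"
    unfolding sum_distrib_left by (rule sum.swap)
  also have "\<dots> = 0" using assms(2) z by (intro sum.neutral) (simp add: row_relation_def)
  also have "ev a z * (\<Sum>m\<in>UNIV. ev (\<rho> m) z * z $ y m) - 0 = 0"
    using assms(1) z by (simp add: row_relation_def)
  finally show "(\<Sum>m\<in>UNIV. ev (a * \<rho> m - (\<Sum>j\<in>J. b j * \<rho>' j m)) z * z $ y m) = 0" .
qed

text \<open>Take a maximal set of pivots. If a row of \<open>A\<close> is not reduced to 0, its
  residual vanishes in the columns \<open>J\<close> but not in some column \<open>l\<close>, which
  becomes a further pivot. All linear equations in y valid on \<open>Z\<close> compete, so
  \<open>card J\<close> may exceed the generic rank of \<open>A\<close>; what counts is that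
  \<open>A\<close> factors through its columns in \<open>J\<close> and that every pivot makes one
  coordinate algebraic.\<close>

lemma fraction_free_elimination:
  fixes Z :: "('k::field ^ 'v::finite) set" and A :: "'l \<Rightarrow> 'm::finite \<Rightarrow> ('v, 'k) polyfun"
  assumes Z: "prime_set Z" and A: "\<And>k. row_relation Z S y (A k)"
  obtains J s \<rho> where "pivots Z S y J s \<rho>"
    "\<forall>k l. \<forall>z\<in>Z. ev s z * ev (A k l) z = (\<Sum>j\<in>J. ev (A k j) z * ev (\<rho> j l) z)"
proof -
  define P where "P = (\<lambda>J. \<exists>s \<rho>. pivots Z S y J s \<rho>)"
  have "P {}" using prime_set_1[OF Z] polys_1 by (auto simp: P_def pivots_def)
  moreover have "\<forall>J. P J \<longrightarrow> card J < Suc CARD('m)" by (simp add: card_mono less_Suc_eq_le)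
  ultimately obtain J where "P J" and max: "\<And>J'. P J' \<Longrightarrow> card J' \<le> card J"
    using ex_has_greatest_nat[of P "{}" card] by blast
  then obtain s \<rho> where piv: "pivots Z S y J s \<rho>" by (auto simp: P_def)
  hence s: "s \<in> polys S" "\<not> vanishes Z s" and \<rho>: "\<And>j. j \<in> J \<Longrightarrow> row_relation Z S y (\<rho> j)"
    "\<And>j l z. j \<in> J \<Longrightarrow> l \<in> J \<Longrightarrow> z \<in> Z \<Longrightarrow> ev (\<rho> j l) z = (if l = j then ev s z else 0)"
    by (auto simp: pivots_def)
  have AS: "A k l \<in> polys S" for k l using A by (auto simp: row_relation_def)
  have \<rho>S: "\<rho> j l \<in> polys S" if "j \<in> J" for j l using \<rho>(1)[OF that] by (auto simp: row_relation_def)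
  have "vanishes Z (s * A k l - (\<Sum>j\<in>J. A k j * \<rho> j l))" for k l
  proof (rule ccontr)
    define r where "r = (\<lambda>m. s * A k m - (\<Sum>j\<in>J. A k j * \<rho> j m))"
    assume "\<not> vanishes Z (s * A k l - (\<Sum>j\<in>J. A k j * \<rho> j l))"
    hence rl: "\<not> vanishes Z (r l)" by (simp add: r_def)
    have row: "row_relation Z S y r"
      unfolding r_def by (intro row_relation_combine_sum A \<rho> s AS)
    hence rS: "r m \<in> polys S" for m by (simp add: row_relation_def)
    have rJ: "ev (r m) z = 0" if m: "m \<in> J" and z: "z \<in> Z" for m z
    proof -
      have "(\<Sum>j\<in>J. ev (A k j) z * ev (\<rho> j m) z) = (\<Sum>j\<in>J. if j = m then ev (A k j) z * ev s z else 0)"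
        using \<rho>(2)[OF _ m z] by (intro sum.cong) auto
      thus ?thesis using m by (simp add: r_def)
    qed
    have lJ: "l \<notin> J" using rl rJ by (auto simp: vanishes_def)
    \<comment> \<open>The old rows are cleared in column \<open>l\<close>, and the new row is scaled
      by \<open>s\<close> so that all share the pivot \<open>s * r l\<close>. The summand with
      factor 0 gives it the shape of \<open>row_relation_combine\<close>.\<close>
    define \<rho>' where "\<rho>' = (\<lambda>j. if j = l then (\<lambda>m. s * r m - 0 * r m) else (\<lambda>m. r l * \<rho> j m - \<rho> j l * r m))"
    have "pivots Z S y (insert l J) (s * r l) \<rho>'"
      unfolding pivots_def
    proof (intro conjI ballI)
      show "s * r l \<in> polys S" by (intro polys_mult s rS)
      show "\<not> vanishes Z (s * r l)"
        using prime_setD[OF Z polys_UNIV[OF s(1)] polys_UNIV[OF rS]] s(2) rl by blast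
      fix j assume j: "j \<in> insert l J"
      show "row_relation Z S y (\<rho>' j)"
        using j \<rho>(1)[of j] \<rho>S[of j] rS s(1) row polys_0
        by (cases "j = l") (auto simp: \<rho>'_def simp del: mult_zero_left intro!: row_relation_combine)
      fix m z assume m: "m \<in> insert l J" and z: "z \<in> Z"
      show "ev (\<rho>' j m) z = (if m = j then ev (s * r l) z else 0)"
        using j m lJ \<rho>(2)[of j m z] rJ[of m z] z by (auto simp: \<rho>'_def)
    qed
    hence "P (insert l J)" by (auto simp: P_def)
    from max[OF this] lJ show False by simp
  qed
  hence "ev s z * ev (A k l) z = (\<Sum>j\<in>J. ev (A k j) z * ev (\<rho> j l) z)" if "z \<in> Z" for k l z
    using that by (simp add: vanishes_def)
  thus ?thesis using that piv by blast
qed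

text \<open>The row of a pivot \<open>j\<close> is a relation of degree 1 for the coordinate
  \<open>y j\<close>, with leading coefficient \<open>s\<close>; only the coordinates outside
  \<open>J\<close> can raise the exponent.\<close>

lemma growth_pivots:
  fixes Z :: "('k::field ^ 'v::finite) set" and y :: "'m::finite \<Rightarrow> 'v"
  assumes Z: "prime_set Z" and g: "growth Z S t" and piv: "pivots Z S y J s \<rho>" and y: "inj y"
  shows "growth Z (S \<union> range y) (t + card (- J))"
proof -
  have s: "s \<in> polys S" "\<not> vanishes Z s" and \<rho>: "\<And>j. j \<in> J \<Longrightarrow> row_relation Z S y (\<rho> j)"
    "\<And>j l z. j \<in> J \<Longrightarrow> l \<in> J \<Longrightarrow> z \<in> Z \<Longrightarrow> ev (\<rho> j l) z = (if l = j then ev s z else 0)"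
    using piv by (auto simp: pivots_def)
  define S0 where "S0 = S \<union> y ` (- J)"
  have "card (y ` (- J)) = card (- J)" using y by (intro card_image) (simp add: inj_on_def)
  hence g0: "growth Z S0 (t + card (- J))"
    using growth_Un[OF g, of "y ` (- J)"] by (simp add: S0_def)
  have "growth Z (S0 \<union> y ` J') (t + card (- J))" if "J' \<subseteq> J" for J'
    using finite[of J'] that
  proof (induction J' rule: finite_induct)
    case (insert j J')
    hence j: "j \<in> J" by simp
    define q where "q = [:\<Sum>l\<in>-J. \<rho> j l * Var (y l), s:]"
    have S0: "S \<subseteq> S0 \<union> y ` J'" "\<And>l. l \<in> - J \<Longrightarrow> y l \<in> S0 \<union> y ` J'" by (auto simp: S0_def)
    have \<rho>S: "\<rho> j l \<in> polys S" for l using \<rho>(1)[OF j] by (simp add: row_relation_def)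
    have "(\<Sum>l\<in>-J. \<rho> j l * Var (y l)) \<in> polys (S0 \<union> y ` J')"
      using polys_subset[OF \<rho>S S0(1)] S0(2) by (intro polys_sum polys_mult polys_Var) auto
    moreover have "s \<in> polys (S0 \<union> y ` J')" by (rule polys_subset[OF s(1) S0(1)])
    ultimately have "Polynomial.coeff q k \<in> polys (S0 \<union> y ` J')" for k
      using polys_0 by (auto simp: q_def coeff_pCons split: nat.split)
    moreover have "vanishes Z (poly q (Var (y j)))"
      unfolding vanishes_def
    proof
      fix z assume z: "z \<in> Z"
      have "(\<Sum>m\<in>J. ev (\<rho> j m) z * z $ y m) = (\<Sum>m\<in>J. if m = j then ev s z * z $ y m else 0)"
        using \<rho>(2)[OF j _ z] by (intro sum.cong) auto
      hence "(\<Sum>m\<in>J. ev (\<rho> j m) z * z $ y m) = ev s z * z $ y j" using j by simp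
      moreover have "(\<Sum>m\<in>UNIV. ev (\<rho> j m) z * z $ y m) = 0"
        using \<rho>(1)[OF j] z by (simp add: row_relation_def)
      moreover have "(\<Sum>m\<in>UNIV. ev (\<rho> j m) z * z $ y m) =
          (\<Sum>m\<in>J. ev (\<rho> j m) z * z $ y m) + (\<Sum>m\<in>-J. ev (\<rho> j m) z * z $ y m)"
        by (subst sum.union_disjoint[symmetric]) auto
      ultimately show "ev (poly q (Var (y j))) z = 0" by (simp add: q_def algebra_simps)
    qed
    ultimately have "relation Z (S0 \<union> y ` J') (y j) q" by (simp add: relation_def)
    moreover have "s \<noteq> 0" using s(2) by (auto simp: vanishes_def)
    hence "\<not> vanishes Z (Polynomial.lead_coeff q)" using s(2) by (simp add: q_def)
    ultimately show ?case
      using growth_insert_algebraic[OF Z insert.IH] insert.prems by simp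
  qed (use g0 in simp)
  moreover have "S0 \<union> y ` J = S \<union> range y" by (auto simp: S0_def)
  ultimately show ?thesis by (metis order.refl)
qed

text \<open>On \<open>Z d\<close>, \<open>s\<close> times the matrix \<open>A\<close> equals its
  pivot columns times \<rho>. Let \<open>w\<close> annihilate the pivot columns at \<open>z\<close>,
  let \<rho> annihilate \<open>u\<close>, and let \<open>x\<close> be tangent: differentiating the
  identity along \<open>x\<close> yields T(x, u, w) = 0. These are at most c, r and r equations,
  where r is \<open>card J\<close>. The dimension bound combines d \<le> t + n2 - r with t + c =
  n1.\<close>

lemma chain_vanishing_subspaces:
  fixes T :: "('k::field, 'n1::finite, 'n2::finite, 'n3::finite) tensor3"
    and Z :: "nat \<Rightarrow> ('k ^ ('n1 + 'n2)) set"
  assumes chain: "\<And>i. i \<le> d \<Longrightarrow> irreducible_closed (Z i)" "\<And>i. i < d \<Longrightarrow> Z i \<subset> Z (Suc i)"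
    and ker: "\<And>z. z \<in> Z d \<Longrightarrow> bilinear_map T (\<chi> i. z $ Inl i) (\<chi> j. z $ Inr j) = 0"
  obtains U1 U2 U3 c r where "vec.subspace U1" "vec.subspace U2" "vec.subspace U3"
    "\<forall>x\<in>U1. \<forall>y\<in>U2. \<forall>w\<in>U3. trilinear_form T x y w = 0"
    "CARD('n1) \<le> vec.dim U1 + c" "CARD('n2) \<le> vec.dim U2 + r" "CARD('n3) \<le> vec.dim U3 + r"
    "d + c + r \<le> CARD('n1) + CARD('n2)"
proof -
  define S :: "('n1 + 'n2) set" where "S = range Inl"
  have Zd: "prime_set (Z d)" by (rule irreducible_closed_prime[OF chain(1)]) simp
  define A :: "'n3 \<Rightarrow> 'n2 \<Rightarrow> ('n1 + 'n2, 'k) polyfun"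
    where "A = (\<lambda>k m. \<Sum>i\<in>UNIV. Const (T $ i $ m $ k) * Var (Inl i))"
  have AS: "A k m \<in> polys S" for k m
    unfolding A_def S_def by (intro polys_sum polys_mult polys_Const polys_Var) simp
  have row: "row_relation (Z d) S Inr (A k)" for k
    unfolding row_relation_def
  proof (intro conjI allI ballI AS)
    fix z assume "z \<in> Z d"
    hence "(\<Sum>i\<in>UNIV. \<Sum>m\<in>UNIV. T $ i $ m $ k * z $ Inl i * z $ Inr m) = 0"
      using ker[of z] by (simp add: bilinear_map_def vec_eq_iff)
    hence "(\<Sum>m\<in>UNIV. \<Sum>i\<in>UNIV. T $ i $ m $ k * z $ Inl i * z $ Inr m) = 0"
      by (subst sum.swap)
    thus "(\<Sum>m\<in>UNIV. ev (A k m) z * z $ Inr m) = 0" by (simp add: A_def sum_distrib_right)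
  qed
  obtain J s \<rho> where piv: "pivots (Z d) S Inr J s \<rho>"
    and "\<forall>k l. \<forall>z\<in>Z d. ev s z * ev (A k l) z = (\<Sum>j\<in>J. ev (A k j) z * ev (\<rho> j l) z)"
    by (rule fraction_free_elimination[OF Zd row])
  hence elim: "ev s z * ev (A k l) z = (\<Sum>j\<in>J. ev (A k j) z * ev (\<rho> j l) z)" if "z \<in> Z d" for k l z
    using that by blast
  have s: "s \<in> polys S" "\<not> vanishes (Z d) s" and \<rho>S: "\<And>j l. j \<in> J \<Longrightarrow> \<rho> j l \<in> polys S"
    using piv by (auto simp: pivots_def row_relation_def)
  obtain t c where tc: "t + c = card S" "growth (Z d) S t" "tangent_codim (Z d) S c"
    by (rule growth_tangent[OF Zd])
  have cS: "card S = CARD('n1)" by (simp add: S_def card_image)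
  have "S \<union> range Inr = UNIV" unfolding S_def by (metis UNIV_sum)
  hence "growth (Z d) UNIV (t + card (- J))" using growth_pivots[OF Zd tc(2) piv] by simp
  hence "d \<le> t + card (- J)" by (intro chain_length_le_growth[of d Z] chain)
  moreover have "card J \<le> CARD('n2)" by (rule card_mono) auto
  hence "card (- J) + card J = CARD('n2)" by (simp add: Compl_eq_Diff_UNIV card_Diff_subset)
  ultimately have dim: "d + c + card J \<le> CARD('n1) + CARD('n2)" using tc(1) cS by linarith
  obtain s' Q where s': "s' \<in> polys UNIV" "\<not> vanishes (Z d) s'" and Q: "Q \<subseteq> polys UNIV" "finite Q" "card Q \<le> c"
    and tan: "\<And>z v P. z \<in> Z d \<Longrightarrow> ev s' z \<noteq> 0 \<Longrightarrow> (\<And>p. p \<in> Q \<Longrightarrow> dv p z v = 0) \<Longrightarrow> P \<in> polys S \<Longrightarrow>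
      vanishes (Z d) P \<Longrightarrow> dv P z v = 0"
    using tc(3) unfolding tangent_codim_def by metis
  have "\<not> vanishes (Z d) (s * s')"
    using prime_setD[OF Zd polys_UNIV[OF s(1)] s'(1)] s(2) s'(2) by blast
  then obtain z where z: "z \<in> Z d" "ev s z \<noteq> 0" "ev s' z \<noteq> 0" by (auto simp: vanishes_def)
  \<comment> \<open>Directions with zero y-part suffice, as the differentiated identities involve
    only x. The members of \<open>Q\<close> may involve y, but still impose at most c equations on
    x.\<close>
  define emb :: "'k ^ 'n1 \<Rightarrow> 'k ^ ('n1 + 'n2)"
    where "emb = (\<lambda>x. \<chi> i. case i of Inl a \<Rightarrow> x $ a | Inr b \<Rightarrow> 0)"
  have emb: "emb (x + x') = emb x + emb x'" "emb (a *s x) = a *s emb x" for x x' a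
    by (auto simp: emb_def vec_eq_iff split: sum.split)
  \<comment> \<open>The value 0 outside \<open>Q\<close> makes \<open>f1 p\<close> linear for every
    \<open>p\<close>, as \<open>common_kernel_dim\<close> demands.\<close>
  define f1 where "f1 = (\<lambda>p x. if p \<in> Q then dv p z (emb x) else 0)"
  define f2 where "f2 = (\<lambda>j (u :: 'k ^ 'n2). \<Sum>m\<in>UNIV. ev (\<rho> j m) z * u $ m)"
  define f3 where "f3 = (\<lambda>j (w :: 'k ^ 'n3). \<Sum>k\<in>UNIV. w $ k * ev (A k j) z)"
  have l1: "f1 p (x + x') = f1 p x + f1 p x'" "f1 p (a *s x) = a * f1 p x" for p x x' a
    using Q(1) dv_linear[of p UNIV] by (auto simp: f1_def emb)
  have l2: "f2 p (x + x') = f2 p x + f2 p x'" "f2 p (a *s x) = a * f2 p x" for p x x' a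
    by (auto simp: f2_def algebra_simps sum.distrib sum_distrib_left)
  have l3: "f3 p (x + x') = f3 p x + f3 p x'" "f3 p (a *s x) = a * f3 p x" for p x x' a
    by (auto simp: f3_def algebra_simps sum.distrib sum_distrib_left)
  have van: "trilinear_form T x u w = 0"
    if x: "\<forall>p\<in>Q. f1 p x = 0" and u: "\<forall>j\<in>J. f2 j u = 0" and w: "\<forall>j\<in>J. f3 j w = 0" for x u w
  proof -
    define a b where "a = (\<lambda>k m. ev (A k m) z)" and "b = (\<lambda>k m. dv (A k m) z (emb x))"
    define wa wb where "wa = (\<lambda>m. \<Sum>k\<in>UNIV. w $ k * a k m)" and "wb = (\<lambda>m. \<Sum>k\<in>UNIV. w $ k * b k m)"
    have b: "b k m = (\<Sum>i\<in>UNIV. T $ i $ m $ k * x $ i)" for k m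
      unfolding b_def A_def dv_sum
      by (intro sum.cong) (simp_all add: dv_mult[OF polys_Const[of _ UNIV] polys_Var[OF UNIV_I]] emb_def)
    have waJ: "wa j = 0" if "j \<in> J" for j using w that by (simp add: wa_def f3_def a_def)
    \<comment> \<open>At \<open>z\<close> all columns are combinations of the pivot columns, so
      \<open>w\<close> annihilates them all.\<close>
    have wa: "wa l = 0" for l
    proof -
      have "ev s z * wa l = (\<Sum>k\<in>UNIV. w $ k * (ev s z * a k l))"
        by (simp add: wa_def sum_distrib_left mult_ac)
      also have "\<dots> = (\<Sum>k\<in>UNIV. \<Sum>j\<in>J. w $ k * a k j * ev (\<rho> j l) z)"
        using elim[OF z(1)] by (simp add: a_def sum_distrib_left mult_ac)
      also have "\<dots> = (\<Sum>j\<in>J. wa j * ev (\<rho> j l) z)"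
        by (subst sum.swap) (simp add: wa_def sum_distrib_right)
      also have "\<dots> = 0" using waJ by (intro sum.neutral) simp
      finally show ?thesis using z(2) by simp
    qed
    have "ev s z * b k l + dv s z (emb x) * a k l =
        (\<Sum>j\<in>J. a k j * dv (\<rho> j l) z (emb x) + b k j * ev (\<rho> j l) z)" for k l
    proof -
      have "dv (s * A k l - (\<Sum>j\<in>J. A k j * \<rho> j l)) z (emb x) = 0"
      proof (rule tan[OF z(1,3)])
        show "dv p z (emb x) = 0" if "p \<in> Q" for p using x that by (simp add: f1_def)
        show "s * A k l - (\<Sum>j\<in>J. A k j * \<rho> j l) \<in> polys S"
          by (intro polys_diff polys_mult polys_sum s AS \<rho>S)
        show "vanishes (Z d) (s * A k l - (\<Sum>j\<in>J. A k j * \<rho> j l))"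
          using elim by (simp add: vanishes_def)
      qed
      hence "dv (s * A k l) z (emb x) = (\<Sum>j\<in>J. dv (A k j * \<rho> j l) z (emb x))" by simp
      also have "(\<Sum>j\<in>J. dv (A k j * \<rho> j l) z (emb x)) =
          (\<Sum>j\<in>J. a k j * dv (\<rho> j l) z (emb x) + b k j * ev (\<rho> j l) z)"
        by (intro sum.cong) (auto simp: dv_mult[OF AS \<rho>S] a_def b_def)
      finally show ?thesis by (simp add: dv_mult[OF s(1) AS] a_def b_def)
    qed
    hence "(\<Sum>k\<in>UNIV. w $ k * (ev s z * b k l + dv s z (emb x) * a k l)) =
        (\<Sum>k\<in>UNIV. \<Sum>j\<in>J. w $ k * a k j * dv (\<rho> j l) z (emb x) + w $ k * b k j * ev (\<rho> j l) z)" for l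
      by (simp add: sum_distrib_left algebra_simps)
    moreover have "(\<Sum>k\<in>UNIV. w $ k * (ev s z * b k l + dv s z (emb x) * a k l)) =
        ev s z * wb l + dv s z (emb x) * wa l" for l
      by (simp add: wa_def wb_def sum_distrib_left algebra_simps sum.distrib)
    moreover have "(\<Sum>k\<in>UNIV. \<Sum>j\<in>J. w $ k * a k j * dv (\<rho> j l) z (emb x) + w $ k * b k j * ev (\<rho> j l) z) =
        (\<Sum>j\<in>J. wa j * dv (\<rho> j l) z (emb x) + wb j * ev (\<rho> j l) z)" for l
      by (subst sum.swap) (simp add: wa_def wb_def sum_distrib_right sum.distrib)
    \<comment> \<open>Contraction with \<open>w\<close> removes the terms with \<open>wa\<close>.
      What remains exhibits \<open>wb\<close>, the product of \<open>w\<close> with the matrix at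
      \<open>x\<close>, as a combination of the rows of \<rho>, which annihilate
      \<open>u\<close>.\<close>
    ultimately have wb: "ev s z * wb l = (\<Sum>j\<in>J. wb j * ev (\<rho> j l) z)" for l
      by (simp add: wa)
    have "ev s z * (\<Sum>m\<in>UNIV. wb m * u $ m) = (\<Sum>m\<in>UNIV. ev s z * wb m * u $ m)"
      by (simp add: sum_distrib_left mult.assoc)
    also have "\<dots> = (\<Sum>m\<in>UNIV. \<Sum>j\<in>J. wb j * (ev (\<rho> j m) z * u $ m))"
      unfolding wb by (simp add: sum_distrib_right mult.assoc)
    also have "\<dots> = (\<Sum>j\<in>J. wb j * f2 j u)"
      by (subst sum.swap) (simp add: f2_def sum_distrib_left)
    also have "\<dots> = 0" using u by (intro sum.neutral) simp
    finally have "(\<Sum>m\<in>UNIV. wb m * u $ m) = 0" using z(2) by simp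
    moreover have "trilinear_form T x u w = (\<Sum>m\<in>UNIV. wb m * u $ m)"
    proof -
      have "trilinear_form T x u w = (\<Sum>m\<in>UNIV. \<Sum>i\<in>UNIV. \<Sum>k\<in>UNIV. T $ i $ m $ k * x $ i * u $ m * w $ k)"
        unfolding trilinear_form_def by (rule sum.swap)
      also have "\<dots> = (\<Sum>m\<in>UNIV. \<Sum>k\<in>UNIV. \<Sum>i\<in>UNIV. T $ i $ m $ k * x $ i * u $ m * w $ k)"
        by (intro sum.cong refl sum.swap)
      also have "\<dots> = (\<Sum>m\<in>UNIV. wb m * u $ m)"
        by (simp add: wb_def b sum_distrib_left sum_distrib_right mult_ac)
      finally show ?thesis .
    qed
    ultimately show ?thesis by simp
  qed
  show ?thesis
  proof (rule that[of "{x. \<forall>p\<in>Q. f1 p x = 0}" "{u. \<forall>j\<in>J. f2 j u = 0}" "{w. \<forall>j\<in>J. f3 j w = 0}" c "card J"])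
    show "CARD('n1) \<le> vec.dim {x. \<forall>p\<in>Q. f1 p x = 0} + c"
      using common_kernel_dim(2)[where f = f1, OF Q(2) l1] Q(3) by linarith
    show "CARD('n2) \<le> vec.dim {u. \<forall>j\<in>J. f2 j u = 0} + card J"
      by (rule common_kernel_dim(2)[where f = f2, OF finite l2])
    show "CARD('n3) \<le> vec.dim {w. \<forall>j\<in>J. f3 j w = 0} + card J"
      by (rule common_kernel_dim(2)[where f = f3, OF finite l3])
    show "vec.subspace {x. \<forall>p\<in>Q. f1 p x = 0}" by (rule common_kernel_dim(1)[where f = f1, OF Q(2) l1])
    show "vec.subspace {u. \<forall>j\<in>J. f2 j u = 0}" by (rule common_kernel_dim(1)[where f = f2, OF finite l2])
    show "vec.subspace {w. \<forall>j\<in>J. f3 j w = 0}" by (rule common_kernel_dim(1)[where f = f3, OF finite l3])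
  qed (use van dim in auto)
qed

lemma slice_rank_le_chain:
  fixes T :: "('a::field, 'n1::finite, 'n2::finite, 'n3::finite) tensor3"
  assumes perfect: "perfect_field TYPE('a)"
    and chain: "\<And>i. i \<le> d \<Longrightarrow> irreducible_closed (Z i)" "\<And>i. i < d \<Longrightarrow> Z i \<subset> Z (Suc i)" "Z d \<subseteq> kernel_variety T"
  shows "d \<le> CARD('n1) + CARD('n2)" "slice_rank T \<le> 3 * (CARD('n1) + CARD('n2) - d)"
proof -
  have ker: "bilinear_map (tensor_to_ac T) (\<chi> i. z $ Inl i) (\<chi> j. z $ Inr j) = 0" if "z \<in> Z d" for z
    using that chain(3) by (auto simp: kernel_variety_def)
  obtain U1 U2 U3 c r where U: "vec.subspace U1" "vec.subspace U2" "vec.subspace U3"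
    "\<forall>x\<in>U1. \<forall>y\<in>U2. \<forall>w\<in>U3. trilinear_form (tensor_to_ac T) x y w = 0"
    "CARD('n1) \<le> vec.dim U1 + c" "CARD('n2) \<le> vec.dim U2 + r" "CARD('n3) \<le> vec.dim U3 + r"
    "d + c + r \<le> CARD('n1) + CARD('n2)"
    by (rule chain_vanishing_subspaces[where Z = Z and d = d, OF chain(1,2) ker])
  show "d \<le> CARD('n1) + CARD('n2)" using U(8) by simp
  have "2 * slice_rank T \<le> 3 * ((CARD('n1) - vec.dim U1) + (CARD('n2) - vec.dim U2) + (CARD('n3) - vec.dim U3))"
    by (rule slice_rank_descent[OF perfect U(1-3)]) (use U(4) in blast)
  also have "\<dots> \<le> 3 * (c + r + r)"
    using U(5-7) by (intro mult_le_mono2 add_mono) simp_all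
  finally have "2 * slice_rank T \<le> 6 * (c + r)" by simp
  moreover have "c + r \<le> CARD('n1) + CARD('n2) - d" using U(8) by simp
  moreover have "v \<le> 3 * y" if "2 * v \<le> 6 * x" "x \<le> y" for v x y :: nat using that by linarith
  ultimately show "slice_rank T \<le> 3 * (CARD('n1) + CARD('n2) - d)" by blast
qed

theorem theorem3p1:
  fixes T :: "('a::field, 'n1::finite, 'n2::finite, 'n3::finite) tensor3"
  assumes "perfect_field TYPE('a)"
  shows "enat (slice_rank T) \<le> 3 * geometric_rank T"
proof -
  define n where "n = CARD('n1) + CARD('n2)"
  define D where "D = {enat d | d. \<exists>Z :: nat \<Rightarrow> ('a alg_closure ^ ('n1 + 'n2)) set.
        (\<forall>i\<le>d. irreducible_closed (Z i) \<and> Z i \<subseteq> kernel_variety T) \<and> (\<forall>i<d. Z i \<subset> Z (Suc i))}"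
  have D: "\<exists>d. e = enat d \<and> d \<le> n \<and> slice_rank T \<le> 3 * (n - d)" if "e \<in> D" for e
  proof -
    obtain d Z where d: "e = enat d" "\<forall>i\<le>d. irreducible_closed (Z i) \<and> Z i \<subseteq> kernel_variety T"
      "\<forall>i<d. Z i \<subset> Z (Suc i)" using \<open>e \<in> D\<close> unfolding D_def by blast
    thus ?thesis using slice_rank_le_chain[OF assms, of d Z T] unfolding n_def by blast
  qed
  have "\<exists>d. Sup D = enat d \<and> slice_rank T \<le> 3 * (n - d)"
  proof (cases "D = {}")
    \<comment> \<open>Without chains the supremum is 0 and the codimension is n; the zero subspace
      in the first argument already bounds the slice rank by 3/2 n1.\<close>
    case True
    have "2 * slice_rank T \<le> 3 * ((CARD('n1) - vec.dim {0 :: 'a alg_closure ^ 'n1}) +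
        (CARD('n2) - vec.dim (UNIV :: ('a alg_closure ^ 'n2) set)) +
        (CARD('n3) - vec.dim (UNIV :: ('a alg_closure ^ 'n3) set)))"
      by (rule slice_rank_descent[OF assms])
         (auto simp: trilinear_form_zero intro: vec.subspace_UNIV)
    hence "2 * slice_rank T \<le> 3 * CARD('n1)" unfolding vec_dim_card by simp
    hence "slice_rank T \<le> 3 * (n - 0)" unfolding n_def by simp
    thus ?thesis using True by (intro exI[of _ 0]) (simp add: bot_enat_def enat_0)
  next
    case False
    \<comment> \<open>The lengths are bounded by \<open>n\<close>, so the supremum is attained by an
      actual chain.\<close>
    have "D \<subseteq> enat ` {..n}" using D by blast
    hence "finite D" by (rule finite_subset) simp
    hence "Sup D \<in> D" using False by (simp add: Sup_enat_def)
    thus ?thesis using D by blast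
  qed
  then obtain d where d: "variety_dim (kernel_variety T) = enat d" "slice_rank T \<le> 3 * (n - d)"
    unfolding variety_dim_def D_def by blast
  have "3 * geometric_rank T = enat (3 * (n - d))"
    unfolding geometric_rank_def variety_codim_def d(1) n_def
    by (simp add: numeral_eq_enat)
  thus ?thesis using d(2) by simp
qed

end
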